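(* Let $\Omega\subset\mathbb{R}^n$ be a bounded open set with smooth boundary, $\mu>0$, $2\mu+n\lambda\ge0$, $\kappa>0$, $\gamma>1$, $R>0$, $\rho_0\in C(\bar\Omega)$ with $\rho_0>0$ in $\Omega$, $\rho_0=0$ on $\partial\Omega$, and $u_0,e_0$ continuous with $e_0\ge0$, $e_0\not\equiv0$ in $\Omega$. Then for every $T>0$ the problem $$\partial_t\rho+\operatorname{div}(\rho u)=0,\qquad \partial_t(\rho u)+\operatorname{div}(\rho u\otimes u)+\nabla p=\mu\Delta u+(\mu+\lambda)\nabla\operatorname{div}u,$$ $$\partial_t(\rho e)+\operatorname{div}(\rho e u)+p\operatorname{div}u=\tfrac{\mu}{2}|\nabla u+(\nabla u)^T|^2+\lambda(\operatorname{div}u)^2+\tfrac{\kappa(\gamma-1)}{R}\Delta e\qquad\text{in }\Omega\times(0,T],$$ with $p=(\gamma-1)\rho e$, $(\rho,u,e)=(\rho_0,u_0,e_0)$ on $\Omega\times\{t=0\}$, and $e=\partial_{x_i}e=0$ ($i=1,\dots,n$) on $\partial\Omega\times(0,T]$, has no solution $(\rho,u,e)$ in $C^{2,1}(\bar\Omega\times[0,T])$.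
   Context: $C^{2,1}(\bar\Omega\times[0,T])$ denotes functions that are $C^2$ in $x$ and $C^1$ in $t$ on $\bar\Omega\times[0,T]$. *)

theory Defs
  imports "HOL-Analysis.Analysis"
begin

definition partial_at :: "'n::finite \<Rightarrow> (real^'n \<Rightarrow> 'b::real_normed_vector) \<Rightarrow> real^'n \<Rightarrow> 'b" where
  "partial_at i f x = vector_derivative (\<lambda>s. f (x + s *\<^sub>R axis i 1)) (at 0)"

definition dx :: "'n::finite \<Rightarrow> (real^'n \<Rightarrow> real \<Rightarrow> 'b::real_normed_vector) \<Rightarrow> real^'n \<Rightarrow> real \<Rightarrow> 'b" where
  "dx i f x t = partial_at i (\<lambda>y. f y t) x"

definition dt :: "real \<Rightarrow> (real^'n::finite \<Rightarrow> real \<Rightarrow> 'b::real_normed_vector) \<Rightarrow> real^'n \<Rightarrow> real \<Rightarrow> 'b" where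
  "dt T f x t = vector_derivative (\<lambda>s. f x s) (at t within {0..T})"

fun Ck :: "nat \<Rightarrow> (real^'n::finite) set \<Rightarrow> (real^'n \<Rightarrow> real) \<Rightarrow> bool" where
  "Ck 0 U f = continuous_on U f"
| "Ck (Suc k) U f = (continuous_on U f \<and>
      (\<forall>i. \<forall>x\<in>U. (\<lambda>s. f (x + s *\<^sub>R axis i 1)) differentiable (at 0)) \<and>
      (\<forall>i. Ck k U (partial_at i f)))"

definition smooth_on :: "(real^'n::finite) set \<Rightarrow> (real^'n \<Rightarrow> real) \<Rightarrow> bool" where
  "smooth_on U f = (\<forall>k. Ck k U f)"

definition smooth_boundary :: "(real^'n::finite) set \<Rightarrow> bool" where
  "smooth_boundary \<Omega> = (\<forall>x0\<in>frontier \<Omega>. \<exists>U \<phi>. open U \<and> x0 \<in> U \<and> smooth_on U \<phi> \<and>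
      (\<forall>x\<in>U. (\<chi> i. partial_at i \<phi> x) \<noteq> 0) \<and> \<Omega> \<inter> U = {x\<in>U. \<phi> x < 0})"

definition cont_ext :: "(real^'n::finite) set \<Rightarrow> real \<Rightarrow> (real^'n \<Rightarrow> real \<Rightarrow> 'b::real_normed_vector) \<Rightarrow> bool" where
  "cont_ext \<Omega> T g = (\<exists>h. continuous_on (closure \<Omega> \<times> {0..T}) (\<lambda>(x,t). h x t) \<and>
      (\<forall>x\<in>\<Omega>. \<forall>t\<in>{0..T}. h x t = g x t))"

definition C21 :: "(real^'n::finite) set \<Rightarrow> real \<Rightarrow> (real^'n \<Rightarrow> real \<Rightarrow> 'b::real_normed_vector) \<Rightarrow> bool" where
  "C21 \<Omega> T f = (continuous_on (closure \<Omega> \<times> {0..T}) (\<lambda>(x,t). f x t) \<and>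
     (\<forall>x\<in>\<Omega>. \<forall>t\<in>{0..T}.
        (\<forall>i. (\<lambda>s. f (x + s *\<^sub>R axis i 1) t) differentiable (at 0)) \<and>
        (\<forall>i j. (\<lambda>s. dx i f (x + s *\<^sub>R axis j 1) t) differentiable (at 0)) \<and>
        (\<lambda>s. f x s) differentiable (at t within {0..T})) \<and>
     (\<forall>i. cont_ext \<Omega> T (dx i f)) \<and>
     (\<forall>i j. cont_ext \<Omega> T (dx j (dx i f))) \<and>
     cont_ext \<Omega> T (dt T f))"

end

theory Submission
  imports Defs
begin

text \<open>No boundary condition is imposed on the velocity, so gas may flow into \<Omega>, and then nothing
  prevents the density from becoming negative near the boundary, where the equation for \<open>e\<close> is
  backward parabolic. Only short times \<open>\<tau>\<close> are used. Transport then confines \<open>\<rho> < 0\<close> to a boundary strip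
  of width \<open>O(\<tau>)\<close>, on which \<open>\<rho> \<ge> - C \<tau>\<close>.

  Eliminating \<open>\<partial>\<^sub>t \<rho>\<close> with the continuity equation and dropping the nonnegative dissipation,
  \<open>e\<close> is a supersolution of \<open>\<rho> (\<partial>\<^sub>t e + u \<cdot> \<nabla>e + (\<gamma> - 1) e div u) = \<kappa>' \<Delta>e\<close>. Since a minimum at an interior
  time has \<open>\<partial>\<^sub>t = 0\<close>, the comparison principle holds whatever the sign of \<open>\<rho>\<close>, provided that
  the barrier lies below \<open>e\<close> also at the final time. The barrier is \<open>G - M Z\<close>. Here \<open>G\<close> is a Hopf barrier supported in a ball which grows,
  between times \<open>0\<close> and \<open>\<tau>/2\<close>, from a small ball on which \<open>e > 0\<close> initially to a ball
  touching \<open>\<partial>\<Omega>\<close>; near the contact point \<open>G\<close> has slope at least \<open>exp (- c/\<tau>)\<close>. The function \<open>Z\<close> absorbs the final values: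
  \<open>Z = exp (B (t - \<tau>)/\<tau>\<^sup>2) \<zeta>(x)\<close>, where \<open>\<zeta>\<close> is superharmonic and very concave in the strip, which
  allows \<open>B\<close> to be as large as desired, so that at time \<open>\<tau>/2\<close> the term \<open>M Z\<close> is
  \<open>O(exp (- B/(2\<tau>)))\<close>. As \<open>e = 0\<close>, \<open>\<nabla>e = 0\<close> at the contact point and the second derivatives are bounded, \<open>e\<close> grows
  at most quadratically there, which contradicts the lower bound when \<open>\<tau>\<close> is small.\<close>

section \<open>Partial derivatives along the coordinate axes\<close>

text \<open>The second derivative test for \<open>f'\<close> differentiable at 0: if
  \<open>D\<close> were negative, \<open>f'\<close> would be negative on some interval to the right
  of 0, and the mean value theorem would push \<open>f\<close> below \<open>f 0\<close>.\<close>

lemma second_derivative_nonneg_at_min: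
  fixes f f' :: "real \<Rightarrow> real"
  assumes r: "r > 0"
    and f: "\<And>s. \<bar>s\<bar> < r \<Longrightarrow> (f has_real_derivative f' s) (at s)"
    and f': "(f' has_real_derivative D) (at 0)"
    and min: "\<And>s. \<bar>s\<bar> < r \<Longrightarrow> f 0 \<le> f s"
  shows "f' 0 = 0" "D \<ge> 0"
proof -
  show z: "f' 0 = 0"
    using DERIV_local_min[OF f[of 0] r] min r by auto
  show "D \<ge> 0"
  proof (rule ccontr)
    assume "\<not> D \<ge> 0"
    then obtain d where d: "d > 0" "\<And>h. 0 < h \<Longrightarrow> h < d \<Longrightarrow> f' (0 + h) < f' 0"
      using has_real_derivative_neg_dec_right[OF f'] by auto
    define h where "h = min d r / 2"
    have h: "0 < h" "h < d" "h < r" using d r by (auto simp: h_def min_def)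
    have "\<exists>z>0. z < h \<and> f h - f 0 = (h - 0) * f' z"
      using h by (intro MVT2) (auto intro!: f)
    then obtain s where s: "0 < s" "s < h" "f h - f 0 = h * f' s" by auto
    have "f' s < 0" using d(2)[of s] s h z by auto
    hence "f h < f 0" using s h by (smt (verit) mult_pos_neg)
    thus False using min[of h] h by auto
  qed
qed

text \<open>Derivatives are recorded at parameter 0 with a moving base point. Translating the
  parameter yields the derivative at any point of a coordinate line, as mean value arguments
  require.\<close>

lemma DERIV_along_axis:
  fixes f :: "real^'n \<Rightarrow> real"
  assumes "((\<lambda>h. f ((x + s *\<^sub>R axis i 1) + h *\<^sub>R axis i 1)) has_real_derivative D) (at 0)"
  shows "((\<lambda>h. f (x + h *\<^sub>R axis i 1)) has_real_derivative D) (at s)"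
proof -
  have "((\<lambda>h. f (x + (s + h) *\<^sub>R axis i 1)) has_real_derivative D) (at 0)"
    using assms by (simp add: scaleR_add_left add.assoc)
  thus ?thesis using DERIV_shift[of "\<lambda>h. f (x + h *\<^sub>R axis i 1)" D 0 s]
    by (simp add: add.commute)
qed

text \<open>Partial derivatives alone give no total derivative, so the path from \<open>x\<close> to
  \<open>y\<close> changes one coordinate at a time. Each step is a one-dimensional mean value
  estimate, whence the factor \<open>CARD('n)\<close>.\<close>

lemma partial_bound_imp_lipschitz:
  fixes f :: "real^'n \<Rightarrow> real"
  assumes f: "\<And>z i. z \<in> ball x r \<Longrightarrow> ((\<lambda>s. f (z + s *\<^sub>R axis i 1)) has_real_derivative f1 i z) (at 0)"
    and B: "\<And>z i. z \<in> ball x r \<Longrightarrow> \<bar>f1 i z\<bar> \<le> B"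
    and y: "norm (y - x) < r"
  shows "\<bar>f y - f x\<bar> \<le> real CARD('n) * B * norm (y - x)"
proof -
  define h where "h = y - x"
  \<comment> \<open>\<open>p S\<close> is \<open>x\<close> with the coordinates in \<open>S\<close>
    already replaced by those of \<open>y\<close>.\<close>
  define p where "p = (\<lambda>S. x + (\<Sum>i\<in>S. h $ i *\<^sub>R axis i (1::real)))"
  have comp: "(\<Sum>i\<in>S. h $ i *\<^sub>R axis i (1::real)) $ j = (if j \<in> S then h $ j else 0)"
    if "finite S" for S j
    using that by (induction S rule: finite_induct) (auto simp: axis_def)
  \<comment> \<open>Every intermediate displacement is dominated by \<open>h\<close> in each
    component, so the broken path stays in the ball.\<close>
  have inball: "p S + s *\<^sub>R axis i 1 \<in> ball x r"
    if "i \<notin> S" "\<bar>s\<bar> \<le> \<bar>h $ i\<bar>" for S i s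
  proof -
    have "\<bar>(p S + s *\<^sub>R axis i 1 - x) $ j\<bar> \<le> \<bar>h $ j\<bar>" for j
      using that comp[of S j] by (auto simp: p_def axis_def)
    hence "norm (p S + s *\<^sub>R axis i 1 - x) \<le> norm h"
      by (intro norm_le_componentwise_cart) auto
    thus ?thesis using y by (simp add: h_def dist_norm norm_minus_commute)
  qed
  have B0: "B \<ge> 0"
    using B[of x undefined] le_less_trans[OF norm_ge_zero y] by simp
  have step: "\<bar>f (p (insert i S)) - f (p S)\<bar> \<le> B * norm h" if "i \<notin> S" "finite S" for i S
  proof -
    define g where "g = (\<lambda>s. f (p S + s *\<^sub>R axis i 1))"
    have dg: "(g has_real_derivative f1 i (p S + s *\<^sub>R axis i 1)) (at s)"
      if "\<bar>s\<bar> \<le> \<bar>h $ i\<bar>" for s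
      unfolding g_def using inball[OF \<open>i \<notin> S\<close> that] by (rule DERIV_along_axis[OF f])
    have "norm (g (h $ i) - g 0) \<le> B * norm (h $ i - 0)"
    proof (rule field_differentiable_bound[where S="{-\<bar>h $ i\<bar>..\<bar>h $ i\<bar>}" and f'="\<lambda>s. f1 i (p S + s *\<^sub>R axis i 1)"])
      fix s assume "s \<in> {-\<bar>h $ i\<bar>..\<bar>h $ i\<bar>}"
      hence s: "\<bar>s\<bar> \<le> \<bar>h $ i\<bar>" by auto
      show "(g has_field_derivative f1 i (p S + s *\<^sub>R axis i 1)) (at s within {-\<bar>h $ i\<bar>..\<bar>h $ i\<bar>})"
        using dg[OF s] by (rule has_field_derivative_at_within)
      show "norm (f1 i (p S + s *\<^sub>R axis i 1)) \<le> B"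
        using B[OF inball[OF \<open>i \<notin> S\<close> s]] by simp
    qed auto
    moreover have "g (h $ i) = f (p (insert i S))" "g 0 = f (p S)"
      using that by (simp_all add: g_def p_def ac_simps)
    moreover have "B * \<bar>h $ i\<bar> \<le> B * norm h"
      by (intro mult_left_mono component_le_norm_cart B0)
    ultimately show ?thesis by simp
  qed
  have "\<bar>f (p S) - f (p {})\<bar> \<le> real (card S) * (B * norm h)" if "finite S" for S
    using that
  proof (induction S rule: finite_induct)
    case (insert i S)
    thus ?case using step[of i S] by (simp add: algebra_simps)
  qed auto
  from this[of UNIV] have "\<bar>f (p UNIV) - f (p {})\<bar> \<le> real CARD('n) * (B * norm h)" by simp
  moreover have "p UNIV = y" using comp[of UNIV] by (auto simp: p_def vec_eq_iff h_def)
  moreover have "p {} = x" by (simp add: p_def)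
  ultimately show ?thesis by (simp add: h_def mult.assoc)
qed

text \<open>Test functions enter the comparison through their gradient and Laplacian at one point,
  so the notion records first and pure second derivatives along the axes. They are explicit
  arguments, so that the closure rules below compute them syntactically.\<close>

definition axis_C2 where
  "axis_C2 U f f1 f2 \<longleftrightarrow> (\<forall>x\<in>U. \<forall>i::'n::finite.
     ((\<lambda>s. f (x + s *\<^sub>R axis i (1::real))) has_real_derivative f1 i x) (at 0) \<and>
     ((\<lambda>s. f1 i (x + s *\<^sub>R axis i 1)) has_real_derivative f2 i x) (at 0))"

lemma axis_C2_D:
  assumes "axis_C2 U f f1 f2" "x \<in> U"
  shows "((\<lambda>s. f (x + s *\<^sub>R axis i 1)) has_real_derivative f1 i x) (at 0)"
    "((\<lambda>s. f1 i (x + s *\<^sub>R axis i 1)) has_real_derivative f2 i x) (at 0)"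
  using assms by (auto simp: axis_C2_def)

lemma axis_C2_subset: "axis_C2 U f f1 f2 \<Longrightarrow> V \<subseteq> U \<Longrightarrow> axis_C2 V f f1 f2"
  by (auto simp: axis_C2_def)

lemma axis_C2_const: "axis_C2 U (\<lambda>x. c) (\<lambda>i x. 0) (\<lambda>i x. 0)"
  by (auto simp: axis_C2_def)

lemma axis_C2_add:
  assumes "axis_C2 U f f1 f2" "axis_C2 U g g1 g2"
  shows "axis_C2 U (\<lambda>x. f x + g x) (\<lambda>i x. f1 i x + g1 i x) (\<lambda>i x. f2 i x + g2 i x)"
  using assms by (auto simp: axis_C2_def intro!: DERIV_add)

lemma axis_C2_diff:
  assumes "axis_C2 U f f1 f2" "axis_C2 U g g1 g2"
  shows "axis_C2 U (\<lambda>x. f x - g x) (\<lambda>i x. f1 i x - g1 i x) (\<lambda>i x. f2 i x - g2 i x)"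
  using assms by (auto simp: axis_C2_def intro!: DERIV_diff)

lemma axis_C2_cmult:
  assumes "axis_C2 U f f1 f2"
  shows "axis_C2 U (\<lambda>x. c * f x) (\<lambda>i x. c * f1 i x) (\<lambda>i x. c * f2 i x)"
  using assms by (auto simp: axis_C2_def intro!: DERIV_cmult)

lemma axis_C2_exp:
  assumes "axis_C2 U f f1 f2"
  shows "axis_C2 U (\<lambda>x. exp (f x)) (\<lambda>i x. exp (f x) * f1 i x)
    (\<lambda>i x. exp (f x) * ((f1 i x)\<^sup>2 + f2 i x))"
  unfolding axis_C2_def
proof (intro ballI allI conjI)
  fix x i assume x: "x \<in> U"
  note d = axis_C2_D[OF assms x, of i]
  show e: "((\<lambda>s. exp (f (x + s *\<^sub>R axis i 1))) has_real_derivative exp (f x) * f1 i x) (at 0)"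
    using DERIV_chain2[OF DERIV_exp, OF d(1)] by simp
  show "((\<lambda>s. exp (f (x + s *\<^sub>R axis i 1)) * f1 i (x + s *\<^sub>R axis i 1)) has_real_derivative
        exp (f x) * ((f1 i x)\<^sup>2 + f2 i x)) (at 0)"
    using DERIV_mult[OF e d(2)] by (simp add: algebra_simps power2_eq_square)
qed

lemma axis_C2_dist2:
  "axis_C2 U (\<lambda>x. (norm (x - y))\<^sup>2) (\<lambda>i x. 2 * (x - y) $ i) (\<lambda>i x. 2)"
  unfolding axis_C2_def
proof (intro ballI allI conjI)
  fix x i
  have "(norm (x + s *\<^sub>R axis i 1 - y))\<^sup>2 = (norm (x - y))\<^sup>2 + 2 * s * (x - y) $ i + s\<^sup>2" for s
  proof -
    have "x + s *\<^sub>R axis i 1 - y = (x - y) + s *\<^sub>R axis i 1" by simp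
    thus ?thesis
      by (simp only: power2_norm_eq_inner)
        (simp add: inner_add_left inner_add_right inner_axis inner_axis' inner_commute algebra_simps power2_eq_square)
  qed
  thus "((\<lambda>s. (norm (x + s *\<^sub>R axis i 1 - y))\<^sup>2) has_real_derivative 2 * (x - y) $ i) (at 0)"
    by (auto intro!: derivative_eq_intros)
  show "((\<lambda>s. 2 * (x + s *\<^sub>R axis i 1 - y) $ i) has_real_derivative 2) (at 0)"
    by (auto intro!: derivative_eq_intros simp: axis_def)
qed

text \<open>The one-dimensional test along each axis; summing the second part over \<open>i\<close>
  gives a nonnegative Laplacian at a minimum.\<close>

lemma axis_C2_at_min:
  fixes x :: "real^'n"
  assumes f: "axis_C2 (ball x r) f f1 f2" and r: "r > 0"
    and min: "\<And>y. y \<in> ball x r \<Longrightarrow> f x \<le> f y"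
  shows "f1 i x = 0" "f2 i x \<ge> 0"
proof -
  let ?g = "\<lambda>s. f (x + s *\<^sub>R axis i 1)" and ?g' = "\<lambda>s. f1 i (x + s *\<^sub>R axis i 1)"
  have b: "x + s *\<^sub>R axis i 1 \<in> ball x r" if "\<bar>s\<bar> < r" for s
    using that by (simp add: dist_norm)
  have 1: "(?g has_real_derivative ?g' s) (at s)" if "\<bar>s\<bar> < r" for s
    using axis_C2_D(1)[OF f b[OF that]] by (rule DERIV_along_axis)
  have 2: "(?g' has_real_derivative f2 i x) (at 0)"
    using axis_C2_D(2)[OF f] r by simp
  have 3: "?g 0 \<le> ?g s" if "\<bar>s\<bar> < r" for s using min[OF b[OF that]] by simp
  from second_derivative_nonneg_at_min[where f="?g", OF r 1 2 3]
  show "f1 i x = 0" "f2 i x \<ge> 0" by simp_all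
qed

section \<open>Charts at a smooth boundary\<close>

lemma has_partial_at:
  fixes f :: "real^'n \<Rightarrow> real"
  assumes "(\<lambda>s. f (x + s *\<^sub>R axis i 1)) differentiable (at 0)"
  shows "((\<lambda>s. f (x + s *\<^sub>R axis i 1)) has_real_derivative partial_at i f x) (at 0)"
  using assms unfolding partial_at_def has_real_derivative_iff_has_vector_derivative
  by (simp add: vector_derivative_works)

text \<open>A single constant \<open>K\<close> controls the inverse radius, the derivatives and the
  inverse squared gradient, so that finitely many charts can share it. The data live on the doubled
  ball: a ball of radius \<open>r\<close> around a point of \<open>ball c r\<close> then still lies
  in the chart.\<close>

definition boundary_chart where
  "boundary_chart \<Omega> K c r \<phi> \<phi>1 \<phi>2 \<longleftrightarrow> 0 < r \<and> 1 / r \<le> K \<and>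
     continuous_on (ball c (2 * r)) \<phi> \<and> axis_C2 (ball c (2 * r)) \<phi> \<phi>1 \<phi>2 \<and>
     (\<forall>x\<in>ball c (2 * r). (\<forall>i. \<bar>\<phi>1 i x\<bar> \<le> K \<and> \<bar>\<phi>2 i x\<bar> \<le> K) \<and>
        1 / K \<le> (\<Sum>i\<in>UNIV. (\<phi>1 i x)\<^sup>2) \<and> (x \<in> \<Omega> \<longrightarrow> \<phi> x < 0) \<and> (x \<in> frontier \<Omega> \<longrightarrow> \<phi> x = 0))"

lemma boundary_chart_mono:
  assumes "boundary_chart \<Omega> K c r \<phi> \<phi>1 \<phi>2" "0 < K" "K \<le> K'"
  shows "boundary_chart \<Omega> K' c r \<phi> \<phi>1 \<phi>2"
proof -
  have "1 / K' \<le> 1 / K" using assms by (simp add: frac_le)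
  thus ?thesis using assms unfolding boundary_chart_def by (meson order_trans)
qed

text \<open>On a closed ball inside the neighbourhood of the local defining function, compactness
  bounds the derivatives and gives the continuous, nowhere vanishing squared gradient a positive
  minimum.\<close>

lemma boundary_chart_exists:
  fixes \<Omega> :: "(real^'n) set"
  assumes op: "open \<Omega>" and sb: "smooth_boundary \<Omega>" and c: "c \<in> frontier \<Omega>"
  shows "\<exists>K r \<phi> \<phi>1 \<phi>2. 1 \<le> K \<and> boundary_chart \<Omega> K c r \<phi> \<phi>1 \<phi>2"
proof -
  obtain U \<phi> where U\<phi>: "open U \<and> c \<in> U \<and> smooth_on U \<phi> \<and>
      (\<forall>x\<in>U. (\<chi> i. partial_at i \<phi> x) \<noteq> 0) \<and> \<Omega> \<inter> U = {x\<in>U. \<phi> x < 0}"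
    using bspec[OF sb[unfolded smooth_boundary_def] c] by (elim exE)
  hence U: "open U" "c \<in> U" "smooth_on U \<phi>"
      and grad: "\<And>x. x \<in> U \<Longrightarrow> (\<chi> i. partial_at i \<phi> x) \<noteq> 0"
      and neg: "\<Omega> \<inter> U = {x\<in>U. \<phi> x < 0}"
    by simp_all
  have ck: "Ck (Suc (Suc 0)) U \<phi>" using U(3) by (simp only: smooth_on_def)
  define \<phi>1 where "\<phi>1 = (\<lambda>i. partial_at i \<phi>)"
  define \<phi>2 where "\<phi>2 = (\<lambda>i. partial_at i (\<phi>1 i))"
  have cont: "continuous_on U \<phi>" "\<And>i. continuous_on U (\<phi>1 i)" "\<And>i. continuous_on U (\<phi>2 i)"
    using ck by (simp_all add: \<phi>1_def \<phi>2_def)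
  have C2: "axis_C2 U \<phi> \<phi>1 \<phi>2"
    using ck unfolding axis_C2_def \<phi>1_def \<phi>2_def by (auto intro!: has_partial_at)
  obtain \<delta> where \<delta>: "\<delta> > 0" "cball c \<delta> \<subseteq> U"
    using U open_contains_cball by blast
  define r where "r = \<delta> / 2"
  have r: "r > 0" "cball c (2 * r) \<subseteq> U" using \<delta> by (auto simp: r_def)
  let ?S = "cball c (2 * r)"
  have bdd: "\<exists>B. \<forall>x\<in>?S. \<bar>f x\<bar> \<le> B" if "continuous_on U f" for f :: "real^'n \<Rightarrow> real"
  proof -
    have "compact (f ` ?S)"
      using that r(2) by (intro compact_continuous_image continuous_on_subset[OF that]) auto
    thus ?thesis using compact_imp_bounded bounded_iff by (metis image_eqI real_norm_def)
  qed
  obtain B1 where B1: "\<And>i x. x \<in> ?S \<Longrightarrow> \<bar>\<phi>1 i x\<bar> \<le> B1 i" using bdd[OF cont(2)] by metis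
  obtain B2 where B2: "\<And>i x. x \<in> ?S \<Longrightarrow> \<bar>\<phi>2 i x\<bar> \<le> B2 i" using bdd[OF cont(3)] by metis
  define G where "G = (\<lambda>x. \<Sum>i\<in>UNIV. (\<phi>1 i x)\<^sup>2)"
  have Gc: "continuous_on ?S G"
    unfolding G_def by (intro continuous_intros continuous_on_subset[OF cont(2) r(2)])
  have Gpos: "G x > 0" if "x \<in> ?S" for x
  proof -
    have "\<exists>i. \<phi>1 i x \<noteq> 0" using grad[of x] that r(2) by (auto simp: vec_eq_iff \<phi>1_def)
    then obtain i where "\<phi>1 i x \<noteq> 0" ..
    hence "0 < (\<phi>1 i x)\<^sup>2" by simp
    also have "\<dots> \<le> G x" unfolding G_def by (rule member_le_sum) auto
    finally show ?thesis .
  qed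
  have "?S \<noteq> {}" using r by auto
  then obtain xm where xm: "xm \<in> ?S" "\<And>x. x \<in> ?S \<Longrightarrow> G xm \<le> G x"
    using continuous_attains_inf[OF compact_cball _ Gc] by blast
  define K where "K = Max (insert 1 (insert (1/r) (insert (1 / G xm) (range B1 \<union> range B2))))"
  have fin: "finite (insert 1 (insert (1/r) (insert (1 / G xm) (range B1 \<union> range B2))))" by simp
  have K: "1 \<le> K" "1/r \<le> K" "1 / G xm \<le> K" "B1 i \<le> K" "B2 i \<le> K" for i
    unfolding K_def using fin by (auto intro!: Max_ge simp del: Max_insert)
  have "1 / K \<le> G xm" using K(1,3) Gpos[OF xm(1)] by (simp add: field_simps)
  hence GK: "1 / K \<le> G x" if "x \<in> ?S" for x using xm(2)[OF that] by linarith
  \<comment> \<open>A frontier point lies outside the open set \<Omega>, so \<phi> is nonnegative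
    there; if \<phi> were positive, a whole neighbourhood would miss \<Omega>, contradicting
    membership in the closure.\<close>
  have fr: "\<phi> x = 0" if x: "x \<in> frontier \<Omega>" "x \<in> U" for x
  proof -
    have nx: "x \<notin> \<Omega>" using x op by (simp add: frontier_def interior_open)
    hence "\<phi> x \<ge> 0" using neg x by force
    moreover have "\<not> \<phi> x > 0"
    proof
      assume p: "\<phi> x > 0"
      have "open (U \<inter> \<phi> -` {0<..})"
        using cont(1) U(1) by (simp add: continuous_on_open_vimage Int_commute)
      moreover have "x \<in> closure \<Omega>" using x by (simp add: frontier_def)
      ultimately have "(U \<inter> \<phi> -` {0<..}) \<inter> \<Omega> \<noteq> {}"
        using p x(2) open_Int_closure_eq_empty[of "U \<inter> \<phi> -` {0<..}" \<Omega>] by auto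
      thus False using neg by force
    qed
    ultimately show ?thesis by linarith
  qed
  have sub: "ball c (2 * r) \<subseteq> ?S" by (rule ball_subset_cball)
  have subU: "ball c (2 * r) \<subseteq> U" using sub r(2) by blast
  have "boundary_chart \<Omega> K c r \<phi> \<phi>1 \<phi>2"
    unfolding boundary_chart_def
  proof (intro conjI ballI allI)
    fix x i assume "x \<in> ball c (2 * r)"
    hence x: "x \<in> ?S" using sub by blast
    show "\<bar>\<phi>1 i x\<bar> \<le> K" "\<bar>\<phi>2 i x\<bar> \<le> K"
      using B1[OF x, of i] B2[OF x, of i] K(4,5)[of i] by linarith+
    show "1 / K \<le> (\<Sum>i\<in>UNIV. (\<phi>1 i x)\<^sup>2)" using GK[OF x] by (simp add: G_def)
    show "x \<in> \<Omega> \<longrightarrow> \<phi> x < 0" using neg x r(2) by blast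
    show "x \<in> frontier \<Omega> \<longrightarrow> \<phi> x = 0" using fr x r(2) by blast
  qed (use r K subU in \<open>auto intro: continuous_on_subset[OF cont(1)] axis_C2_subset[OF C2]\<close>)
  thus ?thesis using K(1) by blast
qed

text \<open>The frontier is compact. Covering it by quarter balls ensures that points sufficiently
  near the frontier lie in a half ball, where the bumps below are strictly negative.\<close>

lemma boundary_charts_finite:
  fixes \<Omega> :: "(real^'n) set"
  assumes op: "open \<Omega>" and bd: "bounded \<Omega>" and sb: "smooth_boundary \<Omega>"
  obtains K r \<phi> \<phi>1 \<phi>2 I where "1 \<le> K" "finite I" "frontier \<Omega> \<subseteq> (\<Union>c\<in>I. ball c (r c / 4))"
    "\<forall>c\<in>I. boundary_chart \<Omega> K c (r c) (\<phi> c) (\<phi>1 c) (\<phi>2 c)"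
proof -
  have "\<forall>c\<in>frontier \<Omega>. \<exists>K r \<phi> \<phi>1 \<phi>2. 1 \<le> K \<and> boundary_chart \<Omega> K c r \<phi> \<phi>1 \<phi>2"
    using boundary_chart_exists[OF op sb] by blast
  then obtain K r \<phi> \<phi>1 \<phi>2 where ch: "\<And>c. c \<in> frontier \<Omega> \<Longrightarrow> 1 \<le> K c \<and>
      boundary_chart \<Omega> (K c) c (r c) (\<phi> c) (\<phi>1 c) (\<phi>2 c)"
    by metis
  have cpt: "compact (frontier \<Omega>)" using bd by (rule compact_frontier_bounded)
  have cov: "frontier \<Omega> \<subseteq> (\<Union>c\<in>frontier \<Omega>. ball c (r c / 4))"
    using ch by (force simp: boundary_chart_def)
  obtain I where I: "I \<subseteq> frontier \<Omega>" "finite I" "frontier \<Omega> \<subseteq> (\<Union>c\<in>I. ball c (r c / 4))"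
    by (rule compactE_image[OF cpt _ cov]) auto
  define K' where "K' = Max (insert 1 (K ` I))"
  have K': "1 \<le> K'" "\<And>c. c \<in> I \<Longrightarrow> K c \<le> K'" using I(2) by (auto simp: K'_def simp del: Max_insert)
  show ?thesis
  proof (rule that[OF K'(1) I(2,3)], rule ballI)
    fix c assume c: "c \<in> I"
    hence "1 \<le> K c" "boundary_chart \<Omega> (K c) c (r c) (\<phi> c) (\<phi>1 c) (\<phi>2 c)" using ch I(1) by auto
    thus "boundary_chart \<Omega> K' c (r c) (\<phi> c) (\<phi>1 c) (\<phi>2 c)"
      using boundary_chart_mono K'(2)[OF c] by force
  qed
qed

section \<open>The superharmonic boundary layer function\<close>

lemma continuous_on_Min_image:
  fixes f :: "'a \<Rightarrow> 'b::topological_space \<Rightarrow> real"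
  assumes "finite I" "I \<noteq> {}" "\<And>c. c \<in> I \<Longrightarrow> continuous_on S (f c)"
  shows "continuous_on S (\<lambda>x. Min ((\<lambda>c. f c x) ` I))"
  using assms
proof (induction I rule: finite_ne_induct)
  case (insert c I)
  hence "continuous_on S (\<lambda>x. min (f c x) (Min ((\<lambda>c. f c x) ` I)))"
    by (intro continuous_on_min) auto
  thus ?case using insert by simp
qed simp

text \<open>With \<open>\<phi> < 0\<close> in \<Omega>, the term \<open>- exp (k \<phi>)\<close> has Laplacian of order \<open>- k\<^sup>2\<close> where
  \<open>\<phi> = O(1/k)\<close>; the quadratic term cuts the function off inside the chart, and its positive Laplacian is
  compensated in \<open>boundary_layer\<close> by a global concave function.\<close>

definition layer_bump where
  "layer_bump k c r \<phi> x = (if x \<in> ball c r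
     then min 0 (- 2 - exp (k * min 0 (\<phi> x)) + 4 / r\<^sup>2 * (norm (x - c))\<^sup>2) else (0::real))"

lemma layer_bump_bounds: "k \<ge> 0 \<Longrightarrow> - 3 \<le> layer_bump k c r \<phi> x" "layer_bump k c r \<phi> x \<le> 0"
proof -
  have "exp (k * min 0 (\<phi> x)) \<le> 1" if "k \<ge> 0"
    using that by (simp add: mult_nonneg_nonpos)
  moreover have "0 \<le> 4 / r\<^sup>2 * (norm (x - c))\<^sup>2" by simp
  ultimately show "k \<ge> 0 \<Longrightarrow> - 3 \<le> layer_bump k c r \<phi> x"
    unfolding layer_bump_def by (smt (verit))
qed (auto simp: layer_bump_def)

text \<open>On the half ball the quadratic term is below 1 and cannot compensate the constant -2, so
  the outer \<open>min 0\<close> is inactive there.\<close>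

lemma layer_bump_neg:
  assumes "r > 0" "x \<in> ball c (r / 2)"
  shows "layer_bump k c r \<phi> x < 0"
proof -
  have n: "norm (x - c) < r / 2" using assms by (simp add: dist_norm norm_minus_commute)
  hence "(norm (x - c))\<^sup>2 < (r / 2)\<^sup>2" by (intro power_strict_mono) auto
  hence "4 / r\<^sup>2 * (norm (x - c))\<^sup>2 < 1"
    using assms(1) by (simp add: field_simps power2_eq_square)
  moreover have "0 < exp (k * min 0 (\<phi> x))" by simp
  ultimately have "- 2 - exp (k * min 0 (\<phi> x)) + 4 / r\<^sup>2 * (norm (x - c))\<^sup>2 < 0"
    by linarith
  moreover have "x \<in> ball c r" using n assms(1) by (simp add: dist_norm norm_minus_commute)
  ultimately show ?thesis by (simp add: layer_bump_def)
qed

lemma continuous_on_layer_bump: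
  fixes \<phi> :: "real^'n \<Rightarrow> real"
  assumes \<phi>: "continuous_on (ball c (2 * r)) \<phi>" and r: "r > 0" and k: "k \<ge> 0"
  shows "continuous_on UNIV (layer_bump k c r \<phi>)"
proof -
  \<comment> \<open>On \<open>B\<close> the quadratic term exceeds 3, which is at least
    \<open>2 + exp (...)\<close>, so the bump vanishes. \<open>B\<close> overlaps
    \<open>ball c r\<close> and together they form an open cover, on which the two continuous pieces
    are glued.\<close>
  define B where "B = {x::real^'n. 3 / 4 * r\<^sup>2 < (norm (x - c))\<^sup>2}"
  have op: "open B" unfolding B_def by (intro open_Collect_less continuous_intros)
  have "continuous_on (ball c r) (layer_bump k c r \<phi>)
    = continuous_on (ball c r) (\<lambda>x. min 0 (- 2 - exp (k * min 0 (\<phi> x)) + 4 / r\<^sup>2 * (norm (x - c))\<^sup>2))"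
    by (rule continuous_on_cong) (auto simp: layer_bump_def)
  also have "\<dots>"
    using r by (intro continuous_intros continuous_on_subset[OF \<phi>]) auto
  finally have 1: "continuous_on (ball c r) (layer_bump k c r \<phi>)" .
  have "layer_bump k c r \<phi> x = 0" if "x \<in> B" for x
  proof -
    have "3 < 4 / r\<^sup>2 * (norm (x - c))\<^sup>2" using that r by (simp add: B_def field_simps)
    moreover have "exp (k * min 0 (\<phi> x)) \<le> 1" using k by (simp add: mult_nonneg_nonpos)
    ultimately have "0 \<le> - 2 - exp (k * min 0 (\<phi> x)) + 4 / r\<^sup>2 * (norm (x - c))\<^sup>2" by linarith
    thus ?thesis by (simp add: layer_bump_def)
  qed
  hence 2: "continuous_on B (layer_bump k c r \<phi>)"
    by (simp cong: continuous_on_cong)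
  have "x \<in> B" if "x \<notin> ball c r" for x
  proof -
    have "r \<le> norm (x - c)" using that by (simp add: dist_norm norm_minus_commute)
    hence "r\<^sup>2 \<le> (norm (x - c))\<^sup>2" using r by (intro power_mono) auto
    moreover have "0 < r\<^sup>2" using r by simp
    ultimately have "3 / 4 * r\<^sup>2 < (norm (x - c))\<^sup>2" by linarith
    thus ?thesis unfolding B_def by simp
  qed
  hence "ball c r \<union> B = UNIV" by blast
  thus ?thesis using continuous_on_open_Un[OF open_ball op 1 2] by simp
qed

text \<open>Inside \<Omega> one has \<phi> < 0, so dropping the outer minimum leaves a smooth
  function above the bump that agrees with it at \<open>x\<close>. The Laplacian of
  \<open>- exp (k * \<phi>)\<close> is \<open>- exp (k * \<phi>)\<close> times k^2 |grad \<phi>|^2 +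
  k Laplacian \<phi>; the lower bound on \<open>k\<close> lets half of the gradient term absorb the
  other one. At distance \<open>L / k\<close> from the frontier the exponential is bounded
  below.\<close>

lemma layer_bump_test:
  fixes \<Omega> :: "(real^'n) set" and x c :: "real^'n"
  assumes ch: "boundary_chart \<Omega> K c r \<phi> \<phi>1 \<phi>2" and K: "K \<ge> 1" and op: "open \<Omega>"
    and x: "x \<in> \<Omega>" and neg: "layer_bump k c r \<phi> x < 0"
    and k: "k \<ge> 1" "k \<ge> 2 * real CARD('n) * K ^ 2"
  shows "\<exists>\<delta> b b1 b2. \<delta> > 0 \<and> axis_C2 (ball x \<delta>) b b1 b2 \<and>
     (\<forall>y\<in>ball x \<delta>. layer_bump k c r \<phi> y \<le> b y) \<and> b x = layer_bump k c r \<phi> x \<and>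
     (\<forall>i. \<bar>b1 i x\<bar> \<le> 9 * K * k) \<and>
     (\<Sum>i\<in>UNIV. b2 i x) \<le> real CARD('n) * (8 * K\<^sup>2) \<and>
     (\<forall>y\<in>frontier \<Omega>. \<forall>L. 0 \<le> L \<and> dist x y \<le> L / k \<and> L / k < r \<longrightarrow>
        (\<Sum>i\<in>UNIV. b2 i x) \<le> real CARD('n) * (8 * K\<^sup>2)
           - exp (- real CARD('n) * K * L) / (2 * K) * k\<^sup>2)"
proof -
  from ch have r: "r > 0" "1 / r \<le> K"
    and C2: "axis_C2 (ball c (2 * r)) \<phi> \<phi>1 \<phi>2"
    and bnd: "\<And>y i. y \<in> ball c (2 * r) \<Longrightarrow> \<bar>\<phi>1 i y\<bar> \<le> K"
      "\<And>y i. y \<in> ball c (2 * r) \<Longrightarrow> \<bar>\<phi>2 i y\<bar> \<le> K"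
      "\<And>y. y \<in> ball c (2 * r) \<Longrightarrow> 1 / K \<le> (\<Sum>i\<in>UNIV. (\<phi>1 i y)\<^sup>2)"
    and sgn: "\<And>y. y \<in> ball c (2 * r) \<Longrightarrow> y \<in> \<Omega> \<Longrightarrow> \<phi> y < 0"
      "\<And>y. y \<in> ball c (2 * r) \<Longrightarrow> y \<in> frontier \<Omega> \<Longrightarrow> \<phi> y = 0"
    by (auto simp: boundary_chart_def)
  have xb: "x \<in> ball c r" using neg by (auto simp: layer_bump_def split: if_splits)
  hence xb2: "x \<in> ball c (2 * r)" using r by auto
  define a where "a = 4 / r\<^sup>2"
  have ar: "0 \<le> a" "a * r \<le> 4 * K" "a \<le> 4 * K\<^sup>2"
  proof -
    show "0 \<le> a" by (simp add: a_def)
    have "a * r = 4 * (1 / r)" using r by (simp add: a_def power2_eq_square)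
    thus "a * r \<le> 4 * K" using r by linarith
    have "(1 / r)\<^sup>2 \<le> K\<^sup>2" using r by (intro power_mono) auto
    thus "a \<le> 4 * K\<^sup>2" by (simp add: a_def power_divide)
  qed
  have "open (ball c r \<inter> \<Omega>)" using op by auto
  then obtain \<delta> where \<delta>: "\<delta> > 0" "ball x \<delta> \<subseteq> ball c r \<inter> \<Omega>"
    using xb x by (meson IntI openE)
  \<comment> \<open>The bump without its two truncations: the upper test function at
    \<open>x\<close>.\<close>
  define b where "b = (\<lambda>y. (-2 - exp (k * \<phi> y)) + a * (norm (y - c))\<^sup>2)"
  define E where "E = exp (k * \<phi> x)"
  let ?b1 = "\<lambda>i y. (0 - exp (k * \<phi> y) * (k * \<phi>1 i y)) + a * (2 * (y - c) $ i)"
  let ?b2 = "\<lambda>i y. (0 - exp (k * \<phi> y) * ((k * \<phi>1 i y)\<^sup>2 + k * \<phi>2 i y)) + a * 2"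
  have sub: "ball x \<delta> \<subseteq> ball c (2 * r)" using \<delta>(2) r by auto
  have C2b: "axis_C2 (ball x \<delta>) b ?b1 ?b2"
    unfolding b_def
    by (intro axis_C2_add axis_C2_diff axis_C2_const axis_C2_cmult axis_C2_exp axis_C2_dist2
        axis_C2_subset[OF C2 sub])
  have le: "layer_bump k c r \<phi> y \<le> b y" if "y \<in> ball x \<delta>" for y
  proof -
    have "y \<in> ball c r" "y \<in> \<Omega>" "y \<in> ball c (2 * r)" using that \<delta>(2) sub by auto
    thus ?thesis using sgn(1)[of y] by (simp add: layer_bump_def b_def a_def)
  qed
  have eq: "b x = layer_bump k c r \<phi> x"
    using neg sgn(1)[OF xb2 x] xb by (simp add: layer_bump_def b_def a_def)
  have E: "0 < E" "E \<le> 1"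
    using k sgn(1)[OF xb2 x] by (auto simp: E_def mult_nonneg_nonpos)
  \<comment> \<open>The exponential contributes at most \<open>K * k\<close> and the quadratic
    cutoff at most \<open>8 * K\<close>.\<close>
  have b1: "\<bar>?b1 i x\<bar> \<le> 9 * K * k" for i
  proof -
    have "\<bar>(x - c) $ i\<bar> \<le> r"
      using component_le_norm_cart[of "x - c" i] xb by (simp add: dist_norm norm_minus_commute)
    hence az: "a * \<bar>(x - c) $ i\<bar> \<le> 4 * K" using ar mult_left_mono[of "\<bar>(x - c) $ i\<bar>" r a] by linarith
    have absz: "\<bar>a * (2 * z)\<bar> = 2 * (a * \<bar>z\<bar>)" for z :: real
      using ar by (simp add: abs_mult)
    have 1: "\<bar>a * (2 * (x - c) $ i)\<bar> \<le> 8 * K" unfolding absz using az by linarith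
    have "\<bar>E * (k * \<phi>1 i x)\<bar> \<le> 1 * (k * K)"
      unfolding abs_mult using E k bnd(1)[OF xb2, of i] by (intro mult_mono) auto
    moreover have "8 * K \<le> 8 * K * k" using K k by simp
    moreover have "9 * K * k = 8 * K * k + 1 * (k * K)" by simp
    moreover have "\<bar>0 - p + q\<bar> \<le> \<bar>p\<bar> + \<bar>q\<bar>" for p q :: real by linarith
    note this[of "exp (k * \<phi> x) * (k * \<phi>1 i x)" "a * (2 * (x - c) $ i)"]
    ultimately show ?thesis using 1 unfolding E_def by linarith
  qed
  define n where "n = real CARD('n)"
  have s2: "(\<Sum>i\<in>UNIV. ?b2 i x) \<le> n * (8 * K\<^sup>2) - E * (k\<^sup>2 / (2 * K))"
  proof -
    have "(\<Sum>i\<in>UNIV. ?b2 i x) = - E * (k\<^sup>2 * (\<Sum>i\<in>UNIV. (\<phi>1 i x)\<^sup>2) + k * (\<Sum>i\<in>UNIV. \<phi>2 i x)) + n * (2 * a)"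
      by (simp add: E_def n_def sum.distrib sum_distrib_left sum_negf power_mult_distrib algebra_simps sum_subtractf)
    moreover have "- (n * K) \<le> (\<Sum>i\<in>UNIV. \<phi>2 i x)"
    proof -
      have "\<bar>\<Sum>i\<in>UNIV. \<phi>2 i x\<bar> \<le> (\<Sum>i\<in>(UNIV::'n set). K)"
        by (rule order_trans[OF sum_abs]) (intro sum_mono bnd(2)[OF xb2])
      thus ?thesis by (simp add: n_def)
    qed
    hence "k * - (n * K) \<le> k * (\<Sum>i\<in>UNIV. \<phi>2 i x)" using k by (intro mult_left_mono) auto
    moreover have "k\<^sup>2 * (1 / K) \<le> k\<^sup>2 * (\<Sum>i\<in>UNIV. (\<phi>1 i x)\<^sup>2)"
      by (intro mult_left_mono bnd(3)[OF xb2]) auto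
    \<comment> \<open>This is where k \<ge> 2 n K^2 enters: the second derivatives of \<phi> cost at
      most half of the gradient term.\<close>
    moreover have "k * (n * K) \<le> k\<^sup>2 / (2 * K)"
    proof -
      have "k * (2 * n * K\<^sup>2) \<le> k * k" using k by (intro mult_left_mono) (auto simp: n_def)
      thus ?thesis using K by (simp add: field_simps power2_eq_square)
    qed
    moreover have "k\<^sup>2 * (1 / K) = k\<^sup>2 / (2 * K) + k\<^sup>2 / (2 * K)" using K by (simp add: field_simps)
    ultimately have "k\<^sup>2 / (2 * K) \<le> k\<^sup>2 * (\<Sum>i\<in>UNIV. (\<phi>1 i x)\<^sup>2) + k * (\<Sum>i\<in>UNIV. \<phi>2 i x)"
      by linarith
    hence "E * (k\<^sup>2 / (2 * K)) \<le> E * (k\<^sup>2 * (\<Sum>i\<in>UNIV. (\<phi>1 i x)\<^sup>2) + k * (\<Sum>i\<in>UNIV. \<phi>2 i x))"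
      using E by (intro mult_left_mono) auto
    moreover have "n * (2 * a) \<le> n * (8 * K\<^sup>2)" using ar by (intro mult_left_mono) (auto simp: n_def)
    ultimately show ?thesis
      using \<open>(\<Sum>i\<in>UNIV. ?b2 i x) = _\<close> by linarith
  qed
  have s2a: "(\<Sum>i\<in>UNIV. ?b2 i x) \<le> n * (8 * K\<^sup>2)"
  proof -
    have "0 \<le> E * (k\<^sup>2 / (2 * K))" using E K by simp
    thus ?thesis using s2 by linarith
  qed
  have s2b: "(\<Sum>i\<in>UNIV. ?b2 i x) \<le> n * (8 * K\<^sup>2) - exp (- n * K * L) / (2 * K) * k\<^sup>2"
    if y: "y \<in> frontier \<Omega>" and L: "0 \<le> L" "dist x y \<le> L / k" "L / k < r" for y L
  proof -
    \<comment> \<open>The doubled chart radius provides a ball around \<open>x\<close> containing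
      the frontier point \<open>y\<close>; the Lipschitz bound together with
      \<open>\<phi> y = 0\<close> then gives |\<phi> x| \<le> n K L / k.\<close>
    have bx: "ball x r \<subseteq> ball c (2 * r)"
    proof
      fix z assume "z \<in> ball x r"
      thus "z \<in> ball c (2 * r)" using xb dist_triangle[of c z x] by simp
    qed
    have nyx: "norm (y - x) < r" using L by (simp add: dist_norm norm_minus_commute)
    hence "y \<in> ball c (2 * r)" using bx by (auto simp: dist_norm norm_minus_commute)
    hence "\<phi> y = 0" using sgn(2) y by blast
    moreover have "\<bar>\<phi> y - \<phi> x\<bar> \<le> real CARD('n) * K * norm (y - x)"
      using axis_C2_D(1)[OF C2] bnd(1) bx nyx
      by (intro partial_bound_imp_lipschitz[of x r \<phi> \<phi>1 K y]) blast+
    ultimately have "\<bar>\<phi> x\<bar> \<le> n * K * norm (y - x)" by (simp add: n_def)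
    also have "\<dots> \<le> n * K * (L / k)"
      using L K by (intro mult_left_mono) (auto simp: n_def dist_norm norm_minus_commute)
    finally have "k * \<bar>\<phi> x\<bar> \<le> k * (n * K * (L / k))" using k by (intro mult_left_mono) auto
    also have "\<dots> = n * K * L" using k by simp
    finally have "k * \<bar>\<phi> x\<bar> \<le> n * K * L" .
    moreover have "k * - \<bar>\<phi> x\<bar> \<le> k * \<phi> x" using k by (intro mult_left_mono) auto
    ultimately have "- n * K * L \<le> k * \<phi> x" by simp
    hence "exp (- n * K * L) \<le> E" by (simp add: E_def)
    hence "exp (- n * K * L) * (k\<^sup>2 / (2 * K)) \<le> E * (k\<^sup>2 / (2 * K))"
      using K by (intro mult_right_mono) auto
    thus ?thesis using s2 by simp
  qed
  show ?thesis
    by (rule exI[of _ \<delta>], rule exI[of _ b], rule exI[of _ ?b1], rule exI[of _ ?b2])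
      (use \<delta>(1) C2b le eq b1 s2a s2b in \<open>auto simp: n_def\<close>)
qed

text \<open>The minimum of finitely many local functions is not differentiable; as in the theory of viscosity
  solutions, \<open>\<zeta>\<close> is therefore described by smooth functions \<open>z\<close> touching it from above.\<close>

lemma boundary_layer:
  fixes \<Omega> :: "(real^'n) set"
  assumes op: "open \<Omega>" and bd: "bounded \<Omega>" and sb: "smooth_boundary \<Omega>"
    and ne: "frontier \<Omega> \<noteq> {}" and L: "0 \<le> L"
  obtains C c0 k0 where "1 \<le> C" "0 < c0"
    "\<And>k. k0 \<le> k \<Longrightarrow> \<exists>\<zeta>. continuous_on UNIV \<zeta> \<and> (\<forall>x\<in>closure \<Omega>. 1 \<le> \<zeta> x \<and> \<zeta> x \<le> C) \<and>
       (\<forall>x\<in>\<Omega>. \<exists>\<delta> z z1 z2. \<delta> > 0 \<and> axis_C2 (ball x \<delta>) z z1 z2 \<and>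
          (\<forall>y\<in>ball x \<delta>. \<zeta> y \<le> z y) \<and> z x = \<zeta> x \<and> (\<forall>i. \<bar>z1 i x\<bar> \<le> C * k) \<and>
          (\<Sum>i\<in>UNIV. z2 i x) < 0 \<and>
          ((\<exists>y\<in>frontier \<Omega>. dist x y \<le> L / k) \<longrightarrow> (\<Sum>i\<in>UNIV. z2 i x) \<le> - c0 * k\<^sup>2))"
proof -
  obtain K r \<phi> \<phi>1 \<phi>2 I where K: "1 \<le> K" and fin: "finite I"
    and cov: "frontier \<Omega> \<subseteq> (\<Union>c\<in>I. ball c (r c / 4))"
    and "\<forall>c\<in>I. boundary_chart \<Omega> K c (r c) (\<phi> c) (\<phi>1 c) (\<phi>2 c)"
    by (rule boundary_charts_finite[OF op bd sb])
  hence ch: "boundary_chart \<Omega> K c (r c) (\<phi> c) (\<phi>1 c) (\<phi>2 c)" if "c \<in> I" for c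
    using that by blast
  have I: "I \<noteq> {}" using cov ne by auto
  have r: "r c > 0" "1 / r c \<le> K" if "c \<in> I" for c
    using ch[OF that] by (auto simp: boundary_chart_def)
  obtain D where D: "D > 0" "\<And>x. x \<in> closure \<Omega> \<Longrightarrow> norm x \<le> D"
    using bd bounded_closure bounded_pos by metis
  define n where "n = real CARD('n)"
  have n: "n \<ge> 1" by (simp add: n_def Suc_leI)
  \<comment> \<open>The concave paraboloid \<open>base\<close> has Laplacian - 2 n \<Lambda> = - 8 n
    K^2 - 2 n, which cancels the positive contribution of the cutoffs and leaves a strictly negative
    remainder.\<close>
  define \<Lambda> where "\<Lambda> = 4 * K\<^sup>2 + 1"
  \<comment> \<open>The first two summands bound \<zeta> from above, the last two bound its gradient
    divided by \<open>k\<close>.\<close>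
  define C where "C = \<Lambda> * D\<^sup>2 + 4 + 2 * \<Lambda> * D + 9 * K"
  define c0 where "c0 = exp (- n * K * L) / (2 * K)"
  \<comment> \<open>The summands secure k \<ge> 1, the absorption threshold of the charts, and L / k
    < r / 4, so that points within \<open>L / k\<close> of the frontier lie in half balls.\<close>
  define k0 where "k0 = 1 + 2 * n * K\<^sup>2 + 5 * (L * K)"
  \<comment> \<open>On the closure \<open>base\<close> is at least 4, while the bumps are at least
    -3; hence \<zeta> \<ge> 1.\<close>
  define base where "base = (\<lambda>x::real^'n. (\<Lambda> * D\<^sup>2 + 4) - \<Lambda> * (norm (x - 0))\<^sup>2)"
  have \<Lambda>: "\<Lambda> \<ge> 1" by (simp add: \<Lambda>_def)
  have base: "axis_C2 U base (\<lambda>i x. 0 - \<Lambda> * (2 * (x - 0) $ i)) (\<lambda>i x. 0 - \<Lambda> * 2)" for U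
    unfolding base_def by (intro axis_C2_diff axis_C2_const axis_C2_cmult axis_C2_dist2)
  have cont_base: "continuous_on UNIV base" unfolding base_def by (intro continuous_intros)
  show ?thesis
  proof (rule that)
    have "0 \<le> \<Lambda> * D\<^sup>2 + 2 * \<Lambda> * D" using \<Lambda> D by simp
    thus "1 \<le> C" using K by (simp add: C_def)
    show "0 < c0" using K by (simp add: c0_def)
    fix k assume kk: "k0 \<le> k"
    have "0 \<le> n * K\<^sup>2" "0 \<le> L * K" using n K L by simp_all
    hence k: "k \<ge> 1" "k \<ge> 2 * n * K\<^sup>2" "k > 4 * (L * K)"
      using kk unfolding k0_def by linarith+
    let ?b = "\<lambda>c. layer_bump k c (r c) (\<phi> c)"
    define m where "m = (\<lambda>x. Min ((\<lambda>c. ?b c x) ` I))"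
    define \<zeta> where "\<zeta> = (\<lambda>x. base x + m x)"
    have m_le: "m x \<le> ?b c x" if "c \<in> I" for c x
      unfolding m_def using fin that by (intro Min_le) auto
    have m_eq: "\<exists>c\<in>I. m x = ?b c x" for x
    proof -
      have "m x \<in> (\<lambda>c. ?b c x) ` I" unfolding m_def using fin I by (intro Min_in) auto
      thus ?thesis by blast
    qed
    have m_bounds: "-3 \<le> m x" "m x \<le> 0" for x
      using m_eq[of x] layer_bump_bounds k by (metis order_trans zero_le_one)+
    have cont: "continuous_on UNIV \<zeta>"
      unfolding \<zeta>_def m_def
    proof (intro continuous_on_add cont_base continuous_on_Min_image fin I)
      fix c assume c: "c \<in> I"
      thus "continuous_on UNIV (?b c)"
        using ch[OF c] k by (intro continuous_on_layer_bump) (auto simp: boundary_chart_def)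
    qed
    have bnds: "1 \<le> \<zeta> x \<and> \<zeta> x \<le> C" if "x \<in> closure \<Omega>" for x
    proof -
      have "(norm x)\<^sup>2 \<le> D\<^sup>2" using D(2)[OF that] by (intro power_mono) auto
      hence "\<Lambda> * (norm x)\<^sup>2 \<le> \<Lambda> * D\<^sup>2" using \<Lambda> by (intro mult_left_mono) auto
      hence "4 \<le> base x" by (simp add: base_def)
      moreover have "base x \<le> \<Lambda> * D\<^sup>2 + 4" using \<Lambda> by (simp add: base_def)
      moreover have "0 \<le> 2 * \<Lambda> * D + 9 * K" using \<Lambda> D K by simp
      ultimately show ?thesis using m_bounds[of x] by (simp add: \<zeta>_def C_def)
    qed
    have test: "\<exists>\<delta> z z1 z2. \<delta> > 0 \<and> axis_C2 (ball x \<delta>) z z1 z2 \<and>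
          (\<forall>y\<in>ball x \<delta>. \<zeta> y \<le> z y) \<and> z x = \<zeta> x \<and> (\<forall>i. \<bar>z1 i x\<bar> \<le> C * k) \<and>
          (\<Sum>i\<in>UNIV. z2 i x) < 0 \<and>
          ((\<exists>y\<in>frontier \<Omega>. dist x y \<le> L / k) \<longrightarrow> (\<Sum>i\<in>UNIV. z2 i x) \<le> - c0 * k\<^sup>2)"
      if x: "x \<in> \<Omega>" for x
    proof -
      have b1: "\<bar>0 - \<Lambda> * (2 * (x - 0) $ i)\<bar> \<le> 2 * \<Lambda> * D" for i
      proof -
        have "\<bar>x $ i\<bar> \<le> D"
          using component_le_norm_cart[of x i] D(2)[of x] x closure_subset by force
        thus ?thesis using \<Lambda> by (simp add: abs_mult)
      qed
      have s0: "(\<Sum>i\<in>(UNIV::'n set). 0 - \<Lambda> * 2) = - (n * (8 * K\<^sup>2)) - 2 * n"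
        by (simp add: n_def \<Lambda>_def algebra_simps)
      have near: "m x < 0" if y: "y \<in> frontier \<Omega>" "dist x y \<le> L / k" for y
      proof -
        obtain c where c: "c \<in> I" "y \<in> ball c (r c / 4)" using cov y by blast
        have "L * 4 < r c * k"
        proof -
          have "1 \<le> K * r c" using r[OF c(1)] by (simp add: field_simps)
          hence "k * 1 \<le> k * (K * r c)" using k by (intro mult_left_mono) auto
          moreover have "k * (K * r c) = K * (r c * k)" "4 * (L * K) = K * (L * 4)" by simp_all
          ultimately have "K * (L * 4) < K * (r c * k)" using k by linarith
          thus ?thesis using K by simp
        qed
        hence "L / k < r c / 4" using k by (simp add: field_simps)
        moreover have "dist c y < r c / 4" using c(2) by simp
        ultimately have "dist c x < r c / 2"
          using y(2) dist_triangle[of c x y] dist_commute[of x y] by linarith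
        hence "x \<in> ball c (r c / 2)" by simp
        from layer_bump_neg[OF r(1)[OF c(1)] this] m_le[OF c(1), of x] show ?thesis
          by (meson le_less_trans)
      qed
      obtain c where c: "c \<in> I" "m x = ?b c x" using m_eq by blast
      show ?thesis
      proof (cases "m x < 0")
        \<comment> \<open>Away from all active bumps \<open>base\<close> itself touches \<zeta> from
          above. By \<open>near\<close>, such a point is farther than \<open>L / k\<close> from the
          frontier, so the last clause is vacuous.\<close>
        case False
        hence "m x = 0" using m_bounds[of x] by linarith
        let ?z1 = "\<lambda>i x. 0 - \<Lambda> * (2 * (x - 0) $ i)" and ?z2 = "\<lambda>(i::'n) (x::real^'n). 0 - \<Lambda> * 2"
        have "(\<Sum>i\<in>(UNIV::'n set). 0 - \<Lambda> * 2) < 0" using n \<Lambda> by simp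
        moreover have "\<bar>?z1 i x\<bar> \<le> C * k" for i
        proof -
          have "2 * \<Lambda> * D \<le> C * 1" using K \<Lambda> by (simp add: C_def)
          also have "\<dots> \<le> C * k" using k \<open>1 \<le> C\<close> by (intro mult_left_mono) auto
          finally show ?thesis using b1[of i] by linarith
        qed
        moreover have "\<forall>y\<in>ball x 1. \<zeta> y \<le> base y" using m_bounds by (simp add: \<zeta>_def)
        moreover have "base x = \<zeta> x" using \<open>m x = 0\<close> by (simp add: \<zeta>_def)
        ultimately show ?thesis using near False base[of "ball x 1"]
          by (intro exI[of _ 1] exI[of _ base] exI[of _ ?z1] exI[of _ ?z2]) auto
      next
        \<comment> \<open>A chart attaining the minimum is active, and its smooth upper test
          function added to \<open>base\<close> touches \<zeta> from above.\<close>
        case True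
        have "layer_bump k c (r c) (\<phi> c) x < 0" using True c(2) by simp
        from layer_bump_test[OF ch[OF c(1)] K op x this k(1) k(2)[unfolded n_def]]
        obtain \<delta> b b1 b2 where bb: "\<delta> > 0 \<and> axis_C2 (ball x \<delta>) b b1 b2 \<and>
          (\<forall>y\<in>ball x \<delta>. ?b c y \<le> b y) \<and> b x = ?b c x \<and> (\<forall>i. \<bar>b1 i x\<bar> \<le> 9 * K * k) \<and>
          (\<Sum>i\<in>UNIV. b2 i x) \<le> n * (8 * K\<^sup>2) \<and>
          (\<forall>y\<in>frontier \<Omega>. \<forall>L. 0 \<le> L \<and> dist x y \<le> L / k \<and> L / k < r c \<longrightarrow>
             (\<Sum>i\<in>UNIV. b2 i x) \<le> n * (8 * K\<^sup>2) - exp (- n * K * L) / (2 * K) * k\<^sup>2)"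
          unfolding n_def by (elim exE)
        hence b: "\<delta> > 0" "axis_C2 (ball x \<delta>) b b1 b2"
          "\<And>y. y \<in> ball x \<delta> \<Longrightarrow> ?b c y \<le> b y" "b x = ?b c x" "\<And>i. \<bar>b1 i x\<bar> \<le> 9 * K * k"
          "(\<Sum>i\<in>UNIV. b2 i x) \<le> n * (8 * K\<^sup>2)"
          "\<And>y L. y \<in> frontier \<Omega> \<Longrightarrow> 0 \<le> L \<Longrightarrow> dist x y \<le> L / k \<Longrightarrow> L / k < r c \<Longrightarrow>
             (\<Sum>i\<in>UNIV. b2 i x) \<le> n * (8 * K\<^sup>2) - exp (- n * K * L) / (2 * K) * k\<^sup>2"
          by blast+
        let ?z = "\<lambda>x. base x + b x"
        let ?z1 = "\<lambda>i x. (0 - \<Lambda> * (2 * (x - 0) $ i)) + b1 i x"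
        let ?z2 = "\<lambda>i x. (0 - \<Lambda> * 2) + b2 i x"
        have s: "(\<Sum>i\<in>UNIV. ?z2 i x) = (- (n * (8 * K\<^sup>2)) - 2 * n) + (\<Sum>i\<in>UNIV. b2 i x)"
          by (simp only: sum.distrib s0)
        have "(\<Sum>i\<in>UNIV. ?z2 i x) \<le> - c0 * k\<^sup>2" if y: "y \<in> frontier \<Omega>" "dist x y \<le> L / k" for y
        proof -
          have "L * 1 < r c * k"
          proof -
            have "1 \<le> K * r c" using r[OF c(1)] by (simp add: field_simps)
            hence "k * 1 \<le> k * (K * r c)" using k by (intro mult_left_mono) auto
            moreover have "L * K \<ge> 0" using L K by simp
            moreover have "k * (K * r c) = K * (r c * k)" "L * K = K * (L * 1)" by simp_all
            ultimately have "K * (L * 1) < K * (r c * k)" using k by linarith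
            thus ?thesis using K by simp
          qed
          hence "L / k < r c" using k by (simp add: field_simps)
          from b(7)[OF y(1) L y(2) this] show ?thesis unfolding s c0_def using n by simp
        qed
        moreover have "(\<Sum>i\<in>UNIV. ?z2 i x) < 0" unfolding s using b(6) n by linarith
        moreover have "\<bar>?z1 i x\<bar> \<le> C * k" for i
        proof -
          have "2 * \<Lambda> * D * 1 \<le> 2 * \<Lambda> * D * k" using k \<Lambda> D by (intro mult_left_mono) auto
          moreover have "0 \<le> (\<Lambda> * D\<^sup>2 + 4) * k" using \<Lambda> k by simp
          moreover have "C * k = (\<Lambda> * D\<^sup>2 + 4) * k + 2 * \<Lambda> * D * k + 9 * K * k"
            by (simp add: C_def algebra_simps)
          ultimately show ?thesis using b1[of i] b(5)[of i] by linarith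
        qed
        moreover have "\<forall>y\<in>ball x \<delta>. \<zeta> y \<le> ?z y" 
        proof
          fix y assume "y \<in> ball x \<delta>"
          thus "\<zeta> y \<le> ?z y" using b(3)[of y] m_le[OF c(1), of y] by (simp add: \<zeta>_def)
        qed
        moreover have "?z x = \<zeta> x" using b(4) c(2) by (simp add: \<zeta>_def)
        moreover have "axis_C2 (ball x \<delta>) ?z ?z1 ?z2" by (intro axis_C2_add base b)
        ultimately show ?thesis using b(1)
          by (intro exI[of _ \<delta>] exI[of _ ?z] exI[of _ ?z1] exI[of _ ?z2]) blast
      qed
    qed
    from cont bnds test show "\<exists>\<zeta>. continuous_on UNIV \<zeta> \<and> (\<forall>x\<in>closure \<Omega>. 1 \<le> \<zeta> x \<and> \<zeta> x \<le> C) \<and>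
       (\<forall>x\<in>\<Omega>. \<exists>\<delta> z z1 z2. \<delta> > 0 \<and> axis_C2 (ball x \<delta>) z z1 z2 \<and>
          (\<forall>y\<in>ball x \<delta>. \<zeta> y \<le> z y) \<and> z x = \<zeta> x \<and> (\<forall>i. \<bar>z1 i x\<bar> \<le> C * k) \<and>
          (\<Sum>i\<in>UNIV. z2 i x) < 0 \<and>
          ((\<exists>y\<in>frontier \<Omega>. dist x y \<le> L / k) \<longrightarrow> (\<Sum>i\<in>UNIV. z2 i x) \<le> - c0 * k\<^sup>2))"
      by blast
  qed
qed

section \<open>Transport and comparison for the degenerate heat flow\<close>

text \<open>The setting left after the reduction: \<open>dv\<close> plays the role of div u,
  \<open>g\<close> of \<gamma> - 1, and \<kappa> of the full diffusion coefficient. Derivatives are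
  separate functions, bounded by one constant \<open>C\<close>, and the equations hold at interior
  times, where time derivatives are two-sided. The density may have either sign at positive
  times.\<close>

locale degenerate_heat_flow =
  fixes \<Omega> :: "(real^'n) set" and T C \<kappa> g :: real
    and \<rho> e dv \<rho>t et :: "real^'n \<Rightarrow> real \<Rightarrow> real" and u :: "real^'n \<Rightarrow> real \<Rightarrow> real^'n"
    and \<rho>1 e1 :: "'n \<Rightarrow> real^'n \<Rightarrow> real \<Rightarrow> real" and e2 :: "'n \<Rightarrow> 'n \<Rightarrow> real^'n \<Rightarrow> real \<Rightarrow> real"
  assumes op: "open \<Omega>" and bd: "bounded \<Omega>"
    and C: "1 \<le> C" and \<kappa>: "0 < \<kappa>" and g: "\<bar>g\<bar> \<le> C"
    and cont_\<rho>: "continuous_on (closure \<Omega> \<times> {0..T}) (\<lambda>(x, t). \<rho> x t)"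
    and cont_e: "continuous_on (closure \<Omega> \<times> {0..T}) (\<lambda>(x, t). e x t)"
    and \<rho>_bound: "x \<in> \<Omega> \<Longrightarrow> t \<in> {0..T} \<Longrightarrow> \<bar>\<rho> x t\<bar> \<le> C"
    and u_bound: "x \<in> \<Omega> \<Longrightarrow> t \<in> {0..T} \<Longrightarrow> \<bar>u x t $ i\<bar> \<le> C"
    and dv_bound: "x \<in> \<Omega> \<Longrightarrow> t \<in> {0..T} \<Longrightarrow> \<bar>dv x t\<bar> \<le> C"
    and e_bound: "x \<in> closure \<Omega> \<Longrightarrow> t \<in> {0..T} \<Longrightarrow> \<bar>e x t\<bar> \<le> C"
    and \<rho>t_bound: "x \<in> \<Omega> \<Longrightarrow> t \<in> {0..T} \<Longrightarrow> \<bar>\<rho>t x t\<bar> \<le> C"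
    and e2_bound: "x \<in> \<Omega> \<Longrightarrow> t \<in> {0..T} \<Longrightarrow> \<bar>e2 i j x t\<bar> \<le> C"
    and D_\<rho>t: "x \<in> \<Omega> \<Longrightarrow> t \<in> {0<..<T} \<Longrightarrow> (\<rho> x has_real_derivative \<rho>t x t) (at t)"
    and D_\<rho>x: "x \<in> \<Omega> \<Longrightarrow> t \<in> {0<..<T} \<Longrightarrow>
          ((\<lambda>s. \<rho> (x + s *\<^sub>R axis i 1) t) has_real_derivative \<rho>1 i x t) (at 0)"
    and D_et: "x \<in> \<Omega> \<Longrightarrow> t \<in> {0<..<T} \<Longrightarrow> (e x has_real_derivative et x t) (at t)"
    and D_ex: "x \<in> \<Omega> \<Longrightarrow> t \<in> {0<..<T} \<Longrightarrow>
          ((\<lambda>s. e (x + s *\<^sub>R axis i 1) t) has_real_derivative e1 i x t) (at 0)"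
    and D_exx: "x \<in> \<Omega> \<Longrightarrow> t \<in> {0<..<T} \<Longrightarrow>
          ((\<lambda>s. e1 i (x + s *\<^sub>R axis j 1) t) has_real_derivative e2 i j x t) (at 0)"
    and transport: "x \<in> \<Omega> \<Longrightarrow> t \<in> {0<..<T} \<Longrightarrow>
          \<rho>t x t + (\<Sum>i\<in>UNIV. u x t $ i * \<rho>1 i x t) + \<rho> x t * dv x t = 0"
    and heat: "x \<in> \<Omega> \<Longrightarrow> t \<in> {0<..<T} \<Longrightarrow>
          \<kappa> * (\<Sum>i\<in>UNIV. e2 i i x t)
            \<le> \<rho> x t * (et x t + (\<Sum>i\<in>UNIV. u x t $ i * e1 i x t) + g * dv x t * e x t)"
    and \<rho>_init: "x \<in> \<Omega> \<Longrightarrow> 0 < \<rho> x 0"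
    and e_init: "x \<in> \<Omega> \<Longrightarrow> 0 \<le> e x 0"
    and e_frontier: "x \<in> frontier \<Omega> \<Longrightarrow> t \<in> {0..T} \<Longrightarrow> e x t = 0"
    and e1_frontier: "x \<in> frontier \<Omega> \<Longrightarrow> t \<in> {0<..<T} \<Longrightarrow> ((\<lambda>y. e1 i y t) \<longlongrightarrow> 0) (at x within \<Omega>)"
begin

section \<open>Lower bounds and finite propagation speed for the density\<close>

lemma sum_u_bound:
  assumes "x \<in> \<Omega>" "t \<in> {0..T}" "\<And>i. \<bar>w i\<bar> \<le> W"
  shows "\<bar>\<Sum>i\<in>UNIV. u x t $ i * w i\<bar> \<le> real CARD('n) * C * W"
proof -
  have "\<bar>\<Sum>i\<in>UNIV. u x t $ i * w i\<bar> \<le> (\<Sum>i\<in>(UNIV::'n set). C * W)"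
    using u_bound[OF assms(1,2)] assms(3) C
    by (intro order_trans[OF sum_abs] sum_mono) (auto simp: abs_mult intro!: mult_mono)
  thus ?thesis by simp
qed

text \<open>The mean value theorem in time with the bound on \<open>\<rho>t\<close>. Since the
  density starts positive, it is at least - C t at time \<open>t\<close>.\<close>

lemma \<rho>_lower_bound:
  assumes x: "x \<in> \<Omega>" and t: "0 \<le> t" "t < T"
  shows "\<rho> x 0 - C * t \<le> \<rho> x t"
proof (cases "t = 0")
  case True
  thus ?thesis by simp
next
  case False
  have c: "continuous_on {0..t} (\<rho> x)"
  proof -
    have "continuous_on {0..t} (\<lambda>s. case (x, s) of (x, s) \<Rightarrow> \<rho> x s)"
      using x t closure_subset
      by (intro continuous_on_compose2[OF cont_\<rho>] continuous_intros) auto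
    thus ?thesis by simp
  qed
  have "\<exists>l z. 0 < z \<and> z < t \<and> (\<rho> x has_real_derivative l) (at z) \<and> \<rho> x t - \<rho> x 0 = (t - 0) * l"
  proof (rule MVT[OF _ c])
    fix z assume "0 < z" "z < t"
    thus "\<rho> x differentiable (at z)"
      using D_\<rho>t[OF x, of z] t unfolding real_differentiable_def by auto
  qed (use False t in auto)
  then obtain l z where z: "0 < z" "z < t" "(\<rho> x has_real_derivative l) (at z)"
    "\<rho> x t - \<rho> x 0 = (t - 0) * l" by blast
  have "l = \<rho>t x z" using DERIV_unique[OF z(3) D_\<rho>t[OF x]] z t by simp
  hence "- C \<le> l" using \<rho>t_bound[OF x, of z] z t by simp
  hence "t * (- C) \<le> t * l" using t by (intro mult_left_mono) auto
  thus ?thesis using z(4) by (simp add: mult.commute)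
qed

text \<open>The drift of |x - a|^2 / w^2 along \<open>u\<close> is at most 2 n C / w in a ball of
  radius \<open>w\<close>; the extra 1 makes the cone strictly faster than the flow.\<close>

definition speed where "speed = 2 * real CARD('n) * C + 1"

lemma speed_ge: "speed \<ge> 1"
  using C by (simp add: speed_def)

text \<open>The weight \<open>exp q\<close> is a strict supersolution of the transport equation that exceeds 1 on the
  lateral boundary. Letting \<open>N\<close> tend to infinity it vanishes in the cone \<open>speed * t < w\<close>.\<close>

lemma \<rho>_cone_bound:
  assumes \<tau>: "0 < \<tau>" "\<tau> < T" and w: "0 < w" and sub: "cball a w \<subseteq> \<Omega>" and t: "t \<in> {0..\<tau>}" and N: "0 < N"
  shows "- (C * exp (N * (speed * t / w - 1))) \<le> exp (- (C * t)) * \<rho> a t"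
proof -
  define q where "q = (\<lambda>x s. N * (1 / w\<^sup>2 * (norm (x - a))\<^sup>2 + (speed * s / w - 1)))"
  \<comment> \<open>The factor \<open>exp (- (C * s))\<close> gives the zero-order term a sign: it
    becomes - \<rho> (dv + C), nonnegative wherever \<rho> < 0.\<close>
  define Y where "Y = (\<lambda>x s. exp (- (C * s)) * \<rho> x s + C * exp (q x s))"
  let ?K = "cball a w \<times> {0..\<tau>}"
  have c\<rho>: "continuous_on ?K (\<lambda>z. \<rho> (fst z) (snd z))"
  proof -
    have "continuous_on ?K (\<lambda>z. case z of (x, t) \<Rightarrow> \<rho> x t)"
      using sub \<tau> closure_subset by (intro continuous_on_subset[OF cont_\<rho>]) fastforce
    thus ?thesis by (simp add: case_prod_beta)
  qed
  have "continuous_on ?K (\<lambda>z. Y (fst z) (snd z))"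
    unfolding Y_def q_def by (intro continuous_intros c\<rho>) (use w in auto)
  moreover have "compact ?K" by (intro compact_Times) auto
  moreover have "?K \<noteq> {}" using w \<tau> by auto
  ultimately obtain zm where zm: "zm \<in> ?K" "\<forall>z\<in>?K. Y (fst zm) (snd zm) \<le> Y (fst z) (snd z)"
    using continuous_attains_inf by blast
  define x s where "x = fst zm" and "s = snd zm"
  have x: "x \<in> cball a w" and s: "s \<in> {0..\<tau>}" using zm(1) by (auto simp: x_def s_def)
  have min: "Y x s \<le> Y x' s'" if "x' \<in> cball a w" "s' \<in> {0..\<tau>}" for x' s'
    using zm(2)[rule_format, of "(x', s')"] that by (simp add: x_def s_def)
  have xO: "x \<in> \<Omega>" using x sub by blast
  have "Y x s \<ge> 0"
  proof (rule ccontr)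
    assume neg: "\<not> 0 \<le> Y x s"
    have P: "0 < C * exp (q x s)" using C by simp
    have "exp (- (C * s)) * \<rho> x s < 0" using neg P by (simp add: Y_def)
    hence \<rho>neg: "\<rho> x s < 0" by (simp add: mult_less_0_iff)
    have s0: "s \<noteq> 0" using \<rho>neg \<rho>_init[OF xO] by auto
    have sT: "s \<in> {0<..<T}" using s s0 \<tau> by auto
    \<comment> \<open>On the sphere of radius \<open>w\<close> the weight is at least 1, so its
      multiple by \<open>C\<close> outweighs |\<rho>|; a negative minimum therefore lies
      inside.\<close>
    have nx: "norm (x - a) < w"
    proof (rule ccontr)
      assume "\<not> norm (x - a) < w"
      hence n: "norm (x - a) = w" using x by (simp add: dist_norm norm_minus_commute)
      have "0 \<le> speed * s / w" using speed_ge s w by simp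
      moreover have "q x s = N * (speed * s / w)" using n w by (simp add: q_def)
      ultimately have "0 \<le> q x s" using N by (simp only: mult_nonneg_nonneg less_imp_le)
      hence "C * 1 \<le> C * exp (q x s)" using C by (intro mult_left_mono) auto
      moreover have "exp (- (C * s)) * \<bar>\<rho> x s\<bar> \<le> 1 * C"
        using \<rho>_bound[OF xO, of s] sT C s by (intro mult_mono) auto
      ultimately have "0 \<le> Y x s" using \<rho>neg by (simp add: Y_def)
      thus False using neg by simp
    qed
    define E Q where "E = exp (- (C * s))" and "Q = C * exp (q x s)"
    have E: "E > 0" and Q: "Q > 0" using C by (auto simp: E_def Q_def)
    have dx: "E * \<rho>1 i x s + Q * (N * (1 / w\<^sup>2 * (2 * (x - a) $ i))) = 0" for i
    proof -
      have "axis_C2 UNIV (\<lambda>x. exp (q x s)) (\<lambda>i x. exp (q x s) * (N * (1 / w\<^sup>2 * (2 * (x - a) $ i) + 0)))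
          (\<lambda>i x. exp (q x s) * ((N * (1 / w\<^sup>2 * (2 * (x - a) $ i) + 0))\<^sup>2 + N * (1 / w\<^sup>2 * 2 + 0)))"
        unfolding q_def
        by (intro axis_C2_exp axis_C2_cmult axis_C2_add axis_C2_dist2 axis_C2_const)
      from DERIV_add[OF DERIV_cmult[OF D_\<rho>x[OF xO sT, of i], of E] DERIV_cmult[OF axis_C2_D(1)[OF this UNIV_I, of x i], of C]]
      have d: "((\<lambda>h. Y (x + h *\<^sub>R axis i 1) s) has_real_derivative
           E * \<rho>1 i x s + Q * (N * (1 / w\<^sup>2 * (2 * (x - a) $ i)))) (at 0)"
        by (simp add: Y_def E_def Q_def mult.assoc)
      show ?thesis
      proof (rule DERIV_local_min[OF d, of "w - norm (x - a)"])
        show "0 < w - norm (x - a)" using nx by simp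
        show "\<forall>y. \<bar>0 - y\<bar> < w - norm (x - a) \<longrightarrow> Y (x + 0 *\<^sub>R axis i 1) s \<le> Y (x + y *\<^sub>R axis i 1) s"
        proof (intro allI impI)
          fix y assume y: "\<bar>0 - y\<bar> < w - norm (x - a)"
          have "norm ((x - a) + y *\<^sub>R axis i 1) \<le> norm (x - a) + \<bar>y\<bar>"
            using norm_triangle_ineq[of "x - a" "y *\<^sub>R axis i 1"] by simp
          hence "norm (x + y *\<^sub>R axis i 1 - a) \<le> w" using y by (simp add: algebra_simps)
          thus "Y (x + 0 *\<^sub>R axis i 1) s \<le> Y (x + y *\<^sub>R axis i 1) s"
            using min[OF _ s] by (simp add: dist_norm norm_minus_commute)
        qed
      qed
    qed
    \<comment> \<open>The minimum may lie at the final time \<tau>, so only times to the left are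
      compared and only one sign of the time derivative results.\<close>
    have dt: "E * (\<rho>t x s - C * \<rho> x s) + Q * (N * (speed / w)) \<le> 0"
    proof (rule ccontr)
      assume a: "\<not> ?thesis"
      have "((\<lambda>s. Y x s) has_real_derivative E * (\<rho>t x s - C * \<rho> x s) + Q * (N * (speed / w))) (at s)"
        unfolding Y_def q_def E_def Q_def using w
        by (auto intro!: derivative_eq_intros D_\<rho>t[OF xO sT] simp: q_def algebra_simps)
      from has_real_derivative_pos_inc_left[OF this] a
      obtain d where d: "d > 0" "\<And>h. 0 < h \<Longrightarrow> h < d \<Longrightarrow> Y x (s - h) < Y x s" by auto
      define h where "h = min (d / 2) s"
      have "0 < h" "h < d" "h \<le> s" using d sT by (auto simp: h_def)
      thus False using d(2)[of h] min[OF x, of "s - h"] s by auto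
    qed
    have sumdx: "E * (\<Sum>i\<in>UNIV. u x s $ i * \<rho>1 i x s)
       + Q * (N * (\<Sum>i\<in>UNIV. u x s $ i * (2 / w\<^sup>2 * (x - a) $ i))) = 0"
    proof -
      have "E * (\<Sum>i\<in>UNIV. u x s $ i * \<rho>1 i x s)
         + Q * (N * (\<Sum>i\<in>UNIV. u x s $ i * (2 / w\<^sup>2 * (x - a) $ i)))
        = (\<Sum>i\<in>UNIV. u x s $ i * (E * \<rho>1 i x s + Q * (N * (1 / w\<^sup>2 * (2 * (x - a) $ i)))))"
        unfolding sum_distrib_left sum.distrib[symmetric]
        by (intro sum.cong refl) (simp add: distrib_left mult_ac del: vector_minus_component)
      also have "\<dots> = 0" by (simp only: dx) simp
      finally show ?thesis .
    qed
    have drift: "\<bar>\<Sum>i\<in>UNIV. u x s $ i * (2 / w\<^sup>2 * (x - a) $ i)\<bar> \<le> real CARD('n) * C * (2 / w)"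
    proof (rule sum_u_bound[OF xO])
      fix i
      have "\<bar>(x - a) $ i\<bar> \<le> w" using component_le_norm_cart[of "x - a" i] nx by linarith
      hence "2 / w\<^sup>2 * \<bar>(x - a) $ i\<bar> \<le> 2 / w\<^sup>2 * w" by (intro mult_left_mono) auto
      moreover have "2 / w\<^sup>2 * w = 2 / w" by (simp add: power2_eq_square)
      moreover have "\<bar>2 / w\<^sup>2 * (x - a) $ i\<bar> = 2 / w\<^sup>2 * \<bar>(x - a) $ i\<bar>"
        by (simp add: abs_mult del: vector_minus_component)
      ultimately show "\<bar>2 / w\<^sup>2 * (x - a) $ i\<bar> \<le> 2 / w" by linarith
    qed (use sT in auto)
    have "real CARD('n) * C * (2 / w) < speed / w"
      using w by (simp add: speed_def field_simps)
    hence "0 < speed / w + (\<Sum>i\<in>UNIV. u x s $ i * (2 / w\<^sup>2 * (x - a) $ i))" using drift by linarith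
    hence "0 < Q * (N * (speed / w + (\<Sum>i\<in>UNIV. u x s $ i * (2 / w\<^sup>2 * (x - a) $ i))))"
      using Q N by simp
    \<comment> \<open>Adding \<open>dt\<close> and \<open>sumdx\<close> and inserting the continuity
      equation yields a nonnegative plus a positive quantity that should be nonpositive.\<close>
    moreover have "0 \<le> E * (- \<rho> x s * (dv x s + C))"
      using E \<rho>neg dv_bound[OF xO, of s] sT by (intro mult_nonneg_nonneg) auto
    moreover have "E * (- \<rho> x s * (dv x s + C))
        = E * (\<rho>t x s + (\<Sum>i\<in>UNIV. u x s $ i * \<rho>1 i x s) - C * \<rho> x s)"
    proof -
      have "\<rho>t x s + (\<Sum>i\<in>UNIV. u x s $ i * \<rho>1 i x s) = - (\<rho> x s * dv x s)"
        using transport[OF xO sT] by linarith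
      thus ?thesis by (simp add: algebra_simps)
    qed
    ultimately show False using dt sumdx by (simp add: algebra_simps)
  qed
  hence "0 \<le> Y a t" using min[of a t] w t by force
  thus ?thesis by (simp add: Y_def q_def)
qed

text \<open>With \<open>w = 2 * speed * \<tau>\<close> the cone exponent is at most - N / 2. Instead
  of a limit in \<open>N\<close>, the explicit value 2 C / p suffices, where \<open>p\<close> is the
  weighted negative part: p \<le> C exp (- C / p) contradicts exp z \<ge> 1 + z.\<close>

lemma \<rho>_nonneg:
  assumes \<tau>: "0 < \<tau>" "\<tau> < T" and sub: "cball a (2 * speed * \<tau>) \<subseteq> \<Omega>" and t: "t \<in> {0..\<tau>}"
  shows "0 \<le> \<rho> a t"
proof (rule ccontr)
  assume neg: "\<not> 0 \<le> \<rho> a t"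
  define p where "p = - (exp (- (C * t)) * \<rho> a t)"
  have p: "p > 0" using neg by (simp add: p_def mult_less_0_iff)
  let ?w = "2 * speed * \<tau>" and ?N = "2 * (C / p)"
  have w: "0 < ?w" using speed_ge \<tau> by simp
  have "speed * t / ?w \<le> 1 / 2" using t \<tau> speed_ge by (simp add: field_simps)
  hence "?N * (speed * t / ?w - 1) \<le> ?N * (- 1 / 2)" using C p by (intro mult_left_mono) auto
  hence "exp (?N * (speed * t / ?w - 1)) \<le> exp (- (C / p))" by simp
  hence "C * exp (?N * (speed * t / ?w - 1)) \<le> C * exp (- (C / p))"
    using C by (intro mult_left_mono) auto
  moreover have "p \<le> C * exp (?N * (speed * t / ?w - 1))"
  proof -
    have "exp (- (C * t)) * \<rho> a t = - p" by (simp add: p_def)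
    moreover have "0 < ?N" using C p by simp
    ultimately show ?thesis using \<rho>_cone_bound[OF \<tau> w sub t, of ?N] by simp
  qed
  ultimately have "p \<le> C * exp (- (C / p))" by linarith
  hence "p * exp (C / p) \<le> C" using p by (simp add: exp_minus field_simps)
  moreover have "p * (1 + C / p) \<le> p * exp (C / p)"
    using p by (intro mult_left_mono exp_ge_add_one_self) auto
  moreover have "p * (1 + C / p) = p + C" using p by (simp add: field_simps)
  ultimately show False using p by linarith
qed

text \<open>The ball of radius \<open>2 * speed * \<tau>\<close> cannot lie in \<Omega>, so by
  connectedness it meets the frontier. This bounds the width of the strip where the density can be
  negative.\<close>

lemma \<rho>_neg_imp_near_frontier:
  assumes \<tau>: "0 < \<tau>" "\<tau> < T" and a: "a \<in> \<Omega>" and t: "t \<in> {0..\<tau>}" and neg: "\<rho> a t < 0"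
  shows "\<exists>y\<in>frontier \<Omega>. dist a y \<le> 2 * speed * \<tau>"
proof -
  have "\<not> cball a (2 * speed * \<tau>) \<subseteq> \<Omega>" using \<rho>_nonneg[OF \<tau> _ t] neg by force
  hence "cball a (2 * speed * \<tau>) - \<Omega> \<noteq> {}" by blast
  moreover have "cball a (2 * speed * \<tau>) \<inter> \<Omega> \<noteq> {}" using a speed_ge \<tau> by force
  moreover have "connected (cball a (2 * speed * \<tau>))" by (rule convex_connected[OF convex_cball])
  ultimately have "cball a (2 * speed * \<tau>) \<inter> frontier \<Omega> \<noteq> {}"
    using connected_Int_frontier by blast
  thus ?thesis by auto
qed

text \<open>Contact from below is tested separately in space, by \<open>G\<close>, and in time, by
  \<open>h\<close>, so a barrier need not be jointly smooth. Since the time is interior, the time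
  derivatives are equal rather than merely ordered, and multiplication by \<rho> of unknown sign is
  harmless.\<close>

lemma supersolution_touch:
  assumes x: "x \<in> \<Omega>" and t: "t \<in> {0<..<T}" and \<delta>: "\<delta> > 0"
    and G: "axis_C2 (ball x \<delta>) G G1 G2"
    and le: "\<And>y. y \<in> ball x \<delta> \<Longrightarrow> y \<in> \<Omega> \<Longrightarrow> G y \<le> e y t" and eq: "G x = e x t"
    and h: "(h has_real_derivative ht) (at t)"
    and hle: "\<And>s. \<bar>s - t\<bar> < \<delta> \<Longrightarrow> h s \<le> e x s" and heq: "h t = e x t"
  shows "\<kappa> * (\<Sum>i\<in>UNIV. G2 i x) \<le> \<rho> x t * (ht + (\<Sum>i\<in>UNIV. u x t $ i * G1 i x) + g * dv x t * G x)"
proof -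
  have "open (ball x \<delta> \<inter> \<Omega>)" using op by auto
  then obtain d where d: "d > 0" "ball x d \<subseteq> ball x \<delta> \<inter> \<Omega>" using x \<delta> by (meson IntI centre_in_ball openE)
  have "axis_C2 (ball x d) (\<lambda>y. e y t) (\<lambda>i y. e1 i y t) (\<lambda>i y. e2 i i y t)"
    unfolding axis_C2_def using D_ex D_exx t d by blast
  hence C2: "axis_C2 (ball x d) (\<lambda>y. e y t - G y) (\<lambda>i y. e1 i y t - G1 i y) (\<lambda>i y. e2 i i y t - G2 i y)"
    using d by (intro axis_C2_diff axis_C2_subset[OF G]) auto
  have min: "e x t - G x \<le> e y t - G y" if "y \<in> ball x d" for y
  proof -
    have "y \<in> ball x \<delta>" "y \<in> \<Omega>" using that d by blast+
    thus ?thesis using le[of y] eq by simp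
  qed
  have 1: "e1 i x t = G1 i x" "G2 i x \<le> e2 i i x t" for i
    using axis_C2_at_min[OF C2 d(1) min, of i] by auto
  have "((\<lambda>s. e x s - h s) has_real_derivative et x t - ht) (at t)"
    by (intro DERIV_diff D_et h x t)
  hence "et x t - ht = 0"
    by (rule DERIV_local_min[OF _ \<delta>]) (use hle heq in \<open>auto simp: abs_minus_commute\<close>)
  hence 2: "et x t = ht" by simp
  have "(\<Sum>i\<in>UNIV. G2 i x) \<le> (\<Sum>i\<in>UNIV. e2 i i x t)" by (intro sum_mono 1)
  hence "\<kappa> * (\<Sum>i\<in>UNIV. G2 i x) \<le> \<kappa> * (\<Sum>i\<in>UNIV. e2 i i x t)" using \<kappa> by (intro mult_left_mono) auto
  also have "\<dots> \<le> \<rho> x t * (ht + (\<Sum>i\<in>UNIV. u x t $ i * G1 i x) + g * dv x t * G x)"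
    using heat[OF x t] 1 2 eq by simp
  finally show ?thesis .
qed

end

section \<open>The comparison principle for a density of either sign\<close>

context degenerate_heat_flow
begin

text \<open>The quotient of e - max(G, 0) by the weight \<open>Z\<close> attains a minimum m on the
  closed cylinder, and the claim is m \<ge> - M. Otherwise the initial, lateral and final conditions
  force the minimum to an interior point and an interior time, where max(G, 0) + m Z touches
  \<open>e\<close> from below, against the strict supersolution property of
  \<open>Z\<close>.\<close>

lemma comparison:
  fixes G Gt :: "real^'n \<Rightarrow> real \<Rightarrow> real" and G1 G2 :: "'n \<Rightarrow> real^'n \<Rightarrow> real \<Rightarrow> real"
  assumes \<tau>: "0 < \<tau>" "\<tau> < T"
    and cont_G: "continuous_on UNIV (\<lambda>(x, t). G x t)"
    and G_init: "\<And>x. x \<in> \<Omega> \<Longrightarrow> G x 0 \<le> e x 0"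
    and G_frontier: "\<And>x t. x \<in> frontier \<Omega> \<Longrightarrow> t \<in> {0..\<tau>} \<Longrightarrow> G x t \<le> 0"
    and G_final: "\<And>x. x \<in> closure \<Omega> \<Longrightarrow> G x \<tau> \<le> M - C" and M: "C \<le> M"
    and G_C2: "\<And>t. axis_C2 UNIV (\<lambda>x. G x t) (\<lambda>i x. G1 i x t) (\<lambda>i x. G2 i x t)"
    and D_Gt: "\<And>x t. (G x has_real_derivative Gt x t) (at t)"
    and G_sub: "\<And>x t. x \<in> \<Omega> \<Longrightarrow> t \<in> {0<..<\<tau>} \<Longrightarrow> 0 < G x t \<Longrightarrow>
       \<rho> x t * (Gt x t + (\<Sum>i\<in>UNIV. u x t $ i * G1 i x t) + g * dv x t * G x t) \<le> \<kappa> * (\<Sum>i\<in>UNIV. G2 i x t)"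
    and cont_\<zeta>: "continuous_on UNIV \<zeta>" and \<zeta>_ge: "\<And>x. x \<in> closure \<Omega> \<Longrightarrow> 1 \<le> \<zeta> x"
    and \<zeta>_super: "\<And>x. x \<in> \<Omega> \<Longrightarrow> \<exists>\<delta> z z1 z2. \<delta> > 0 \<and> axis_C2 (ball x \<delta>) z z1 z2 \<and>
          (\<forall>y\<in>ball x \<delta>. \<zeta> y \<le> z y) \<and> z x = \<zeta> x \<and>
          (\<forall>t\<in>{0<..<\<tau>}. \<kappa> * (\<Sum>i\<in>UNIV. z2 i x)
             < \<rho> x t * (r * \<zeta> x + (\<Sum>i\<in>UNIV. u x t $ i * z1 i x) + g * dv x t * \<zeta> x))"
    and x: "x \<in> closure \<Omega>" and t: "t \<in> {0..\<tau>}"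
  shows "G x t - M * (exp (r * (t - \<tau>)) * \<zeta> x) \<le> e x t"
proof -
  define Z where "Z = (\<lambda>x t. exp (r * (t - \<tau>)) * \<zeta> x)"
  define Q where "Q = (\<lambda>x t. (e x t - max (G x t) 0) / Z x t)"
  let ?K = "closure \<Omega> \<times> {0..\<tau>}"
  have Z: "0 < Z x t" if "x \<in> closure \<Omega>" for x t
    using \<zeta>_ge[OF that] by (simp add: Z_def)
  have "continuous_on ?K (\<lambda>z. e (fst z) (snd z))"
    using \<tau> by (intro continuous_on_subset[OF cont_e, unfolded case_prod_beta]) auto
  moreover have "continuous_on ?K (\<lambda>z. G (fst z) (snd z))"
    by (intro continuous_on_subset[OF cont_G, unfolded case_prod_beta]) auto
  moreover have "continuous_on ?K (\<lambda>z. \<zeta> (fst z))"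
    by (intro continuous_on_compose2[OF cont_\<zeta>] continuous_intros) auto
  moreover have "\<forall>z\<in>?K. exp (r * (snd z - \<tau>)) * \<zeta> (fst z) \<noteq> 0"
    using Z by (force simp: Z_def)
  ultimately have "continuous_on ?K (\<lambda>z. Q (fst z) (snd z))"
    unfolding Q_def Z_def by (intro continuous_intros)
  moreover have "compact ?K" using bd by (intro compact_Times) auto
  moreover have "?K \<noteq> {}" using x \<tau> by auto
  ultimately obtain zm where zm: "zm \<in> ?K" "\<forall>z\<in>?K. Q (fst zm) (snd zm) \<le> Q (fst z) (snd z)"
    using continuous_attains_inf by blast
  define y s where "y = fst zm" and "s = snd zm"
  have y: "y \<in> closure \<Omega>" and s: "s \<in> {0..\<tau>}" using zm(1) by (auto simp: y_def s_def)
  define m where "m = Q y s"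
  have min: "m \<le> Q y' s'" if "y' \<in> closure \<Omega>" "s' \<in> {0..\<tau>}" for y' s'
    using zm(2)[rule_format, of "(y', s')"] that by (simp add: m_def y_def s_def)
  have min': "max (G y' s') 0 + m * Z y' s' \<le> e y' s'" if "y' \<in> closure \<Omega>" "s' \<in> {0..\<tau>}" for y' s'
    using min[OF that] Z[OF that(1), of s'] by (simp add: Q_def field_simps)
  have eq: "max (G y s) 0 + m * Z y s = e y s"
    using Z[OF y, of s] by (simp add: m_def Q_def field_simps)
  have "- M \<le> m"
  proof (rule ccontr)
    assume "\<not> - M \<le> m"
    hence m: "m < - M" "m < 0" using M C by auto
    have mZ: "m * Z y s < 0" using m Z[OF y] by (simp add: mult_less_0_iff)
    have "y \<notin> frontier \<Omega>"
      using eq mZ e_frontier[of y s] G_frontier[of y s] s \<tau> by auto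
    hence y\<Omega>: "y \<in> \<Omega>" using y op by (simp add: frontier_def interior_open)
    have "s \<noteq> 0" using eq mZ G_init[OF y\<Omega>] e_init[OF y\<Omega>] by auto
    moreover have "s \<noteq> \<tau>"
    proof
      assume s\<tau>: "s = \<tau>"
      \<comment> \<open>At the final time \<open>Z\<close> equals \<zeta> \<ge> 1, so the barrier
        would lie below (M - C) - M = - C, the lower bound for \<open>e\<close>.\<close>
      have "m * \<zeta> y \<le> m * 1" using m \<zeta>_ge[OF y] by (intro mult_left_mono_neg) auto
      hence "m * \<zeta> y \<le> m" by (simp only: mult_1_right)
      moreover have "- C \<le> e y s" using e_bound[OF y, of s] s \<tau> by auto
      moreover have "max (G y s) 0 \<le> M - C" using G_final[OF y] M s\<tau> by auto
      moreover have "max (G y s) 0 + m * \<zeta> y = e y s" using eq by (simp add: Z_def s\<tau>)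
      ultimately show False using m by linarith
    qed
    ultimately have s': "s \<in> {0<..<\<tau>}" and sT: "s \<in> {0<..<T}" using s \<tau> by auto
    obtain \<delta> z z1 z2 where z: "\<delta> > 0 \<and> axis_C2 (ball y \<delta>) z z1 z2 \<and>
          (\<forall>y'\<in>ball y \<delta>. \<zeta> y' \<le> z y') \<and> z y = \<zeta> y \<and>
          (\<forall>t\<in>{0<..<\<tau>}. \<kappa> * (\<Sum>i\<in>UNIV. z2 i y)
             < \<rho> y t * (r * \<zeta> y + (\<Sum>i\<in>UNIV. u y t $ i * z1 i y) + g * dv y t * \<zeta> y))"
      using \<zeta>_super[OF y\<Omega>] by (elim exE)
    \<comment> \<open>The maximum is replaced by whichever of \<open>G\<close> and 0 attains it at
      the contact point; both are subsolutions there and lie below the maximum in space and in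
      time.\<close>
    have "\<exists>H H1 H2 h ht. axis_C2 UNIV H H1 H2 \<and> (\<forall>y'. H y' \<le> max (G y' s) 0) \<and> H y = max (G y s) 0 \<and>
        (h has_real_derivative ht) (at s) \<and> (\<forall>s'. h s' \<le> max (G y s') 0) \<and> h s = max (G y s) 0 \<and>
        \<rho> y s * (ht + (\<Sum>i\<in>UNIV. u y s $ i * H1 i y) + g * dv y s * H y) \<le> \<kappa> * (\<Sum>i\<in>UNIV. H2 i y)"
    proof (cases "0 < G y s")
      case True
      show ?thesis
        by (rule exI[of _ "\<lambda>x. G x s"], rule exI[of _ "\<lambda>i x. G1 i x s"], rule exI[of _ "\<lambda>i x. G2 i x s"],
            rule exI[of _ "G y"], rule exI[of _ "Gt y s"])
          (use G_C2 D_Gt G_sub[OF y\<Omega> s' True] True in auto)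
    next
      case False
      show ?thesis
        by (rule exI[of _ "\<lambda>x. 0"], rule exI[of _ "\<lambda>i x. 0"], rule exI[of _ "\<lambda>i x. 0"],
            rule exI[of _ "\<lambda>x. 0"], rule exI[of _ 0])
          (use False in \<open>auto simp: axis_C2_const\<close>)
    qed
    then obtain H H1 H2 h ht where H: "axis_C2 UNIV H H1 H2" "\<And>y'. H y' \<le> max (G y' s) 0"
        "H y = max (G y s) 0" "(h has_real_derivative ht) (at s)" "\<And>s'. h s' \<le> max (G y s') 0"
        "h s = max (G y s) 0"
        "\<rho> y s * (ht + (\<Sum>i\<in>UNIV. u y s $ i * H1 i y) + g * dv y s * H y) \<le> \<kappa> * (\<Sum>i\<in>UNIV. H2 i y)"
      by auto
    \<comment> \<open>The coefficient of \<zeta> at the contact time. As it is negative, the test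
      function \<open>z\<close> above \<zeta> becomes one below after multiplication.\<close>
    define b where "b = m * exp (r * (s - \<tau>))"
    have b: "b < 0" using m by (simp add: b_def mult_less_0_iff)
    define d where "d = min \<delta> (min s (\<tau> - s))"
    have d: "d > 0" "d \<le> \<delta>" "d \<le> s" "d \<le> \<tau> - s" using z s' by (auto simp: d_def)
    have "\<kappa> * (\<Sum>i\<in>UNIV. H2 i y + b * z2 i y) \<le> \<rho> y s * ((ht + b * r * \<zeta> y)
       + (\<Sum>i\<in>UNIV. u y s $ i * (H1 i y + b * z1 i y)) + g * dv y s * (H y + b * z y))"
    proof (rule supersolution_touch[of y s d "\<lambda>x. H x + b * z x" "\<lambda>i x. H1 i x + b * z1 i x"
          "\<lambda>i x. H2 i x + b * z2 i x" "\<lambda>s'. h s' + m * Z y s'", OF y\<Omega> sT d(1)])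
      have "axis_C2 (ball y d) z z1 z2" using z d by (auto intro: axis_C2_subset)
      thus "axis_C2 (ball y d) (\<lambda>x. H x + b * z x) (\<lambda>i x. H1 i x + b * z1 i x) (\<lambda>i x. H2 i x + b * z2 i x)"
        by (intro axis_C2_add axis_C2_cmult axis_C2_subset[OF H(1)]) auto
      have zy: "z y = \<zeta> y" using z by simp
      show "H y + b * z y = e y s" using eq H(3) zy by (simp add: b_def Z_def)
      show "h s + m * Z y s = e y s" using eq H(6) by simp
      show "((\<lambda>s'. h s' + m * Z y s') has_real_derivative ht + b * r * \<zeta> y) (at s)"
        unfolding Z_def b_def by (auto intro!: derivative_eq_intros H(4))
      show "h s' + m * Z y s' \<le> e y s'" if "\<bar>s' - s\<bar> < d" for s'
      proof -
        have "0 \<le> s'" "s' \<le> \<tau>" using that d by linarith+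
        thus ?thesis using min'[OF y, of s'] H(5)[of s'] by auto
      qed
      show "H y' + b * z y' \<le> e y' s" if "y' \<in> ball y d" "y' \<in> \<Omega>" for y'
      proof -
        have "\<zeta> y' \<le> z y'" using z that d by auto
        hence "b * z y' \<le> b * \<zeta> y'" using b by (intro mult_left_mono_neg) auto
        moreover have "max (G y' s) 0 + m * Z y' s \<le> e y' s"
          using that closure_subset s by (intro min') auto
        ultimately show ?thesis using H(2)[of y'] by (simp add: b_def Z_def)
      qed
    qed
    moreover have "\<rho> y s * ((ht + b * r * \<zeta> y)
         + (\<Sum>i\<in>UNIV. u y s $ i * (H1 i y + b * z1 i y)) + g * dv y s * (H y + b * z y))
       = \<rho> y s * (ht + (\<Sum>i\<in>UNIV. u y s $ i * H1 i y) + g * dv y s * H y)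
         + b * (\<rho> y s * (r * \<zeta> y + (\<Sum>i\<in>UNIV. u y s $ i * z1 i y) + g * dv y s * \<zeta> y))"
      using z by (simp add: algebra_simps sum.distrib sum_distrib_left)
    moreover have "\<kappa> * (\<Sum>i\<in>UNIV. H2 i y + b * z2 i y)
       = \<kappa> * (\<Sum>i\<in>UNIV. H2 i y) + b * (\<kappa> * (\<Sum>i\<in>UNIV. z2 i y))"
      by (simp add: algebra_simps sum.distrib sum_distrib_left)
    \<comment> \<open>Multiplying the strict inequality for \<open>z\<close> by the negative
      \<open>b\<close> reverses it, which excludes contact.\<close>
    moreover have "b * (\<rho> y s * (r * \<zeta> y + (\<Sum>i\<in>UNIV. u y s $ i * z1 i y) + g * dv y s * \<zeta> y))
       < b * (\<kappa> * (\<Sum>i\<in>UNIV. z2 i y))"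
      using z s' b by (intro mult_strict_left_mono_neg) auto
    ultimately show False using H(7) by linarith
  qed
  hence "- M * Z x t \<le> m * Z x t" using Z[OF x, of t] by (intro mult_right_mono) auto
  thus ?thesis using min'[OF x t] by (simp add: Z_def)
qed

end

section \<open>Hopf barrier and touching ball\<close>

text \<open>The pointwise inequality making the Hopf barrier a subsolution: \<open>E\<close> is the
  Gaussian at \<open>x\<close>, \<open>E'\<close> its value on the moving sphere, \<open>S'\<close>
  the derivative of the squared radius, \<open>W\<close> the drift, \<open>v\<close> the zero-order
  coefficient and \<open>q\<close> the squared distance to the centre. In the core \<rho> is bounded
  below and damping of order k^2 wins; outside it the Laplacian has order k^2, while \<rho> \<ge> -
  C / k makes adverse damping cost only order \<open>k\<close>.\<close>

lemma barrier_coefficients: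
  fixes n C \<kappa> r0 d0 \<rho>m :: real
  assumes n: "1 \<le> n" and C: "1 \<le> C" and \<kappa>: "0 < \<kappa>" and r0: "0 < r0" and d0: "0 < d0" and \<rho>m: "0 < \<rho>m"
  obtains a A k1 where "1 \<le> a" "2 \<le> a * r0\<^sup>2" "0 < A"
    "\<And>k \<rho> S' W v q E E'. k1 \<le> k \<Longrightarrow> 1 \<le> k \<Longrightarrow> 0 < E' \<Longrightarrow> E' < E \<Longrightarrow> \<bar>\<rho>\<bar> \<le> C \<Longrightarrow> - C / k \<le> \<rho> \<Longrightarrow>
       \<bar>S'\<bar> \<le> 4 * d0\<^sup>2 * k \<Longrightarrow> \<bar>W\<bar> \<le> n * C * (E * (a * k * (2 * d0))) \<Longrightarrow> \<bar>v\<bar> \<le> C * C \<Longrightarrow> 0 \<le> q \<Longrightarrow>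
       (q < r0\<^sup>2 / 4 \<Longrightarrow> \<rho>m \<le> \<rho> \<and> E' \<le> E / 2) \<Longrightarrow>
       \<rho> * ((- (A * k\<^sup>2 * (E - E')) + a * k * S' * E') + W + v * (E - E'))
         \<le> \<kappa> * (E * (4 * (a * k)\<^sup>2 * q - 2 * n * (a * k)))"
proof -
  \<comment> \<open>The summands yield a \<ge> 1, a r0^2 \<ge> 2 (so that the Gaussian has dropped
    by half between core and sphere) and \<kappa> a r0^2 \<ge> 4 d0^2 C + 1 (so that the Laplacian
    beats the motion of the sphere).\<close>
  define a where "a = 1 + 2 / r0\<^sup>2 + (4 * d0\<^sup>2 * C + 1) / (\<kappa> * r0\<^sup>2)"
  define P where "P = 4 * d0\<^sup>2 * a * C"
  define R1 where "R1 = 2 * n * C * C * d0 * a + C * C * C"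
  \<comment> \<open>Solves \<rho>m A / 2 = P + R1 + 2 n \<kappa> a, the balance required in the
    core.\<close>
  define A where "A = 2 * (P + R1 + 2 * n * \<kappa> * a) / \<rho>m"
  \<comment> \<open>The sum of all coefficients of order \<open>k\<close> in the outer region,
    absorbed there by the spare term a k^2.\<close>
  define k1 where "k1 = R1 + C * A + 2 * n * \<kappa> * a"
  have pos: "0 < 2 / r0\<^sup>2" "0 < (4 * d0\<^sup>2 * C + 1) / (\<kappa> * r0\<^sup>2)" 
    using r0 \<kappa> C d0 by (simp_all add: add_pos_pos)
  have a1: "1 \<le> a" using pos by (simp add: a_def)
  have "2 / r0\<^sup>2 * r0\<^sup>2 \<le> a * r0\<^sup>2" using pos by (intro mult_right_mono) (auto simp: a_def)
  hence a2: "2 \<le> a * r0\<^sup>2" using r0 by simp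
  have "(4 * d0\<^sup>2 * C + 1) / (\<kappa> * r0\<^sup>2) * (\<kappa> * r0\<^sup>2) \<le> a * (\<kappa> * r0\<^sup>2)"
    using pos \<kappa> by (intro mult_right_mono) (auto simp: a_def)
  hence a3: "4 * d0\<^sup>2 * C + 1 \<le> a * (\<kappa> * r0\<^sup>2)" using r0 \<kappa> by simp
  have P0: "P > 0" using a1 C d0 by (simp add: P_def)
  have R0: "R1 > 0" using a1 C d0 n by (simp add: R1_def add_pos_pos)
  have N0: "0 < 2 * n * \<kappa> * a" using a1 n \<kappa> by simp
  have "0 < P + R1 + 2 * n * \<kappa> * a" using P0 R0 N0 by linarith
  hence A0: "A > 0" unfolding A_def using \<rho>m by (intro divide_pos_pos) auto
  show ?thesis
  proof (rule that[OF a1 a2 A0])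
    fix k \<rho> S' W v q E E' :: real
    assume k: "k1 \<le> k" "1 \<le> k" and E: "0 < E'" "E' < E" and \<rho>: "\<bar>\<rho>\<bar> \<le> C" "- C / k \<le> \<rho>"
      and S': "\<bar>S'\<bar> \<le> 4 * d0\<^sup>2 * k" and W: "\<bar>W\<bar> \<le> n * C * (E * (a * k * (2 * d0)))" and v: "\<bar>v\<bar> \<le> C * C"
      and q: "0 \<le> q" and core: "q < r0\<^sup>2 / 4 \<Longrightarrow> \<rho>m \<le> \<rho> \<and> E' \<le> E / 2"
    define X where "X = a * k * S' * E' + W + v * (E - E')"
    have E0: "0 < E" using E by linarith
    have kk: "1 * k \<le> k * k" using k by (intro mult_right_mono) auto
    have X: "\<bar>X\<bar> \<le> (4 * d0\<^sup>2 * a * k\<^sup>2 + (2 * n * C * d0 * a + C * C) * k) * E"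
    proof -
      have "\<bar>a * k * S' * E'\<bar> \<le> a * k * (4 * d0\<^sup>2 * k) * E"
        unfolding abs_mult using a1 k S' E by (intro mult_mono) auto
      moreover have "\<bar>v * (E - E')\<bar> \<le> C * C * E"
        unfolding abs_mult using v E C by (intro mult_mono) auto
      moreover have "C * C * E * 1 \<le> C * C * E * k" using k C E0 by (intro mult_left_mono) auto
      ultimately have "\<bar>X\<bar> \<le> a * k * (4 * d0\<^sup>2 * k) * E + n * C * (E * (a * k * (2 * d0))) + C * C * E * k"
        unfolding X_def using W by linarith
      also have "\<dots> = (4 * d0\<^sup>2 * a * k\<^sup>2 + (2 * n * C * d0 * a + C * C) * k) * E"
        by (simp add: algebra_simps power2_eq_square)
      finally show ?thesis .
    qed
    have \<rho>X: "\<rho> * X \<le> (P * k\<^sup>2 + R1 * k) * E"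
    proof -
      have "\<rho> * X \<le> \<bar>\<rho>\<bar> * \<bar>X\<bar>" by (metis abs_ge_self abs_mult)
      also have "\<dots> \<le> C * ((4 * d0\<^sup>2 * a * k\<^sup>2 + (2 * n * C * d0 * a + C * C) * k) * E)"
        using \<rho> X C by (intro mult_mono) auto
      also have "\<dots> = (P * k\<^sup>2 + R1 * k) * E" by (simp add: P_def R1_def algebra_simps)
      finally show ?thesis .
    qed
    have split: "\<rho> * ((- (A * k\<^sup>2 * (E - E')) + a * k * S' * E') + W + v * (E - E'))
       = \<rho> * X - \<rho> * (A * k\<^sup>2 * (E - E'))"
      by (simp add: X_def algebra_simps)
    show "\<rho> * ((- (A * k\<^sup>2 * (E - E')) + a * k * S' * E') + W + v * (E - E'))
         \<le> \<kappa> * (E * (4 * (a * k)\<^sup>2 * q - 2 * n * (a * k)))"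
    proof (cases "q < r0\<^sup>2 / 4")
      case True
      define YY QQ PE RE RE2 NE NE2 where
        "YY = \<rho> * (A * k\<^sup>2 * (E - E'))" "QQ = \<kappa> * (E * (4 * (a * k)\<^sup>2 * q))"
        "PE = P * k\<^sup>2 * E" "RE = R1 * k * E" "RE2 = R1 * k\<^sup>2 * E"
        "NE = 2 * n * \<kappa> * a * k * E" "NE2 = 2 * n * \<kappa> * a * k\<^sup>2 * E"
      note defs = this
      have "\<rho>m * (A * k\<^sup>2 * (E / 2)) \<le> \<rho> * (A * k\<^sup>2 * (E - E'))"
        using core[OF True] \<rho>m A0 E0 by (intro mult_mono) auto
      moreover have "\<rho>m * (A * k\<^sup>2 * (E / 2)) = (P + R1 + 2 * n * \<kappa> * a) * k\<^sup>2 * E"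
        using \<rho>m by (simp add: A_def)
      ultimately have 1: "PE + RE2 + NE2 \<le> YY" by (simp add: defs distrib_right)
      have 2: "RE \<le> RE2" unfolding defs
        using kk R0 E0 by (intro mult_right_mono mult_left_mono) (auto simp: power2_eq_square)
      have 3: "NE \<le> NE2" unfolding defs
        using kk N0 E0 by (intro mult_right_mono mult_left_mono) (auto simp: power2_eq_square)
      have 4: "0 \<le> QQ" using \<kappa> E0 q by (simp add: defs)
      have 5: "\<kappa> * (E * (4 * (a * k)\<^sup>2 * q - 2 * n * (a * k))) = QQ - NE"
        by (simp add: defs algebra_simps)
      have 6: "\<rho> * X \<le> PE + RE" using \<rho>X by (simp add: defs distrib_right)
      show ?thesis unfolding split 5 defs(1)[symmetric] using 1 2 3 4 6 by linarith
    next
      case False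
      have "- \<rho> * (A * k\<^sup>2 * (E - E')) \<le> C / k * (A * k\<^sup>2 * (E - E'))"
        using \<rho>(2) A0 E by (intro mult_right_mono) auto
      also have "\<dots> \<le> C / k * (A * k\<^sup>2 * E)"
        using C k A0 E by (intro mult_left_mono) auto
      also have "\<dots> = C * A * k * E" using k by (simp add: power2_eq_square)
      finally have 1: "- \<rho> * (A * k\<^sup>2 * (E - E')) \<le> C * A * k * E" .
      define YY QQ PE RE CE NE aE where
        "YY = \<rho> * (A * k\<^sup>2 * (E - E'))" "QQ = \<kappa> * (E * (4 * (a * k)\<^sup>2 * q))"
        "PE = P * k\<^sup>2 * E" "RE = R1 * k * E" "CE = C * A * k * E"
        "NE = 2 * n * \<kappa> * a * k * E" "aE = a * k\<^sup>2 * E"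
      note defs = this
      have "\<kappa> * (E * (4 * (a * k)\<^sup>2 * (r0\<^sup>2 / 4))) \<le> \<kappa> * (E * (4 * (a * k)\<^sup>2 * q))"
        using False \<kappa> E0 by (intro mult_left_mono) auto
      moreover have "\<kappa> * (E * (4 * (a * k)\<^sup>2 * (r0\<^sup>2 / 4))) = (a * (\<kappa> * r0\<^sup>2)) * (a * k\<^sup>2 * E)"
        by (simp add: power_mult_distrib power2_eq_square)
      moreover have "(4 * d0\<^sup>2 * C + 1) * (a * k\<^sup>2 * E) \<le> (a * (\<kappa> * r0\<^sup>2)) * (a * k\<^sup>2 * E)"
        using a3 a1 E0 by (intro mult_right_mono) auto
      ultimately have "(4 * d0\<^sup>2 * C + 1) * (a * k\<^sup>2 * E) \<le> QQ" by (simp only: defs)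
      moreover have "(4 * d0\<^sup>2 * C + 1) * (a * k\<^sup>2 * E) = PE + aE"
        by (simp add: defs P_def algebra_simps)
      ultimately have 2: "PE + aE \<le> QQ" by simp
      have "k1 * (k * E) \<le> (a * k) * (k * E)"
      proof (intro mult_right_mono)
        have "1 * k \<le> a * k" using a1 k by (intro mult_right_mono) auto
        thus "k1 \<le> a * k" using k by linarith
      qed (use k E0 in auto)
      moreover have "k1 * (k * E) = RE + CE + NE" "(a * k) * (k * E) = aE"
        by (simp_all add: defs k1_def algebra_simps power2_eq_square)
      ultimately have 3: "RE + CE + NE \<le> aE" by simp
      have 4: "\<kappa> * (E * (4 * (a * k)\<^sup>2 * q - 2 * n * (a * k))) = QQ - NE"
        by (simp add: defs algebra_simps)
      have 5: "\<rho> * X \<le> PE + RE" using \<rho>X by (simp add: defs distrib_right)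
      have 6: "- YY \<le> CE" using 1 by (simp add: defs)
      show ?thesis unfolding split 4 defs(1)[symmetric] using 2 3 5 6 by linarith
    qed
  qed
qed

text \<open>The bracket on the right is nonnegative and of order k^2. Where \<rho> \<ge> 0 the sign
  of \<open>s\<close> suffices; where \<rho> < 0 the right side is at least of order - k, while
  \<open>s\<close> has order - k^2. Thus \<open>B\<close> may be arbitrarily large at the price of a
  larger threshold \<open>k2\<close>.\<close>

lemma layer_coefficients:
  fixes n C \<kappa> c0 K B :: real
  assumes n: "1 \<le> n" and C: "1 \<le> C" and \<kappa>: "0 < \<kappa>" and c0: "0 < c0" and K: "1 \<le> K"
    and B: "n * C * K + C * C * K \<le> B"
  obtains k2 where
    "\<And>k \<rho> \<zeta> W v s. k2 \<le> k \<Longrightarrow> 1 \<le> k \<Longrightarrow> 1 \<le> \<zeta> \<Longrightarrow> \<zeta> \<le> K \<Longrightarrow> \<bar>W\<bar> \<le> n * C * (K * k) \<Longrightarrow> \<bar>v\<bar> \<le> C * C \<Longrightarrow> s < 0 \<Longrightarrow>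
       - C / k \<le> \<rho> \<Longrightarrow> (\<rho> < 0 \<Longrightarrow> s \<le> - c0 * k\<^sup>2) \<Longrightarrow>
       \<kappa> * s < \<rho> * (B * k\<^sup>2 * \<zeta> + W + v * \<zeta>)"
proof (rule that)
  fix k \<rho> \<zeta> W v s :: real
  \<comment> \<open>The first assumption fixes the witness for \<open>k2\<close> by
    unification.\<close>
  assume k: "1 + 2 * C * B * K / (\<kappa> * c0) \<le> k" "1 \<le> k" and \<zeta>: "1 \<le> \<zeta>" "\<zeta> \<le> K"
    and W: "\<bar>W\<bar> \<le> n * C * (K * k)" and v: "\<bar>v\<bar> \<le> C * C" and s: "s < 0"
    and \<rho>: "- C / k \<le> \<rho>" "\<rho> < 0 \<Longrightarrow> s \<le> - c0 * k\<^sup>2"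
  define X where "X = B * k\<^sup>2 * \<zeta> + W + v * \<zeta>"
  have "0 < n * C * K + C * C * K" using n C K by (simp add: add_pos_pos)
  hence B0: "0 < B" using B by linarith
  have kk: "1 * k \<le> k * k" using k by (intro mult_right_mono) auto
  have "n * C * K * k \<le> n * C * K * k\<^sup>2" using kk n C K by (intro mult_left_mono) (auto simp: power2_eq_square)
  moreover have "\<bar>v * \<zeta>\<bar> \<le> C * C * K" unfolding abs_mult using v \<zeta> C by (intro mult_mono) auto
  moreover have "C * C * K * 1 \<le> C * C * K * k\<^sup>2" using kk k C K by (intro mult_left_mono) auto
  moreover have "(n * C * K + C * C * K) * k\<^sup>2 \<le> B * k\<^sup>2" using B by (intro mult_right_mono) auto
  moreover have "(n * C * K + C * C * K) * k\<^sup>2 = n * C * K * k\<^sup>2 + C * C * K * k\<^sup>2" by (simp add: algebra_simps)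
  moreover have "n * C * (K * k) = n * C * K * k" by simp
  ultimately have small: "\<bar>W\<bar> + \<bar>v * \<zeta>\<bar> \<le> B * k\<^sup>2" using W by linarith
  have "B * k\<^sup>2 * 1 \<le> B * k\<^sup>2 * \<zeta>" "B * k\<^sup>2 * \<zeta> \<le> B * k\<^sup>2 * K" "B * k\<^sup>2 * 1 \<le> B * k\<^sup>2 * K"
    using B0 \<zeta> K by (intro mult_left_mono; simp)+
  hence X: "0 \<le> X" "X \<le> 2 * (B * k\<^sup>2 * K)" unfolding X_def using small by linarith+
  have "\<kappa> * s < \<rho> * X"
  proof (cases "\<rho> < 0")
    case False
    have "\<kappa> * s < 0" using \<kappa> s by (simp add: mult_less_0_iff)
    thus ?thesis using False X by (smt (verit) mult_nonneg_nonneg)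
  next
    case True
    have "2 * C * B * K / (\<kappa> * c0) < k" using k by linarith
    hence "2 * C * B * K < \<kappa> * c0 * k" using \<kappa> c0 by (simp add: field_simps)
    hence "2 * C * B * K * k < \<kappa> * c0 * k * k" using k by (intro mult_strict_right_mono) auto
    hence "- (\<kappa> * (c0 * k\<^sup>2)) < - C / k * (2 * (B * k\<^sup>2 * K))"
      using k by (simp add: power2_eq_square mult_ac)
    moreover have "\<kappa> * s \<le> \<kappa> * (- c0 * k\<^sup>2)" using \<rho>(2)[OF True] \<kappa> by (intro mult_left_mono) auto
    moreover have "- C / k * (2 * (B * k\<^sup>2 * K)) \<le> - C / k * X"
      using X C k by (intro mult_left_mono_neg) auto
    moreover have "- C / k * X \<le> \<rho> * X" using \<rho>(1) X by (intro mult_right_mono) auto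
    ultimately show ?thesis by simp
  qed
  thus "\<kappa> * s < \<rho> * (B * k\<^sup>2 * \<zeta> + W + v * \<zeta>)" by (simp add: X_def)
qed

section \<open>Quadratic growth at a boundary contact point\<close>

context degenerate_heat_flow
begin

text \<open>Bounded second derivatives integrate the vanishing gradient and value at
  \<open>x0\<close> twice. Both estimates take place in the ball of radius \<open>s\<close> around
  the point at distance \<open>s\<close> from \<open>x0\<close>, which lies in \<Omega> and has
  \<open>x0\<close> on its boundary; \<open>x0\<close> is reached by a limit along \<nu>.\<close>

lemma e_quadratic_bound:
  assumes x0: "x0 \<in> frontier \<Omega>" and b: "ball y0 (dist y0 x0) \<subseteq> \<Omega>" and t: "t \<in> {0<..<T}"
    and \<nu>: "y0 = x0 + dist y0 x0 *\<^sub>R \<nu>" "norm \<nu> = 1" and s: "0 < s" "s < dist y0 x0"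
  shows "e (x0 + s *\<^sub>R \<nu>) t \<le> 2 * (real CARD('n))\<^sup>2 * C * s\<^sup>2"
proof -
  define n where "n = real CARD('n)"
  define d where "d = dist y0 x0"
  define p where "p = (\<lambda>s. x0 + s *\<^sub>R \<nu>)"
  have p0: "p 0 = x0" by (simp add: p_def)
  have dp: "dist (p a) (p b) = \<bar>a - b\<bar>" for a b
  proof -
    have "p a - p b = (a - b) *\<^sub>R \<nu>" by (simp add: p_def algebra_simps)
    thus ?thesis using \<nu>(2) by (simp add: dist_norm)
  qed
  have "y0 = p d" using \<nu>(1) by (simp add: p_def d_def)
  hence dy: "dist y0 (p a) = \<bar>d - a\<bar>" for a using dp[of d a] by simp
  have inO: "p s' \<in> \<Omega>" if "0 < s'" "s' \<le> s" for s'
    using b that s dy[of s'] by (auto simp: d_def)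
  have bs: "ball (p s) s \<subseteq> \<Omega>"
  proof
    fix z assume z: "z \<in> ball (p s) s"
    have "dist y0 z \<le> dist y0 (p s) + dist (p s) z" by (rule dist_triangle)
    also have "\<dots> < (d - s) + s" using z dy[of s] s by (auto simp: d_def)
    finally show "z \<in> \<Omega>" using b by (auto simp: d_def)
  qed
  have near: "norm (p s' - p s) < s" "norm (p s' - p s) \<le> s" if "0 < s'" "s' < s" for s'
    using dp[of s' s] that by (auto simp: dist_norm)
  have tT: "t \<in> {0..T}" using t by auto
  have ev: "eventually (\<lambda>s'. 0 < s' \<and> s' < s) (at_right 0)"
    using eventually_at_right_real[OF s(1)] by simp
  have nC: "0 \<le> n * C" using C by (simp add: n_def)
  have fl: "filterlim p (at x0 within \<Omega>) (at_right 0)"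
    unfolding filterlim_at
  proof
    have "isCont p 0" unfolding p_def by (intro continuous_intros)
    thus "(p \<longlongrightarrow> x0) (at_right 0)"
      using p0 by (simp add: isCont_def filterlim_at_split)
    show "\<forall>\<^sub>F s' in at_right 0. p s' \<in> \<Omega> \<and> p s' \<noteq> x0"
      using ev
    proof (rule eventually_mono)
      fix s' assume "0 < s' \<and> s' < s"
      thus "p s' \<in> \<Omega> \<and> p s' \<noteq> x0" using inO[of s'] dp[of s' 0] p0 by auto
    qed
  qed
  have lip1: "\<bar>e1 i z t - e1 i (p s) t\<bar> \<le> n * C * s" if "norm (z - p s) < s" for i z
  proof -
    have "\<bar>e1 i z t - e1 i (p s) t\<bar> \<le> n * C * norm (z - p s)"
      unfolding n_def using D_exx[OF _ t] e2_bound[OF _ tT] bs that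
      by (intro partial_bound_imp_lipschitz[of "p s" s "\<lambda>z. e1 i z t" "\<lambda>j z. e2 i j z t"]) blast+
    also have "\<dots> \<le> n * C * s" using that nC by (intro mult_left_mono) auto
    finally show ?thesis .
  qed
  have e1s: "\<bar>e1 i (p s) t\<bar> \<le> n * C * s" for i
  proof -
    have "((\<lambda>s'. e1 i (p s') t) \<longlongrightarrow> 0) (at_right 0)"
      \<comment> \<open>The gradient condition is a limit from inside \<Omega>, here specialised to
        the inner segment.\<close>
      by (rule filterlim_compose[OF e1_frontier[OF x0 t] fl])
    hence "((\<lambda>s'. \<bar>e1 i (p s') t - e1 i (p s) t\<bar>) \<longlongrightarrow> \<bar>0 - e1 i (p s) t\<bar>) (at_right 0)"
      by (intro tendsto_intros)
    moreover have "\<forall>\<^sub>F s' in at_right 0. \<bar>e1 i (p s') t - e1 i (p s) t\<bar> \<le> n * C * s"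
      using ev by (rule eventually_mono) (use near lip1 in blast)
    ultimately have "\<bar>0 - e1 i (p s) t\<bar> \<le> n * C * s"
      by (rule tendsto_upperbound) simp
    thus ?thesis by simp
  qed
  have e1z: "\<bar>e1 i z t\<bar> \<le> 2 * (n * C * s)" if "z \<in> ball (p s) s" for i z
    using lip1[of z i] e1s[of i] that by (auto simp: dist_norm norm_minus_commute)
  have lip0: "\<bar>e (p s') t - e (p s) t\<bar> \<le> 2 * n\<^sup>2 * C * s\<^sup>2" if "0 < s'" "s' < s" for s'
  proof -
    have "\<bar>e (p s') t - e (p s) t\<bar> \<le> n * (2 * (n * C * s)) * norm (p s' - p s)"
      unfolding n_def using D_ex[OF _ t] e1z bs near[OF that] 
      by (intro partial_bound_imp_lipschitz[of "p s" s "\<lambda>z. e z t" "\<lambda>j z. e1 j z t"]) (auto simp: n_def)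
    also have "\<dots> \<le> n * (2 * (n * C * s)) * s" using near[OF that] nC s C
      by (intro mult_left_mono) (auto simp: n_def)
    finally show ?thesis by (simp add: power2_eq_square mult_ac)
  qed
  have "((\<lambda>s'. e (p s') t) \<longlongrightarrow> e x0 t) (at_right 0)"
  proof -
    have "continuous_on (closure \<Omega>) (\<lambda>x. case (x, t) of (x, t) \<Rightarrow> e x t)"
      using tT by (intro continuous_on_compose2[OF cont_e] continuous_intros) auto
    hence "((\<lambda>x. e x t) \<longlongrightarrow> e x0 t) (at x0 within closure \<Omega>)"
      using x0 by (auto simp: continuous_on_def frontier_def)
    hence "((\<lambda>x. e x t) \<longlongrightarrow> e x0 t) (at x0 within \<Omega>)"
      by (rule tendsto_within_subset) (rule closure_subset)
    thus ?thesis by (rule filterlim_compose[OF _ fl])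
  qed
  hence "((\<lambda>s'. \<bar>e (p s') t - e (p s) t\<bar>) \<longlongrightarrow> \<bar>e x0 t - e (p s) t\<bar>) (at_right 0)"
    by (intro tendsto_intros)
  moreover have "\<forall>\<^sub>F s' in at_right 0. \<bar>e (p s') t - e (p s) t\<bar> \<le> 2 * n\<^sup>2 * C * s\<^sup>2"
    using ev by (rule eventually_mono) (use lip0 in blast)
  ultimately have "\<bar>e x0 t - e (p s) t\<bar> \<le> 2 * n\<^sup>2 * C * s\<^sup>2" by (rule tendsto_upperbound) simp
  thus ?thesis using e_frontier[OF x0 tT] by (simp add: p_def n_def)
qed

end

text \<open>The contact point is a nearest frontier point; a ball leaving \<Omega> would, by
  connectedness, contain a closer one.\<close>

lemma touching_ball:
  fixes \<Omega> :: "(real^'n) set"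
  assumes "open \<Omega>" "bounded \<Omega>" "y0 \<in> \<Omega>"
  obtains x0 where "x0 \<in> frontier \<Omega>" "0 < dist y0 x0" "ball y0 (dist y0 x0) \<subseteq> \<Omega>"
    "\<And>x. x \<in> frontier \<Omega> \<Longrightarrow> dist y0 x0 \<le> dist y0 x"
proof -
  have "\<Omega> \<noteq> UNIV" using assms(2) not_bounded_UNIV by auto
  hence ne: "frontier \<Omega> \<noteq> {}" using assms(3) frontier_eq_empty by auto
  obtain x0 where x0: "x0 \<in> frontier \<Omega>" "\<And>x. x \<in> frontier \<Omega> \<Longrightarrow> dist y0 x0 \<le> dist y0 x"
    using distance_attains_inf[OF frontier_closed ne] by blast
  have "y0 \<notin> frontier \<Omega>" using assms by (simp add: frontier_def interior_open)
  hence d: "0 < dist y0 x0" using x0(1) by auto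
  have "ball y0 (dist y0 x0) \<subseteq> \<Omega>"
  proof (rule ccontr)
    assume "\<not> ?thesis"
    hence "ball y0 (dist y0 x0) - \<Omega> \<noteq> {}" by blast
    moreover have "y0 \<in> ball y0 (dist y0 x0)" using d by simp
    hence "ball y0 (dist y0 x0) \<inter> \<Omega> \<noteq> {}" using assms(3) by blast
    ultimately have "ball y0 (dist y0 x0) \<inter> frontier \<Omega> \<noteq> {}"
      using connected_Int_frontier[OF convex_connected[OF convex_ball]] by blast
    thus False using x0(2) by force
  qed
  thus ?thesis using that x0 d by blast
qed

section \<open>Comparison with the Hopf barrier at half time\<close>

context degenerate_heat_flow
begin

text \<open>Combines the moving Hopf barrier with the boundary layer on the time interval of length
  \<open>1 / k\<close>. The constants \<open>a\<close>, \<open>A\<close>, \<open>K\<close> are fixed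
  before \<open>B\<close>, and only the threshold for \<open>k\<close> depends on \<open>B\<close>;
  the error term can therefore be made to decay faster than any prescribed power of the
  barrier.\<close>

lemma barrier_comparison:
  assumes sb: "smooth_boundary \<Omega>" and T: "0 < T"
    and bd0: "\<And>x. x \<in> frontier \<Omega> \<Longrightarrow> d0 \<le> dist y0 x" and ball: "ball y0 d0 \<subseteq> \<Omega>"
    and r0: "0 < r0" "r0 < d0" and \<epsilon>: "0 < \<epsilon>"
    and core_e: "\<And>x. x \<in> cball y0 r0 \<Longrightarrow> \<epsilon> \<le> e x 0"
    and \<rho>m: "0 < \<rho>m" and core_\<rho>: "\<And>x. x \<in> cball y0 r0 \<Longrightarrow> 2 * \<rho>m \<le> \<rho> x 0"
    and ne: "frontier \<Omega> \<noteq> {}"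
  obtains a A K where "1 \<le> a" "0 < A" "1 \<le> K"
    "\<And>B. real CARD('n) * C * K + C * C * K \<le> B \<Longrightarrow>
       \<exists>k0. \<forall>k\<ge>k0. \<forall>x\<in>closure \<Omega>. \<epsilon> * exp (- (A * k / 2)) *
          (exp (- (a * k * (norm (x - y0))\<^sup>2)) - exp (- (a * k * d0\<^sup>2)))
          - (C + \<epsilon>) * (exp (- (B * k / 2)) * K) \<le> e x (1 / (2 * k))"
proof -
  define n where "n = real CARD('n)"
  have n: "1 \<le> n" by (simp add: n_def Suc_leI)
  have d0: "0 < d0" using r0 by simp
  \<comment> \<open>With \<tau> = 1 / k, the strip where the density may be negative has width
    \<open>2 * speed / k\<close>; this is the layer parameter.\<close>
  have L: "0 \<le> 2 * speed" using speed_ge by simp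
  obtain K c0 k0 where K: "1 \<le> K" and c0: "0 < c0" and layer:
    "\<And>k. k0 \<le> k \<Longrightarrow> \<exists>\<zeta>. continuous_on UNIV \<zeta> \<and> (\<forall>x\<in>closure \<Omega>. 1 \<le> \<zeta> x \<and> \<zeta> x \<le> K) \<and>
       (\<forall>x\<in>\<Omega>. \<exists>\<delta> z z1 z2. \<delta> > 0 \<and> axis_C2 (ball x \<delta>) z z1 z2 \<and>
          (\<forall>y\<in>ball x \<delta>. \<zeta> y \<le> z y) \<and> z x = \<zeta> x \<and> (\<forall>i. \<bar>z1 i x\<bar> \<le> K * k) \<and>
          (\<Sum>i\<in>UNIV. z2 i x) < 0 \<and>
          ((\<exists>y\<in>frontier \<Omega>. dist x y \<le> 2 * speed / k) \<longrightarrow> (\<Sum>i\<in>UNIV. z2 i x) \<le> - c0 * k\<^sup>2))"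
    by (rule boundary_layer[OF op bd sb ne L]) blast
  obtain a A k1 where a: "1 \<le> a" "2 \<le> a * r0\<^sup>2" and A: "0 < A" and barrier:
    "\<And>k \<rho> S' W v q E E'. k1 \<le> k \<Longrightarrow> 1 \<le> k \<Longrightarrow> 0 < E' \<Longrightarrow> E' < E \<Longrightarrow> \<bar>\<rho>\<bar> \<le> C \<Longrightarrow> - C / k \<le> \<rho> \<Longrightarrow>
       \<bar>S'\<bar> \<le> 4 * d0\<^sup>2 * k \<Longrightarrow> \<bar>W\<bar> \<le> n * C * (E * (a * k * (2 * d0))) \<Longrightarrow> \<bar>v\<bar> \<le> C * C \<Longrightarrow> 0 \<le> q \<Longrightarrow>
       (q < r0\<^sup>2 / 4 \<Longrightarrow> \<rho>m \<le> \<rho> \<and> E' \<le> E / 2) \<Longrightarrow>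
       \<rho> * ((- (A * k\<^sup>2 * (E - E')) + a * k * S' * E') + W + v * (E - E'))
         \<le> \<kappa> * (E * (4 * (a * k)\<^sup>2 * q - 2 * n * (a * k)))"
    by (rule barrier_coefficients[OF n C \<kappa> r0(1) d0 \<rho>m]) blast
  show ?thesis
  proof (rule that[OF a(1) A K])
    fix B assume B: "real CARD('n) * C * K + C * C * K \<le> B"
    obtain k2 where layer_coeff:
      "\<And>k \<rho> \<zeta> W v s. k2 \<le> k \<Longrightarrow> 1 \<le> k \<Longrightarrow> 1 \<le> \<zeta> \<Longrightarrow> \<zeta> \<le> K \<Longrightarrow> \<bar>W\<bar> \<le> n * C * (K * k) \<Longrightarrow> \<bar>v\<bar> \<le> C * C \<Longrightarrow> s < 0 \<Longrightarrow>
         - C / k \<le> \<rho> \<Longrightarrow> (\<rho> < 0 \<Longrightarrow> s \<le> - c0 * k\<^sup>2) \<Longrightarrow>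
         \<kappa> * s < \<rho> * (B * k\<^sup>2 * \<zeta> + W + v * \<zeta>)"
      by (rule layer_coefficients[OF n C \<kappa> c0 K B[folded n_def]]) blast
    \<comment> \<open>\<open>1 / T + 1\<close> gives \<tau> < T, and \<open>C / \<rho>m\<close>
      limits the density loss up to time \<tau> to \<open>\<rho>m\<close>, leaving at least
      \<open>\<rho>m\<close> in the core.\<close>
    define kk where "kk = Max {1, 1 / T + 1, k0, k1, k2, C / \<rho>m}"
    show "\<exists>k0. \<forall>k\<ge>k0. \<forall>x\<in>closure \<Omega>. \<epsilon> * exp (- (A * k / 2)) *
          (exp (- (a * k * (norm (x - y0))\<^sup>2)) - exp (- (a * k * d0\<^sup>2)))
          - (C + \<epsilon>) * (exp (- (B * k / 2)) * K) \<le> e x (1 / (2 * k))"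
    proof (intro exI[of _ kk] allI impI ballI)
      fix k x assume "kk \<le> k" and x: "x \<in> closure \<Omega>"
      hence k: "1 \<le> k" "1 / T + 1 \<le> k" "k0 \<le> k" "k1 \<le> k" "k2 \<le> k" "C / \<rho>m \<le> k"
        by (auto simp: kk_def)
      define \<tau> where "\<tau> = 1 / k"
      have "1 / T < k" using k by linarith
      hence "1 < k * T" using T by (simp add: divide_less_eq)
      hence \<tau>: "0 < \<tau>" "\<tau> < T" using k T by (simp_all add: \<tau>_def divide_less_eq mult.commute)
      have C\<rho>: "C / k \<le> \<rho>m" using k \<rho>m by (simp add: field_simps)
      obtain \<zeta> where cont_\<zeta>: "continuous_on UNIV \<zeta>" and \<zeta>: "\<And>x. x \<in> closure \<Omega> \<Longrightarrow> 1 \<le> \<zeta> x \<and> \<zeta> x \<le> K"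
        and test: "\<And>x. x \<in> \<Omega> \<Longrightarrow> \<exists>\<delta> z z1 z2. \<delta> > 0 \<and> axis_C2 (ball x \<delta>) z z1 z2 \<and>
          (\<forall>y\<in>ball x \<delta>. \<zeta> y \<le> z y) \<and> z x = \<zeta> x \<and> (\<forall>i. \<bar>z1 i x\<bar> \<le> K * k) \<and>
          (\<Sum>i\<in>UNIV. z2 i x) < 0 \<and>
          ((\<exists>y\<in>frontier \<Omega>. dist x y \<le> 2 * speed / k) \<longrightarrow> (\<Sum>i\<in>UNIV. z2 i x) \<le> - c0 * k\<^sup>2)"
        using layer[OF k(3)] by (elim exE conjE) blast
      \<comment> \<open>The squared radius of the support: \<open>r0\<^sup>2\<close> at time 0,
        \<open>d0\<^sup>2\<close> at \<tau> / 2 and \<open>r0\<^sup>2\<close> again at \<tau>, so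
        the positivity ball never passes the contact point.\<close>
      define S where "S = (\<lambda>t. d0\<^sup>2 - (d0\<^sup>2 - r0\<^sup>2) * (2 * k * t - 1)\<^sup>2)"
      define S' where "S' = (\<lambda>t. - ((d0\<^sup>2 - r0\<^sup>2) * (2 * (2 * k * t - 1) * (2 * k))))"
      define c where "c = (\<lambda>t. \<epsilon> * exp (- (A * k\<^sup>2 * t)))"
      define E where "E = (\<lambda>x. exp (- (a * k) * (norm (x - y0))\<^sup>2))"
      define E' where "E' = (\<lambda>t. exp (- (a * k * S t)))"
      define G where "G = (\<lambda>x t. c t * (E x - E' t))"
      \<comment> \<open>The unsimplified zeros match what the closure rules of
        \<open>axis_C2\<close> produce; likewise in \<open>G2\<close>.\<close>
      define G1 where "G1 = (\<lambda>i x t. c t * (E x * (- (a * k) * (2 * (x - y0) $ i)) - 0))"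
      define G2 where "G2 = (\<lambda>i x t. c t * (E x * ((- (a * k) * (2 * (x - y0) $ i))\<^sup>2 + - (a * k) * 2) - 0))"
      define Gt where "Gt = (\<lambda>x t. c t * (- (A * k\<^sup>2 * (E x - E' t)) + a * k * S' t * E' t))"
      have r0d0: "r0\<^sup>2 \<le> d0\<^sup>2" using r0 by (intro power_mono) auto
      have S_bounds: "r0\<^sup>2 \<le> S t" "S t \<le> d0\<^sup>2" "\<bar>S' t\<bar> \<le> 4 * d0\<^sup>2 * k" if t: "t \<in> {0..\<tau>}" for t
      proof -
        have "k * t \<le> 1" "0 \<le> k * t" using t k by (auto simp: \<tau>_def field_simps)
        hence b: "\<bar>2 * k * t - 1\<bar> \<le> 1" by linarith
        hence "(2 * k * t - 1)\<^sup>2 \<le> 1" by (simp add: abs_square_le_1)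
        hence "(d0\<^sup>2 - r0\<^sup>2) * (2 * k * t - 1)\<^sup>2 \<le> (d0\<^sup>2 - r0\<^sup>2) * 1"
          using r0d0 by (intro mult_left_mono) auto
        thus "r0\<^sup>2 \<le> S t" by (simp add: S_def)
        show "S t \<le> d0\<^sup>2" using r0d0 by (simp add: S_def)
        have "\<bar>S' t\<bar> = (d0\<^sup>2 - r0\<^sup>2) * (\<bar>2 * k * t - 1\<bar> * (4 * k))"
        proof -
          have "\<bar>- ((d0\<^sup>2 - r0\<^sup>2) * (2 * w * (2 * k)))\<bar> = (d0\<^sup>2 - r0\<^sup>2) * (\<bar>w\<bar> * (4 * k))" for w
            using r0d0 k by (simp add: abs_mult)
          thus ?thesis by (simp only: S'_def)
        qed
        also have "\<dots> \<le> d0\<^sup>2 * (1 * (4 * k))"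
          using r0d0 b k by (intro mult_mono) auto
        finally show "\<bar>S' t\<bar> \<le> 4 * d0\<^sup>2 * k" by simp
      qed
      have ak: "0 < a * k" using a k by simp
      have c_pos: "0 < c t" for t using \<epsilon> by (simp add: c_def)
      have c_le: "c t \<le> \<epsilon>" if "t \<in> {0..\<tau>}" for t
        using that A k \<epsilon> by (simp add: c_def)
      have E_le: "E x \<le> 1" for x using ak by (simp add: E_def)
      have E'_pos: "0 < E' t" for t by (simp add: E'_def)
      have G_le: "G x t \<le> \<epsilon>" if "t \<in> {0..\<tau>}" for x t
      proof -
        have "c t * (E x - E' t) \<le> c t * 1"
          using c_pos[of t] E_le[of x] E'_pos[of t] by (intro mult_left_mono) auto
        thus ?thesis using c_le[OF that] by (simp add: G_def)
      qed
      have G_out: "G x t \<le> 0" if "S t \<le> (norm (x - y0))\<^sup>2" for x t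
      proof -
        have "a * k * S t \<le> a * k * (norm (x - y0))\<^sup>2" using that ak by (intro mult_left_mono) auto
        hence "E x \<le> E' t" by (simp add: E_def E'_def)
        thus ?thesis using c_pos[of t] by (simp add: G_def mult_le_0_iff)
      qed
      \<comment> \<open>M = C + \<epsilon> fits the final condition because the barrier never
        exceeds \<epsilon>. The rate B k^2 is B / \<tau>^2.\<close>
      have compare: "G x (\<tau> / 2) - (C + \<epsilon>) * (exp (B * k\<^sup>2 * (\<tau> / 2 - \<tau>)) * \<zeta> x) \<le> e x (\<tau> / 2)"
      proof (rule comparison[of \<tau> G "C + \<epsilon>" G1 G2 Gt \<zeta> "B * k\<^sup>2" x "\<tau> / 2", OF \<tau>])
        show "continuous_on UNIV (\<lambda>(x, t). G x t)"
          unfolding G_def c_def E_def E'_def S_def case_prod_beta by (intro continuous_intros)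
        show "G x 0 \<le> e x 0" if "x \<in> \<Omega>" for x
        proof (cases "x \<in> cball y0 r0")
          case True
          thus ?thesis using core_e G_le[of 0 x] \<tau> by force
        next
          case False
          hence "r0 \<le> norm (x - y0)" by (simp add: dist_norm norm_minus_commute)
          hence "S 0 \<le> (norm (x - y0))\<^sup>2" using r0 by (simp add: S_def power_mono)
          thus ?thesis using G_out e_init[OF that] by force
        qed
        show "G x t \<le> 0" if "x \<in> frontier \<Omega>" "t \<in> {0..\<tau>}" for x t
        proof -
          have "d0 \<le> norm (x - y0)" using bd0[OF that(1)] by (simp add: dist_norm norm_minus_commute)
          hence "d0\<^sup>2 \<le> (norm (x - y0))\<^sup>2" using d0 by (intro power_mono) auto
          thus ?thesis using G_out S_bounds(2)[OF that(2)] by force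
        qed
        show "G x \<tau> \<le> C + \<epsilon> - C" if "x \<in> closure \<Omega>" for x using G_le[of \<tau> x] \<tau> by simp
        show "C \<le> C + \<epsilon>" using \<epsilon> by simp
        show "axis_C2 UNIV (\<lambda>x. G x t) (\<lambda>i x. G1 i x t) (\<lambda>i x. G2 i x t)" for t
          unfolding G_def G1_def G2_def E_def
          by (intro axis_C2_cmult axis_C2_diff axis_C2_const axis_C2_exp axis_C2_dist2)
        show "(G x has_real_derivative Gt x t) (at t)" for x t
        proof -
          have 1: "(c has_real_derivative - (A * k\<^sup>2) * c t) (at t)"
            unfolding c_def by (auto intro!: derivative_eq_intros)
          have "(S has_real_derivative S' t) (at t)"
            unfolding S_def S'_def by (auto intro!: derivative_eq_intros simp: algebra_simps)
          hence 2: "(E' has_real_derivative E' t * (- (a * k * S' t))) (at t)"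
            unfolding E'_def by (auto intro!: derivative_eq_intros)
          have "((\<lambda>t. c t * (E x - E' t)) has_real_derivative
              - (A * k\<^sup>2) * c t * (E x - E' t) + (0 - E' t * (- (a * k * S' t))) * c t) (at t)"
            by (intro DERIV_mult 1 DERIV_diff DERIV_const 2)
          moreover have "- (A * k\<^sup>2) * c t * (E x - E' t) + (0 - E' t * (- (a * k * S' t))) * c t = Gt x t"
            by (simp add: Gt_def algebra_simps)
          moreover have "(\<lambda>t. c t * (E x - E' t)) = G x" by (simp add: G_def fun_eq_iff)
          ultimately show ?thesis by metis
        qed
        show "\<rho> x t * (Gt x t + (\<Sum>i\<in>UNIV. u x t $ i * G1 i x t) + g * dv x t * G x t)
             \<le> \<kappa> * (\<Sum>i\<in>UNIV. G2 i x t)"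
          if x: "x \<in> \<Omega>" and t: "t \<in> {0<..<\<tau>}" and pos: "0 < G x t" for x t
        proof -
          have tt: "t \<in> {0..\<tau>}" "t \<in> {0..T}" using t \<tau> by auto
          define W where "W = (\<Sum>i\<in>UNIV. u x t $ i * (E x * (- (a * k) * (2 * (x - y0) $ i))))"
          define q where "q = (norm (x - y0))\<^sup>2"
          have EE: "E' t < E x" using pos c_pos[of t] by (simp add: G_def zero_less_mult_iff)
          have "a * k * q < a * k * S t" using EE by (simp add: E_def E'_def q_def)
          hence qS: "q < S t" by (simp only: mult_less_cancel_left_pos[OF ak])
          hence "q < d0\<^sup>2" using S_bounds(2)[OF tt(1)] by linarith
          hence nx: "norm (x - y0) < d0" using d0 unfolding q_def by (meson less_imp_le power_less_imp_less_base)
          have W: "\<bar>W\<bar> \<le> n * C * (E x * (a * k * (2 * d0)))"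
            unfolding W_def n_def
          proof (rule sum_u_bound[OF x tt(2)])
            fix i
            have "\<bar>(x - y0) $ i\<bar> \<le> d0" using component_le_norm_cart[of "x - y0" i] nx by linarith
            hence "E x * (a * k * (2 * \<bar>(x - y0) $ i\<bar>)) \<le> E x * (a * k * (2 * d0))"
              using ak by (intro mult_left_mono) (auto simp: E_def)
            moreover have "\<bar>E x * (- (a * k) * (2 * (x - y0) $ i))\<bar> = E x * (a * k * (2 * \<bar>(x - y0) $ i\<bar>))"
              using a k by (simp add: abs_mult E_def del: vector_minus_component)
            ultimately show "\<bar>E x * (- (a * k) * (2 * (x - y0) $ i))\<bar> \<le> E x * (a * k * (2 * d0))"
              by linarith
          qed
          have v: "\<bar>g * dv x t\<bar> \<le> C * C"
            unfolding abs_mult using g dv_bound[OF x tt(2)] C by (intro mult_mono) auto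
          have Ct: "C * t \<le> C / k"
              using mult_left_mono[of t "1 / k" C] t C by (simp add: \<tau>_def)
          have low: "\<rho> x 0 - C * t \<le> \<rho> x t" using \<rho>_lower_bound[OF x, of t] t \<tau> by simp
          have \<rho>1: "- C / k \<le> \<rho> x t" using low Ct \<rho>_init[OF x] by simp
          \<comment> \<open>The density loses at most C / k \<le> \<rho>m from its initial value of
            at least \<open>2 * \<rho>m\<close>. The exponents of \<open>E\<close> and
            \<open>E'\<close> differ by at least a k r0^2 / 2 - a k r0^2 / 4 on crude counting of S
            - q \<ge> r0^2 / 2, hence by at least 1, and exp 1 \<ge> 2.\<close>
          have core: "\<rho>m \<le> \<rho> x t \<and> E' t \<le> E x / 2" if q4: "q < r0\<^sup>2 / 4"
          proof
            have r02: "0 < r0\<^sup>2" using r0 by simp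
            have "q < r0\<^sup>2" using q4 r02 by linarith
            hence "norm (x - y0) < r0" using r0 unfolding q_def by (meson less_imp_le power_less_imp_less_base)
            hence "2 * \<rho>m \<le> \<rho> x 0" by (intro core_\<rho>) (simp add: dist_norm norm_minus_commute)
            thus "\<rho>m \<le> \<rho> x t" using low Ct C\<rho> by linarith
            have "r0\<^sup>2 / 2 \<le> S t - q" using q4 S_bounds(1)[OF tt(1)] r02 by linarith
            hence "a * k * (r0\<^sup>2 / 2) \<le> a * k * (S t - q)" using ak by (intro mult_left_mono) auto
            moreover have "1 * 1 \<le> (a * r0\<^sup>2 / 2) * k" using a k by (intro mult_mono) auto
            moreover have "(a * r0\<^sup>2 / 2) * k = a * k * (r0\<^sup>2 / 2)" by simp
            ultimately have "1 \<le> a * k * (S t - q)" by linarith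
            hence "2 \<le> exp (a * k * (S t - q))" using exp_ge_add_one_self[of "a * k * (S t - q)"] by linarith
            hence "E' t * 2 \<le> E' t * exp (a * k * (S t - q))" using E'_pos[of t] by (intro mult_left_mono) auto
            also have "\<dots> = E x" by (simp add: E'_def E_def q_def flip: exp_add) (simp add: algebra_simps)
            finally show "E' t \<le> E x / 2" by simp
          qed
          have "\<rho> x t * ((- (A * k\<^sup>2 * (E x - E' t)) + a * k * S' t * E' t) + W + g * dv x t * (E x - E' t))
              \<le> \<kappa> * (E x * (4 * (a * k)\<^sup>2 * q - 2 * n * (a * k)))"
            using k S_bounds(3)[OF tt(1)] \<rho>_bound[OF x tt(2)] \<rho>1 W v core EE E'_pos[of t]
            by (intro barrier) (auto simp: q_def)
          hence "c t * (\<rho> x t * ((- (A * k\<^sup>2 * (E x - E' t)) + a * k * S' t * E' t) + W + g * dv x t * (E x - E' t)))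
              \<le> c t * (\<kappa> * (E x * (4 * (a * k)\<^sup>2 * q - 2 * n * (a * k))))"
            using c_pos[of t] by (intro mult_left_mono) auto
          moreover have sG1: "(\<Sum>i\<in>UNIV. u x t $ i * G1 i x t) = c t * W"
            by (simp add: G1_def W_def sum_distrib_left mult_ac)
          moreover have sG2: "(\<Sum>i\<in>UNIV. G2 i x t) = c t * (E x * (4 * (a * k)\<^sup>2 * q - 2 * n * (a * k)))"
          proof -
            have q: "q = (\<Sum>i\<in>UNIV. ((x - y0) $ i)\<^sup>2)"
              unfolding q_def power2_norm_eq_inner by (simp add: inner_vec_def power2_eq_square)
            have "(\<Sum>i\<in>UNIV. G2 i x t)
              = (\<Sum>i\<in>(UNIV::'n set). c t * E x * (4 * (a * k)\<^sup>2) * ((x - y0) $ i)\<^sup>2 - c t * E x * (2 * (a * k)))"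
              by (intro sum.cong refl) (simp add: G2_def power_mult_distrib right_diff_distrib mult_ac del: vector_minus_component)
            also have "\<dots> = c t * E x * (4 * (a * k)\<^sup>2) * q - n * (c t * E x * (2 * (a * k)))"
              by (simp only: sum_subtractf q sum_distrib_left sum_constant n_def)
            finally show ?thesis by (simp add: algebra_simps)
          qed
          moreover have "c t * (\<rho> x t * ((- (A * k\<^sup>2 * (E x - E' t)) + a * k * S' t * E' t) + W + g * dv x t * (E x - E' t)))
             = \<rho> x t * (Gt x t + c t * W + g * dv x t * G x t)"
            by (simp add: Gt_def G_def algebra_simps)
          ultimately show ?thesis
            unfolding sG1 sG2 by (simp only: mult.left_commute[of \<kappa> "c t"])
        qed
        show "\<exists>\<delta> z z1 z2. \<delta> > 0 \<and> axis_C2 (ball x \<delta>) z z1 z2 \<and>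
          (\<forall>y\<in>ball x \<delta>. \<zeta> y \<le> z y) \<and> z x = \<zeta> x \<and>
          (\<forall>t\<in>{0<..<\<tau>}. \<kappa> * (\<Sum>i\<in>UNIV. z2 i x)
             < \<rho> x t * (B * k\<^sup>2 * \<zeta> x + (\<Sum>i\<in>UNIV. u x t $ i * z1 i x) + g * dv x t * \<zeta> x))"
          if x: "x \<in> \<Omega>" for x
        proof -
          obtain \<delta> z z1 z2 where z: "\<delta> > 0 \<and> axis_C2 (ball x \<delta>) z z1 z2 \<and>
            (\<forall>y\<in>ball x \<delta>. \<zeta> y \<le> z y) \<and> z x = \<zeta> x \<and> (\<forall>i. \<bar>z1 i x\<bar> \<le> K * k) \<and>
            (\<Sum>i\<in>UNIV. z2 i x) < 0 \<and>
            ((\<exists>y\<in>frontier \<Omega>. dist x y \<le> 2 * speed / k) \<longrightarrow> (\<Sum>i\<in>UNIV. z2 i x) \<le> - c0 * k\<^sup>2)"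
            using test[OF x] by (elim exE)
          have "\<kappa> * (\<Sum>i\<in>UNIV. z2 i x)
             < \<rho> x t * (B * k\<^sup>2 * \<zeta> x + (\<Sum>i\<in>UNIV. u x t $ i * z1 i x) + g * dv x t * \<zeta> x)"
            if t: "t \<in> {0<..<\<tau>}" for t
          proof (rule layer_coeff[OF k(5) k(1)])
            have tt: "t \<in> {0..\<tau>}" "t \<in> {0..T}" using t \<tau> by auto
            show "1 \<le> \<zeta> x" "\<zeta> x \<le> K" using \<zeta>[of x] x closure_subset by auto
            show "\<bar>\<Sum>i\<in>UNIV. u x t $ i * z1 i x\<bar> \<le> n * C * (K * k)"
              unfolding n_def using z by (intro sum_u_bound x tt) auto
            show "\<bar>g * dv x t\<bar> \<le> C * C"
              unfolding abs_mult using g dv_bound[OF x tt(2)] C by (intro mult_mono) auto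
            show "(\<Sum>i\<in>UNIV. z2 i x) < 0" using z by simp
            have "C * t \<le> C / k"
              using mult_left_mono[of t "1 / k" C] t C by (simp add: \<tau>_def)
            thus "- C / k \<le> \<rho> x t" using \<rho>_lower_bound[OF x, of t] \<rho>_init[OF x] t \<tau> by simp
            show "(\<Sum>i\<in>UNIV. z2 i x) \<le> - c0 * k\<^sup>2" if "\<rho> x t < 0"
              using \<rho>_neg_imp_near_frontier[OF \<tau> x tt(1) that] z by (simp add: \<tau>_def)
          qed
          thus ?thesis using z by (intro exI[of _ \<delta>] exI[of _ z] exI[of _ z1] exI[of _ z2]) auto
        qed
      qed (use cont_\<zeta> \<zeta> x \<tau> in auto)
      have "\<zeta> x \<le> K" using \<zeta>[OF x] by simp
      hence "(C + \<epsilon>) * (exp (- (B * k / 2)) * \<zeta> x) \<le> (C + \<epsilon>) * (exp (- (B * k / 2)) * K)"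
        using C \<epsilon> by (intro mult_left_mono) auto
      moreover have tb: "B * k\<^sup>2 * (\<tau> / 2 - \<tau>) = - (B * k / 2)"
        using k by (simp add: \<tau>_def power2_eq_square field_simps)
      moreover have Gh: "G x (\<tau> / 2) = \<epsilon> * exp (- (A * k / 2)) *
          (exp (- (a * k * (norm (x - y0))\<^sup>2)) - exp (- (a * k * d0\<^sup>2)))"
      proof -
        have "A * k\<^sup>2 * (\<tau> / 2) = A * k / 2" "S (\<tau> / 2) = d0\<^sup>2"
          using k by (simp_all add: \<tau>_def S_def power2_eq_square)
        thus ?thesis by (simp add: G_def c_def E_def E'_def)
      qed
      moreover have th: "\<tau> / 2 = 1 / (2 * k)" by (simp add: \<tau>_def)
      ultimately show "\<epsilon> * exp (- (A * k / 2)) *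
          (exp (- (a * k * (norm (x - y0))\<^sup>2)) - exp (- (a * k * d0\<^sup>2)))
          - (C + \<epsilon>) * (exp (- (B * k / 2)) * K) \<le> e x (1 / (2 * k))"
        unfolding th[symmetric] using compare[unfolded tb Gh] by linarith
    qed
  qed
qed

end

section \<open>The contradiction for short times\<close>

lemma open_superlevel_ball:
  fixes f :: "'a::metric_space \<Rightarrow> real"
  assumes "open U" "continuous_on U f" "x \<in> U" "a < f x"
  obtains r where "0 < r" "ball x r \<subseteq> U" "\<And>y. y \<in> ball x r \<Longrightarrow> a < f y"
proof -
  have "open (f -` {a<..} \<inter> U)"
    using continuous_on_open_vimage[OF assms(1), THEN iffD1, OF assms(2), rule_format, of "{a<..}"] by simp
  moreover have "x \<in> f -` {a<..} \<inter> U" using assms by auto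
  ultimately obtain r where r: "0 < r" "ball x r \<subseteq> f -` {a<..} \<inter> U" by (meson openE)
  show ?thesis
  proof (rule that[OF r(1)])
    show "ball x r \<subseteq> U" using r(2) by blast
    show "a < f y" if "y \<in> ball x r" for y using subsetD[OF r(2) that] by simp
  qed
qed

text \<open>Convexity: the exponential lies above its tangent. It supplies the Hopf slope of the
  barrier at the contact point.\<close>

lemma exp_diff_lower_bound:
  fixes p q :: real
  shows "exp (- q) * (q - p) \<le> exp (- p) - exp (- q)"
proof -
  have "exp (- q) * (1 + (q - p)) \<le> exp (- q) * exp (q - p)"
    by (intro mult_left_mono exp_ge_add_one_self) auto
  also have "\<dots> = exp (- p)" by (simp flip: exp_add)
  finally show ?thesis by (simp add: algebra_simps)
qed

context degenerate_heat_flow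
begin

text \<open>At distance \<open>s\<close> from the contact point and time \<open>1 / (2 * k)\<close>,
  the barrier gives e \<ge> \<sigma> s minus the layer error, whereas quadratic growth gives e \<le>
  C4 s^2. With the optimal \<open>s\<close> the error would have to exceed a multiple of \<sigma>^2,
  which fails for large \<open>k\<close>.\<close>

lemma no_solution:
  assumes sb: "smooth_boundary \<Omega>" and T: "0 < T" and y0: "y0 \<in> \<Omega>" and pos: "0 < e y0 0"
  shows False
proof -
  obtain x0 where x0: "x0 \<in> frontier \<Omega>" "0 < dist y0 x0" "ball y0 (dist y0 x0) \<subseteq> \<Omega>"
    "\<And>x. x \<in> frontier \<Omega> \<Longrightarrow> dist y0 x0 \<le> dist y0 x"
    using touching_ball[OF op bd y0] by blast
  define d0 where "d0 = dist y0 x0"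
  have d0: "0 < d0" using x0 by (simp add: d0_def)
  have cont0: "continuous_on \<Omega> (\<lambda>x. f x 0)"
    if "continuous_on (closure \<Omega> \<times> {0..T}) (\<lambda>(x, t). f x t)" for f :: "real^'n \<Rightarrow> real \<Rightarrow> real"
  proof -
    have "continuous_on \<Omega> (\<lambda>x. case (x, 0) of (x, t) \<Rightarrow> f x t)"
      using T closure_subset by (intro continuous_on_compose2[OF that] continuous_intros) auto
    thus ?thesis by simp
  qed
  define \<epsilon> \<rho>m where "\<epsilon> = e y0 0 / 2" and "\<rho>m = \<rho> y0 0 / 4"
  have \<epsilon>: "0 < \<epsilon>" and \<rho>m: "0 < \<rho>m" using pos \<rho>_init[OF y0] by (auto simp: \<epsilon>_def \<rho>m_def)
  have "\<epsilon> < e y0 0" "2 * \<rho>m < \<rho> y0 0" using \<epsilon> \<rho>m by (simp_all add: \<epsilon>_def \<rho>m_def)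
  note lt = this
  obtain r1 where r1: "0 < r1" "ball y0 r1 \<subseteq> \<Omega>" "\<forall>x\<in>ball y0 r1. \<epsilon> < e x 0"
    using open_superlevel_ball[OF op cont0[OF cont_e] y0 lt(1)] by metis
  obtain r2 where r2: "0 < r2" "ball y0 r2 \<subseteq> \<Omega>" "\<forall>x\<in>ball y0 r2. 2 * \<rho>m < \<rho> x 0"
    using open_superlevel_ball[OF op cont0[OF cont_\<rho>] y0 lt(2)] by metis
  define r0 where "r0 = min d0 (min r1 r2) / 2"
  have r0: "0 < r0" "r0 < d0" "r0 < r1" "r0 < r2" using d0 r1 r2 by (auto simp: r0_def min_def)
  have core_e: "\<epsilon> \<le> e x 0" and core_\<rho>: "2 * \<rho>m \<le> \<rho> x 0" if "x \<in> cball y0 r0" for x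
  proof -
    have "x \<in> ball y0 r1" "x \<in> ball y0 r2" using that r0 by auto
    thus "\<epsilon> \<le> e x 0" "2 * \<rho>m \<le> \<rho> x 0" using r1(3) r2(3) less_imp_le by blast+
  qed
  have ne: "frontier \<Omega> \<noteq> {}" using x0(1) by auto
  obtain a A K where a: "1 \<le> a" and A: "0 < A" and K: "1 \<le> K" and cmp:
    "\<And>B. real CARD('n) * C * K + C * C * K \<le> B \<Longrightarrow>
       \<exists>k0. \<forall>k\<ge>k0. \<forall>x\<in>closure \<Omega>. \<epsilon> * exp (- (A * k / 2)) *
          (exp (- (a * k * (norm (x - y0))\<^sup>2)) - exp (- (a * k * d0\<^sup>2)))
          - (C + \<epsilon>) * (exp (- (B * k / 2)) * K) \<le> e x (1 / (2 * k))"
    by (rule barrier_comparison[OF sb T x0(4)[folded d0_def] x0(3)[folded d0_def] r0(1,2) \<epsilon> core_e \<rho>m core_\<rho> ne]) blast+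
  define n where "n = real CARD('n)"
  \<comment> \<open>The exponential rate of the slope: A / 2 from the time damping and a d0^2 from
    the Gaussian at the contact sphere.\<close>
  define c3 where "c3 = A / 2 + a * d0\<^sup>2"
  \<comment> \<open>The first two terms meet the lower bound on \<open>B\<close>; the last makes the
    layer error smaller than \<sigma>^2 by a factor exp (- k), up to constants.\<close>
  define B where "B = n * C * K + C * C * K + 2 * (2 * c3 + 1)"
  have c3: "0 < c3" using A a d0 by (simp add: c3_def add_pos_pos)
  have nCK: "0 \<le> n * C * K + C * C * K" using C K by (simp add: n_def)
  obtain k0 where k0: "\<And>k x. k0 \<le> k \<Longrightarrow> x \<in> closure \<Omega> \<Longrightarrow> \<epsilon> * exp (- (A * k / 2)) *
          (exp (- (a * k * (norm (x - y0))\<^sup>2)) - exp (- (a * k * d0\<^sup>2)))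
          - (C + \<epsilon>) * (exp (- (B * k / 2)) * K) \<le> e x (1 / (2 * k))"
    using cmp[of B] c3 by (auto simp: B_def n_def)
  \<comment> \<open>The summand \<epsilon> a enlarges the growth constant so that \<sigma> \<le> C4
    d0, which keeps \<open>s\<close> below \<open>d0\<close>.\<close>
  define C4 where "C4 = 2 * n\<^sup>2 * C + \<epsilon> * a"
  define b where "b = \<epsilon> * a * d0"
  \<comment> \<open>The surviving inequality will read \<eta> \<le> exp (- k), which k \<ge> 1 /
    \<eta> refutes.\<close>
  define \<eta> where "\<eta> = b\<^sup>2 / (4 * C4 * ((C + \<epsilon>) * K))"
  have b: "0 < b" using \<epsilon> a d0 by (simp add: b_def)
  have \<epsilon>a: "0 < \<epsilon> * a" using \<epsilon> a by simp
  moreover have n2C: "0 \<le> 2 * n\<^sup>2 * C" using C by simp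
  ultimately have C4: "0 < C4" by (simp add: C4_def add_nonneg_pos)
  have CK: "0 < (C + \<epsilon>) * K" using C \<epsilon> K by simp
  have \<eta>: "0 < \<eta>" using b C4 CK by (simp add: \<eta>_def)
  define k where "k = Max {1, k0, 1 / T, 1 / \<eta>}"
  have k: "1 \<le> k" "k0 \<le> k" "1 / T \<le> k" "1 / \<eta> \<le> k" by (auto simp: k_def)
  define t where "t = 1 / (2 * k)"
  have "1 \<le> k * T" using k(3) T by (simp add: divide_le_eq)
  hence "1 < 2 * k * T" by linarith
  hence t: "t \<in> {0<..<T}" using k by (simp add: t_def divide_less_eq mult_ac)
  define \<sigma> where "\<sigma> = b * exp (- (c3 * k))"
  \<comment> \<open>Maximises \<sigma> s - C4 s^2, with maximal value \<sigma>^2 / (4 C4).\<close>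
  define s where "s = \<sigma> / (2 * C4)"
  have \<sigma>: "0 < \<sigma>" using b by (simp add: \<sigma>_def)
  have s0: "0 < s" using \<sigma> C4 by (simp add: s_def)
  have sd: "s < d0"
  proof -
    have "\<sigma> \<le> b * 1" unfolding \<sigma>_def using b c3 k by (intro mult_left_mono) auto
    also have "b * 1 \<le> C4 * d0" using n2C d0 by (simp add: b_def C4_def distrib_right)
    finally have "\<sigma> \<le> C4 * d0" .
    moreover have "0 < C4 * d0" using C4 d0 by simp
    ultimately have "\<sigma> < 2 * (C4 * d0)" by linarith
    hence "\<sigma> < d0 * (2 * C4)" by (simp only: mult_ac)
    moreover have "0 < 2 * C4" using C4 by simp
    ultimately show ?thesis unfolding s_def by (simp only: pos_divide_less_eq)
  qed
  define \<nu> where "\<nu> = (1 / d0) *\<^sub>R (y0 - x0)"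
  have y0e: "y0 - x0 = d0 *\<^sub>R \<nu>" using d0 by (simp add: \<nu>_def)
  have \<nu>: "y0 = x0 + dist y0 x0 *\<^sub>R \<nu>" "norm \<nu> = 1"
  proof -
    show "y0 = x0 + dist y0 x0 *\<^sub>R \<nu>" unfolding d0_def[symmetric] y0e[symmetric] by simp
    have "norm (y0 - x0) = d0" by (simp add: d0_def dist_norm)
    thus "norm \<nu> = 1" using d0 by (simp add: \<nu>_def)
  qed
  define x where "x = x0 + s *\<^sub>R \<nu>"
  have nx: "norm (x - y0) = d0 - s"
  proof -
    have "x - y0 = s *\<^sub>R \<nu> - (y0 - x0)" by (simp add: x_def)
    also have "\<dots> = (s - d0) *\<^sub>R \<nu>" unfolding y0e by (simp add: algebra_simps)
    finally show ?thesis using \<nu>(2) sd by simp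
  qed
  have "x \<in> \<Omega>" using x0(3) nx s0 by (auto simp: d0_def dist_norm norm_minus_commute)
  hence xc: "x \<in> closure \<Omega>" using closure_subset by blast
  have upper: "e x t \<le> C4 * s\<^sup>2"
  proof -
    have "e x t \<le> 2 * n\<^sup>2 * C * s\<^sup>2"
      using e_quadratic_bound[OF x0(1,3) t \<nu> s0] sd by (simp add: x_def d0_def n_def)
    also have "\<dots> \<le> C4 * s\<^sup>2" using \<epsilon>a by (intro mult_right_mono) (auto simp: C4_def)
    finally show ?thesis .
  qed
  have lower: "\<sigma> * s \<le> \<epsilon> * exp (- (A * k / 2)) *
          (exp (- (a * k * (norm (x - y0))\<^sup>2)) - exp (- (a * k * d0\<^sup>2)))"
  proof -
    let ?E = "exp (- (a * k * d0\<^sup>2))"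
    have "d0 * s \<le> d0\<^sup>2 - (d0 - s)\<^sup>2"
    proof -
      have "s * s \<le> d0 * s" using sd s0 by (intro mult_right_mono) auto
      thus ?thesis by (simp add: power2_eq_square algebra_simps)
    qed
    hence "1 * (d0 * s) \<le> k * (d0\<^sup>2 - (d0 - s)\<^sup>2)" using k d0 s0 by (intro mult_mono) auto
    hence "a * (1 * (d0 * s)) \<le> a * (k * (d0\<^sup>2 - (d0 - s)\<^sup>2))" using a by (intro mult_left_mono) auto
    hence "?E * (a * d0 * s) \<le> ?E * (a * k * d0\<^sup>2 - a * k * (d0 - s)\<^sup>2)"
      by (intro mult_left_mono) (auto simp: algebra_simps)
    also have "\<dots> \<le> exp (- (a * k * (d0 - s)\<^sup>2)) - ?E" by (rule exp_diff_lower_bound)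
    finally have "\<epsilon> * exp (- (A * k / 2)) * (?E * (a * d0 * s))
       \<le> \<epsilon> * exp (- (A * k / 2)) * (exp (- (a * k * (d0 - s)\<^sup>2)) - ?E)"
      using \<epsilon> by (intro mult_left_mono) auto
    moreover have "exp (- (c3 * k)) = exp (- (A * k / 2)) * ?E"
      by (simp add: c3_def algebra_simps flip: exp_add)
    hence "\<sigma> * s = \<epsilon> * exp (- (A * k / 2)) * (?E * (a * d0 * s))"
      by (simp add: \<sigma>_def b_def mult_ac)
    ultimately show ?thesis unfolding nx by linarith
  qed
  have "\<sigma> * s - (C + \<epsilon>) * (exp (- (B * k / 2)) * K) \<le> C4 * s\<^sup>2"
    using k0[OF k(2) xc] lower upper by (simp add: t_def)
  moreover have "\<sigma> * s = 2 * (\<sigma>\<^sup>2 / (4 * C4))" "C4 * s\<^sup>2 = \<sigma>\<^sup>2 / (4 * C4)"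
    using C4 by (simp_all add: s_def power2_eq_square)
  ultimately have "\<sigma>\<^sup>2 / (4 * C4) \<le> (C + \<epsilon>) * (exp (- (B * k / 2)) * K)" by linarith
  also have "\<dots> \<le> (C + \<epsilon>) * (exp (- (2 * c3 * k) - k) * K)"
  proof -
    have "(2 * (2 * c3 + 1)) * k \<le> B * k" using nCK k by (intro mult_right_mono) (auto simp: B_def)
    hence "- (B * k / 2) \<le> - (2 * c3 * k) - k" by (simp add: algebra_simps)
    thus ?thesis using C \<epsilon> K by (intro mult_left_mono mult_right_mono) auto
  qed
  also have "exp (- (2 * c3 * k) - k) = (exp (- (c3 * k)))\<^sup>2 * exp (- k)"
    by (simp add: power2_eq_square flip: exp_add)
  finally have "b\<^sup>2 * (exp (- (c3 * k)))\<^sup>2 / (4 * C4) \<le> (C + \<epsilon>) * ((exp (- (c3 * k)))\<^sup>2 * exp (- k) * K)"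
    by (simp add: \<sigma>_def power_mult_distrib)
  hence "(exp (- (c3 * k)))\<^sup>2 * (b\<^sup>2 / (4 * C4)) \<le> (exp (- (c3 * k)))\<^sup>2 * ((C + \<epsilon>) * K * exp (- k))"
    by (simp add: mult_ac)
  hence "b\<^sup>2 / (4 * C4) \<le> (C + \<epsilon>) * K * exp (- k)"
    by (rule mult_left_le_imp_le) simp
  moreover have "\<eta> * ((C + \<epsilon>) * K) = b\<^sup>2 / (4 * C4)"
  proof -
    have "\<eta> = b\<^sup>2 / (4 * C4) / ((C + \<epsilon>) * K)" unfolding \<eta>_def by (rule divide_divide_eq_left[symmetric])
    thus ?thesis using CK by (metis nonzero_eq_divide_eq less_irrefl)
  qed
  ultimately have "\<eta> * ((C + \<epsilon>) * K) \<le> exp (- k) * ((C + \<epsilon>) * K)" by (simp only: mult.commute)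
  hence "\<eta> \<le> exp (- k)" using CK by (rule mult_right_le_imp_le)
  hence "\<eta> * exp k \<le> exp (- k) * exp k" by (intro mult_right_mono) auto
  hence "\<eta> * exp k \<le> 1" by (simp flip: exp_add)
  moreover have "1 / \<eta> < exp k" using exp_ge_add_one_self[of k] k by linarith
  hence "1 < \<eta> * exp k" using \<eta> by (simp only: pos_divide_less_eq mult.commute)
  ultimately show False by simp
qed

end

section \<open>Classical solutions\<close>

text \<open>Keeping only the diagonal bounds the double sum below by four times the sum of squares
  of the diagonal entries. Cauchy-Schwarz then bounds the total below by (2 \<mu> + n lam) / n times
  the squared trace.\<close>

lemma dissipation_nonneg:
  fixes a :: "'n::finite \<Rightarrow> 'n \<Rightarrow> real"
  assumes "0 < \<mu>" and "0 \<le> 2 * \<mu> + real CARD('n) * lam"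
  shows "0 \<le> \<mu> / 2 * (\<Sum>i\<in>UNIV. \<Sum>j\<in>UNIV. (a i j + a j i)\<^sup>2) + lam * (\<Sum>i\<in>UNIV. a i i)\<^sup>2"
proof -
  define D S where "D = (\<Sum>i\<in>UNIV. a i i)\<^sup>2" and "S = (\<Sum>i\<in>UNIV. (a i i)\<^sup>2)"
  have "4 * S = (\<Sum>i\<in>UNIV. (a i i + a i i)\<^sup>2)"
    by (simp add: S_def sum_distrib_left power2_eq_square)
  also have "\<dots> \<le> (\<Sum>i\<in>UNIV. \<Sum>j\<in>UNIV. (a i j + a j i)\<^sup>2)"
    by (intro sum_mono member_le_sum[where f = "\<lambda>j. (a _ j + a j _)\<^sup>2"]) auto
  finally have "\<mu> / 2 * (4 * S) \<le> \<mu> / 2 * (\<Sum>i\<in>UNIV. \<Sum>j\<in>UNIV. (a i j + a j i)\<^sup>2)"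
    using assms by (intro mult_left_mono) auto
  moreover have "D \<le> S * real CARD('n)"
    unfolding D_def S_def by (rule sum_squared_le_sum_of_squares)
  hence "D / real CARD('n) \<le> S" by (simp add: divide_le_eq)
  hence "2 * \<mu> * (D / real CARD('n)) \<le> 2 * \<mu> * S" using assms by (intro mult_left_mono) auto
  moreover have "0 \<le> (2 * \<mu> + real CARD('n) * lam) * (D / real CARD('n))"
    using assms by (intro mult_nonneg_nonneg divide_nonneg_pos) (auto simp: D_def)
  moreover have "(2 * \<mu> + real CARD('n) * lam) * (D / real CARD('n))
      = 2 * \<mu> * (D / real CARD('n)) + lam * D"
    by (simp add: field_simps)
  moreover have "\<mu> / 2 * (4 * S) = 2 * \<mu> * S" by simp
  ultimately show ?thesis unfolding D_def[symmetric] by linarith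
qed

lemma cont_ext_bounded:
  fixes f :: "real^'n \<Rightarrow> real \<Rightarrow> 'b::real_normed_vector"
  assumes "cont_ext \<Omega> T f" "bounded \<Omega>"
  shows "\<exists>B\<ge>0. \<forall>x\<in>\<Omega>. \<forall>t\<in>{0..T}. norm (f x t) \<le> B"
proof -
  obtain h where h: "continuous_on (closure \<Omega> \<times> {0..T}) (\<lambda>(x, t). h x t)"
    "\<And>x t. x \<in> \<Omega> \<Longrightarrow> t \<in> {0..T} \<Longrightarrow> h x t = f x t"
    using assms(1) unfolding cont_ext_def by blast
  have "compact (closure \<Omega> \<times> {0..T})" using assms(2) by (intro compact_Times) auto
  hence "bounded ((\<lambda>(x, t). h x t) ` (closure \<Omega> \<times> {0..T}))"
    by (intro compact_imp_bounded compact_continuous_image h)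
  then obtain B where B: "0 < B" "\<And>z. z \<in> closure \<Omega> \<times> {0..T} \<Longrightarrow> norm (case z of (x, t) \<Rightarrow> h x t) \<le> B"
    unfolding bounded_pos by blast
  show ?thesis
  proof (intro exI[of _ B] conjI ballI)
    fix x t assume xt: "x \<in> \<Omega>" "t \<in> {0..T}"
    hence "(x, t) \<in> closure \<Omega> \<times> {0..T}" using closure_subset by blast
    thus "norm (f x t) \<le> B" using B(2)[of "(x, t)"] h(2)[OF xt] by simp
  qed (use B in simp)
qed

lemma continuous_bounded:
  fixes f :: "real^'n \<Rightarrow> real \<Rightarrow> 'b::real_normed_vector"
  assumes "continuous_on (closure \<Omega> \<times> {0..T}) (\<lambda>(x, t). f x t)" "bounded \<Omega>"
  shows "\<exists>B\<ge>0. \<forall>x\<in>closure \<Omega>. \<forall>t\<in>{0..T}. norm (f x t) \<le> B"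
proof -
  have "cont_ext (closure \<Omega>) T f" using assms(1) unfolding cont_ext_def by auto
  thus ?thesis using bounded_closure[OF assms(2)] by (rule cont_ext_bounded)
qed

lemma C21_has_dx:
  assumes "C21 \<Omega> T f" "x \<in> \<Omega>" "t \<in> {0..T}"
  shows "((\<lambda>s. f (x + s *\<^sub>R axis i 1) t) has_vector_derivative dx i f x t) (at 0)"
    "((\<lambda>s. dx i f (x + s *\<^sub>R axis j 1) t) has_vector_derivative dx j (dx i f) x t) (at 0)"
  using assms unfolding C21_def dx_def partial_at_def
  by (simp_all add: vector_derivative_works[symmetric])

lemma C21_has_dt:
  assumes "C21 \<Omega> T f" "x \<in> \<Omega>" "t \<in> {0<..<T}"
  shows "(f x has_vector_derivative dt T f x t) (at t)"
proof -
  have t: "t \<in> {0..T}" using assms(3) by auto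
  have "(f x has_vector_derivative dt T f x t) (at t within {0..T})"
    using assms(1,2) t unfolding C21_def dt_def vector_derivative_works[symmetric] by simp
  thus ?thesis using assms(3) by (simp add: at_within_Icc_at)
qed

lemma dx_eqI: "((\<lambda>s. f (x + s *\<^sub>R axis i 1) t) has_vector_derivative D) (at 0) \<Longrightarrow> dx i f x t = D"
  unfolding dx_def partial_at_def by (rule vector_derivative_at)

lemma dt_eqI:
  assumes "(f x has_vector_derivative D) (at t)" "t \<in> {0<..<T}"
  shows "dt T f x t = D"
  unfolding dt_def using assms by (simp add: at_within_Icc_at vector_derivative_at)

text \<open>Subtracting \<open>e\<close> times the continuity equation from the energy equation puts
  the latter in nonconservative form. Discarding the nonnegative dissipation gives the differential
  inequality of the locale, and compactness supplies its bounds.\<close>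

lemma no_smooth_solution:
  fixes \<Omega> :: "(real^'n) set" and \<rho> e :: "real^'n \<Rightarrow> real \<Rightarrow> real" and u :: "real^'n \<Rightarrow> real \<Rightarrow> real^'n"
  assumes op: "open \<Omega>" and bd: "bounded \<Omega>" and sb: "smooth_boundary \<Omega>" and T: "0 < T"
    and \<mu>: "0 < \<mu>" "0 \<le> 2 * \<mu> + real CARD('n) * lam" and \<kappa>: "0 < \<kappa>" and \<gamma>: "1 < \<gamma>" and R: "0 < R"
    and C21\<rho>: "C21 \<Omega> T \<rho>" and C21u: "C21 \<Omega> T u" and C21e: "C21 \<Omega> T e"
    and mass: "\<And>x t. x \<in> \<Omega> \<Longrightarrow> t \<in> {0<..T} \<Longrightarrow>
      dt T \<rho> x t + (\<Sum>i\<in>UNIV. dx i (\<lambda>y s. \<rho> y s * u y s $ i) x t) = 0"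
    and energy: "\<And>x t. x \<in> \<Omega> \<Longrightarrow> t \<in> {0<..T} \<Longrightarrow>
      dt T (\<lambda>y s. \<rho> y s * e y s) x t + (\<Sum>i\<in>UNIV. dx i (\<lambda>y s. \<rho> y s * e y s * u y s $ i) x t)
        + (\<gamma> - 1) * \<rho> x t * e x t * (\<Sum>i\<in>UNIV. dx i (\<lambda>z r. u z r $ i) x t)
      = \<mu> / 2 * (\<Sum>i\<in>UNIV. \<Sum>j\<in>UNIV.
             (dx j (\<lambda>y s. u y s $ i) x t + dx i (\<lambda>y s. u y s $ j) x t)\<^sup>2)
        + lam * (\<Sum>i\<in>UNIV. dx i (\<lambda>z r. u z r $ i) x t)\<^sup>2
        + \<kappa> * (\<gamma> - 1) / R * (\<Sum>i\<in>UNIV. dx i (dx i e) x t)"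
    and \<rho>_pos: "\<And>x. x \<in> \<Omega> \<Longrightarrow> 0 < \<rho> x 0" and e_nonneg: "\<And>x. x \<in> \<Omega> \<Longrightarrow> 0 \<le> e x 0"
    and y0: "y0 \<in> \<Omega>" "e y0 0 \<noteq> 0"
    and e_fr: "\<And>x t. x \<in> frontier \<Omega> \<Longrightarrow> t \<in> {0<..T} \<Longrightarrow> e x t = 0"
    and de_fr: "\<And>x t i. x \<in> frontier \<Omega> \<Longrightarrow> t \<in> {0<..T} \<Longrightarrow> ((\<lambda>y. dx i e y t) \<longlongrightarrow> 0) (at x within \<Omega>)"
  shows False
proof -
  define dv where "dv = (\<lambda>x t. \<Sum>i\<in>UNIV. dx i u x t $ i)"
  have cont: "continuous_on (closure \<Omega> \<times> {0..T}) (\<lambda>(x, t). \<rho> x t)"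
    "continuous_on (closure \<Omega> \<times> {0..T}) (\<lambda>(x, t). u x t)"
    "continuous_on (closure \<Omega> \<times> {0..T}) (\<lambda>(x, t). e x t)"
    using C21\<rho> C21u C21e by (simp_all add: C21_def)
  have ext: "cont_ext \<Omega> T (dt T \<rho>)" "\<And>i. cont_ext \<Omega> T (dx i u)" "\<And>i j. cont_ext \<Omega> T (dx j (dx i e))"
    using C21\<rho> C21u C21e by (simp_all add: C21_def)
  obtain B1 where B1: "0 \<le> B1" "\<forall>x\<in>closure \<Omega>. \<forall>t\<in>{0..T}. norm (\<rho> x t) \<le> B1"
    using continuous_bounded[OF cont(1) bd] by (elim exE conjE)
  obtain B2 where B2: "0 \<le> B2" "\<forall>x\<in>closure \<Omega>. \<forall>t\<in>{0..T}. norm (u x t) \<le> B2"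
    using continuous_bounded[OF cont(2) bd] by (elim exE conjE)
  obtain B3 where B3: "0 \<le> B3" "\<forall>x\<in>closure \<Omega>. \<forall>t\<in>{0..T}. norm (e x t) \<le> B3"
    using continuous_bounded[OF cont(3) bd] by (elim exE conjE)
  obtain B4 where B4: "0 \<le> B4" "\<forall>x\<in>\<Omega>. \<forall>t\<in>{0..T}. norm (dt T \<rho> x t) \<le> B4"
    using cont_ext_bounded[OF ext(1) bd] by (elim exE conjE)
  have "\<forall>i. \<exists>B\<ge>0. \<forall>x\<in>\<Omega>. \<forall>t\<in>{0..T}. norm (dx i u x t) \<le> B"
    using cont_ext_bounded[OF ext(2) bd] by (rule allI)
  then obtain B5 where B5: "\<And>i. 0 \<le> B5 i" "\<And>i x t. x \<in> \<Omega> \<Longrightarrow> t \<in> {0..T} \<Longrightarrow> norm (dx i u x t) \<le> B5 i"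
    by metis
  have "\<forall>i j. \<exists>B\<ge>0. \<forall>x\<in>\<Omega>. \<forall>t\<in>{0..T}. norm (dx j (dx i e) x t) \<le> B"
    by (intro allI cont_ext_bounded ext(3) bd)
  then obtain B6 where B6: "\<And>i j. 0 \<le> B6 i j"
    "\<And>i j x t. x \<in> \<Omega> \<Longrightarrow> t \<in> {0..T} \<Longrightarrow> norm (dx j (dx i e) x t) \<le> B6 i j"
    by metis
  \<comment> \<open>Sums over the finitely many indices provide uniform bounds, since all summands
    are nonnegative.\<close>
  define s5 s6 where "s5 = sum B5 UNIV" and "s6 = (\<Sum>i\<in>UNIV. \<Sum>j\<in>UNIV. B6 i j)"
  have s5: "0 \<le> s5" and s6: "0 \<le> s6" by (simp_all add: s5_def s6_def sum_nonneg B5 B6)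
  have B6_le: "B6 i j \<le> s6" for i j
  proof -
    have "B6 i j \<le> (\<Sum>j\<in>UNIV. B6 i j)" by (rule member_le_sum) (auto simp: B6)
    also have "\<dots> \<le> s6" unfolding s6_def
      by (rule member_le_sum[of i UNIV "\<lambda>i. \<Sum>j\<in>UNIV. B6 i j"]) (auto simp: B6 sum_nonneg)
    finally show ?thesis .
  qed
  define C where "C = 1 + (\<gamma> - 1) + B1 + B2 + B3 + B4 + s5 + s6"
  note C_simps = B1(1) B2(1) B3(1) B4(1) s5 s6 \<gamma>
  have sub: "x \<in> \<Omega> \<Longrightarrow> x \<in> closure \<Omega>" for x using closure_subset by blast
  have D\<rho>x: "((\<lambda>s. \<rho> (x + s *\<^sub>R axis i 1) t) has_real_derivative dx i \<rho> x t) (at 0)"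
    and Dex: "((\<lambda>s. e (x + s *\<^sub>R axis i 1) t) has_real_derivative dx i e x t) (at 0)"
    and Dexx: "((\<lambda>s. dx i e (x + s *\<^sub>R axis j 1) t) has_real_derivative dx j (dx i e) x t) (at 0)"
    and Dux: "((\<lambda>s. u (x + s *\<^sub>R axis i 1) t $ k) has_real_derivative dx i u x t $ k) (at 0)"
    if "x \<in> \<Omega>" "t \<in> {0..T}" for x t i j k
    using C21_has_dx[OF C21\<rho> that] C21_has_dx[OF C21e that]
      bounded_linear.has_vector_derivative[OF bounded_linear_vec_nth C21_has_dx(1)[OF C21u that]]
    by (simp_all add: has_real_derivative_iff_has_vector_derivative)
  have D\<rho>t: "(\<rho> x has_real_derivative dt T \<rho> x t) (at t)"
    and Det: "(e x has_real_derivative dt T e x t) (at t)" if "x \<in> \<Omega>" "t \<in> {0<..<T}" for x t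
    using C21_has_dt[OF C21\<rho> that] C21_has_dt[OF C21e that]
    by (simp_all add: has_real_derivative_iff_has_vector_derivative)
  have du: "dx i (\<lambda>z r. u z r $ k) x t = dx i u x t $ k" if "x \<in> \<Omega>" "t \<in> {0..T}" for x t i k
    using Dux[OF that, of i k] by (intro dx_eqI) (simp add: has_real_derivative_iff_has_vector_derivative)
  have transport: "dt T \<rho> x t + (\<Sum>i\<in>UNIV. u x t $ i * dx i \<rho> x t) + \<rho> x t * dv x t = 0"
    if x: "x \<in> \<Omega>" and t: "t \<in> {0<..<T}" for x t
  proof -
    have tt: "t \<in> {0..T}" "t \<in> {0<..T}" using t by auto
    have "dx i (\<lambda>y s. \<rho> y s * u y s $ i) x t = u x t $ i * dx i \<rho> x t + \<rho> x t * (dx i u x t $ i)" for i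
      using DERIV_mult[OF D\<rho>x[OF x tt(1), of i] Dux[OF x tt(1), of i i]]
      by (intro dx_eqI) (simp add: has_real_derivative_iff_has_vector_derivative algebra_simps)
    thus ?thesis using mass[OF x tt(2)] by (simp add: dv_def sum.distrib sum_distrib_left)
  qed
  have heat: "\<kappa> * (\<gamma> - 1) / R * (\<Sum>i\<in>UNIV. dx i (dx i e) x t)
      \<le> \<rho> x t * (dt T e x t + (\<Sum>i\<in>UNIV. u x t $ i * dx i e x t) + (\<gamma> - 1) * dv x t * e x t)"
    if x: "x \<in> \<Omega>" and t: "t \<in> {0<..<T}" for x t
  proof -
    have tt: "t \<in> {0..T}" "t \<in> {0<..T}" using t by auto
    have 1: "dx i (\<lambda>y s. \<rho> y s * e y s * u y s $ i) x t
        = e x t * (u x t $ i * dx i \<rho> x t) + \<rho> x t * (u x t $ i * dx i e x t) + e x t * (\<rho> x t * dx i u x t $ i)" for i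
      using DERIV_mult[OF DERIV_mult[OF D\<rho>x[OF x tt(1), of i] Dex[OF x tt(1), of i]] Dux[OF x tt(1), of i i]]
      by (intro dx_eqI) (simp add: has_real_derivative_iff_has_vector_derivative algebra_simps)
    have 2: "dt T (\<lambda>y s. \<rho> y s * e y s) x t = e x t * dt T \<rho> x t + \<rho> x t * dt T e x t"
      using DERIV_mult[OF D\<rho>t[OF x t] Det[OF x t]] t
      by (intro dt_eqI) (simp_all add: has_real_derivative_iff_has_vector_derivative algebra_simps)
    define a where "a = (\<lambda>i j. dx j u x t $ i)"
    have diss: "0 \<le> \<mu> / 2 * (\<Sum>i\<in>UNIV. \<Sum>j\<in>UNIV. (a i j + a j i)\<^sup>2) + lam * (\<Sum>i\<in>UNIV. a i i)\<^sup>2"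
      by (rule dissipation_nonneg[OF \<mu>])
    have "e x t * dt T \<rho> x t + \<rho> x t * dt T e x t
        + (e x t * (\<Sum>i\<in>UNIV. u x t $ i * dx i \<rho> x t) + \<rho> x t * (\<Sum>i\<in>UNIV. u x t $ i * dx i e x t)
           + e x t * (\<rho> x t * dv x t)) + (\<gamma> - 1) * \<rho> x t * e x t * dv x t
      = \<mu> / 2 * (\<Sum>i\<in>UNIV. \<Sum>j\<in>UNIV. (a i j + a j i)\<^sup>2) + lam * (\<Sum>i\<in>UNIV. a i i)\<^sup>2
        + \<kappa> * (\<gamma> - 1) / R * (\<Sum>i\<in>UNIV. dx i (dx i e) x t)"
      using energy[OF x tt(2)]
      by (simp add: 1 2 du[OF x tt(1)] a_def dv_def sum.distrib sum_distrib_left)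
    \<comment> \<open>Regrouping isolates \<open>e\<close> times the continuity equation, which
      vanishes by \<open>transport\<close>.\<close>
    moreover have "e x t * dt T \<rho> x t + \<rho> x t * dt T e x t
        + (e x t * (\<Sum>i\<in>UNIV. u x t $ i * dx i \<rho> x t) + \<rho> x t * (\<Sum>i\<in>UNIV. u x t $ i * dx i e x t)
           + e x t * (\<rho> x t * dv x t)) + (\<gamma> - 1) * \<rho> x t * e x t * dv x t
      = e x t * (dt T \<rho> x t + (\<Sum>i\<in>UNIV. u x t $ i * dx i \<rho> x t) + \<rho> x t * dv x t)
        + \<rho> x t * (dt T e x t + (\<Sum>i\<in>UNIV. u x t $ i * dx i e x t) + (\<gamma> - 1) * dv x t * e x t)"
      by (simp add: algebra_simps)
    ultimately show ?thesis using diss transport[OF x t] by simp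
  qed
  \<comment> \<open>The boundary condition is given for positive times; continuity up to the closed
    cylinder extends it to time 0.\<close>
  have e_fr0: "e x t = 0" if x: "x \<in> frontier \<Omega>" and t: "t \<in> {0..T}" for x t
  proof -
    have cl: "closure {0<..T} = {0..T}" using T by simp
    have "x \<in> closure \<Omega>" using x by (simp add: frontier_def)
    hence "continuous_on {0..T} (\<lambda>s. case (x, s) of (x, s) \<Rightarrow> e x s)"
      by (intro continuous_on_compose2[OF cont(3)] continuous_intros) auto
    hence "continuous_on (closure {0<..T}) (e x)" unfolding cl by simp
    from continuous_constant_on_closure[OF this, of 0 t] e_fr[OF x] t cl show ?thesis by blast
  qed
  interpret degenerate_heat_flow \<Omega> T C "\<kappa> * (\<gamma> - 1) / R" "\<gamma> - 1" \<rho> e dv "dt T \<rho>" "dt T e" u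
    "\<lambda>i. dx i \<rho>" "\<lambda>i. dx i e" "\<lambda>i j. dx j (dx i e)"
  proof
    show "1 \<le> C" "\<bar>\<gamma> - 1\<bar> \<le> C" using C_simps by (simp_all add: C_def)
    show "0 < \<kappa> * (\<gamma> - 1) / R" using \<kappa> \<gamma> R by simp
    fix x t i j assume x: "x \<in> \<Omega>" and t: "t \<in> {0..T}"
    show "\<bar>\<rho> x t\<bar> \<le> C" using B1(2)[rule_format, OF sub[OF x] t] C_simps by (simp add: C_def)
    show "\<bar>u x t $ i\<bar> \<le> C"
      using order_trans[OF component_le_norm_cart B2(2)[rule_format, OF sub[OF x] t], of i] C_simps by (simp add: C_def)
    show "\<bar>dt T \<rho> x t\<bar> \<le> C" using B4(2)[rule_format, OF x t] C_simps by (simp add: C_def)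
    show "\<bar>dx j (dx i e) x t\<bar> \<le> C" using B6(2)[OF x t, of j i] B6_le[of i j] C_simps by (simp add: C_def)
    have "\<bar>dv x t\<bar> \<le> s5"
      unfolding dv_def s5_def
      by (intro order_trans[OF sum_abs] sum_mono order_trans[OF component_le_norm_cart B5(2)[OF x t]])
    thus "\<bar>dv x t\<bar> \<le> C" using C_simps by (simp add: C_def)
  next
    fix x t assume x: "x \<in> closure \<Omega>" and t: "t \<in> {0..T}"
    show "\<bar>e x t\<bar> \<le> C" using B3(2)[rule_format, OF x t] C_simps by (simp add: C_def)
  next
    fix x t i j assume x: "x \<in> \<Omega>" and t: "t \<in> {0<..<T}"
    hence tt: "t \<in> {0..T}" by auto
    show "((\<lambda>s. \<rho> (x + s *\<^sub>R axis i 1) t) has_real_derivative dx i \<rho> x t) (at 0)"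
      "((\<lambda>s. e (x + s *\<^sub>R axis i 1) t) has_real_derivative dx i e x t) (at 0)"
      "((\<lambda>s. dx i e (x + s *\<^sub>R axis j 1) t) has_real_derivative dx j (dx i e) x t) (at 0)"
      using D\<rho>x[OF x tt] Dex[OF x tt] Dexx[OF x tt] by auto
  next
    fix x t i assume "x \<in> frontier \<Omega>" "t \<in> {0<..<T}"
    thus "((\<lambda>y. dx i e y t) \<longlongrightarrow> 0) (at x within \<Omega>)" by (intro de_fr) auto
  qed (fact op bd cont D\<rho>t Det transport heat \<rho>_pos e_nonneg e_fr0)+
  have "0 < e y0 0" using e_nonneg[OF y0(1)] y0(2) by simp
  from no_solution[OF sb T y0(1) this] show False .
qed

theorem theorem4p1:
  fixes \<Omega> :: "(real^'n) set"
    and \<mu> lam \<kappa> \<gamma> R T :: real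
    and \<rho>0 e0 :: "real^'n \<Rightarrow> real"
    and u0 :: "real^'n \<Rightarrow> real^'n"
  assumes "open \<Omega>" and "bounded \<Omega>" and "smooth_boundary \<Omega>"
    and "\<mu> > 0" and "2 * \<mu> + real CARD('n) * lam \<ge> 0" and "\<kappa> > 0" and "\<gamma> > 1" and "R > 0"
    and "continuous_on (closure \<Omega>) \<rho>0" and "\<forall>x\<in>\<Omega>. \<rho>0 x > 0" and "\<forall>x\<in>frontier \<Omega>. \<rho>0 x = 0"
    and "continuous_on (closure \<Omega>) u0" and "continuous_on (closure \<Omega>) e0"
    and "\<forall>x\<in>\<Omega>. e0 x \<ge> 0" and "\<exists>x\<in>\<Omega>. e0 x \<noteq> 0"
    and "T > 0"
  shows "\<not> (\<exists>(\<rho>::real^'n \<Rightarrow> real \<Rightarrow> real) (u::real^'n \<Rightarrow> real \<Rightarrow> real^'n) (e::real^'n \<Rightarrow> real \<Rightarrow> real).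
     C21 \<Omega> T \<rho> \<and> C21 \<Omega> T u \<and> C21 \<Omega> T e \<and>
     (let p = (\<lambda>y s. (\<gamma> - 1) * \<rho> y s * e y s);
          divu = (\<lambda>y s. \<Sum>i\<in>UNIV. dx i (\<lambda>z r. u z r $ i) y s)
      in (\<forall>x\<in>\<Omega>. \<forall>t\<in>{0<..T}.
          dt T \<rho> x t + (\<Sum>i\<in>UNIV. dx i (\<lambda>y s. \<rho> y s * u y s $ i) x t) = 0 \<and>
          dt T (\<lambda>y s. \<rho> y s *\<^sub>R u y s) x t
            + (\<Sum>i\<in>UNIV. dx i (\<lambda>y s. (\<rho> y s * u y s $ i) *\<^sub>R u y s) x t)
            + (\<chi> j. dx j p x t)
          = \<mu> *\<^sub>R (\<Sum>i\<in>UNIV. dx i (dx i u) x t) + (\<mu> + lam) *\<^sub>R (\<chi> j. dx j divu x t) \<and>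
          dt T (\<lambda>y s. \<rho> y s * e y s) x t
            + (\<Sum>i\<in>UNIV. dx i (\<lambda>y s. \<rho> y s * e y s * u y s $ i) x t)
            + p x t * divu x t
          = \<mu> / 2 * (\<Sum>i\<in>UNIV. \<Sum>j\<in>UNIV.
                 (dx j (\<lambda>y s. u y s $ i) x t + dx i (\<lambda>y s. u y s $ j) x t)\<^sup>2)
            + lam * (divu x t)\<^sup>2
            + \<kappa> * (\<gamma> - 1) / R * (\<Sum>i\<in>UNIV. dx i (dx i e) x t))) \<and>
     (\<forall>x\<in>\<Omega>. \<rho> x 0 = \<rho>0 x \<and> u x 0 = u0 x \<and> e x 0 = e0 x) \<and>
     (\<forall>x\<in>frontier \<Omega>. \<forall>t\<in>{0<..T}. e x t = 0 \<and>
        (\<forall>i. ((\<lambda>y. dx i e y t) \<longlongrightarrow> 0) (at x within \<Omega>))))"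
proof (intro notI, elim exE conjE, unfold Let_def)
  fix \<rho> e :: "real^'n \<Rightarrow> real \<Rightarrow> real" and u :: "real^'n \<Rightarrow> real \<Rightarrow> real^'n"
  assume C21: "C21 \<Omega> T \<rho>" "C21 \<Omega> T u" "C21 \<Omega> T e"
    and init: "\<forall>x\<in>\<Omega>. \<rho> x 0 = \<rho>0 x \<and> u x 0 = u0 x \<and> e x 0 = e0 x"
    and bdry: "\<forall>x\<in>frontier \<Omega>. \<forall>t\<in>{0<..T}. e x t = 0 \<and> (\<forall>i. ((\<lambda>y. dx i e y t) \<longlongrightarrow> 0) (at x within \<Omega>))"
  assume eqs: "\<forall>x\<in>\<Omega>. \<forall>t\<in>{0<..T}.
      dt T \<rho> x t + (\<Sum>i\<in>UNIV. dx i (\<lambda>y s. \<rho> y s * u y s $ i) x t) = 0 \<and>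
      dt T (\<lambda>y s. \<rho> y s *\<^sub>R u y s) x t
        + (\<Sum>i\<in>UNIV. dx i (\<lambda>y s. (\<rho> y s * u y s $ i) *\<^sub>R u y s) x t)
        + (\<chi> j. dx j (\<lambda>y s. (\<gamma> - 1) * \<rho> y s * e y s) x t)
      = \<mu> *\<^sub>R (\<Sum>i\<in>UNIV. dx i (dx i u) x t)
        + (\<mu> + lam) *\<^sub>R (\<chi> j. dx j (\<lambda>y s. \<Sum>i\<in>UNIV. dx i (\<lambda>z r. u z r $ i) y s) x t) \<and>
      dt T (\<lambda>y s. \<rho> y s * e y s) x t
        + (\<Sum>i\<in>UNIV. dx i (\<lambda>y s. \<rho> y s * e y s * u y s $ i) x t)
        + (\<gamma> - 1) * \<rho> x t * e x t * (\<Sum>i\<in>UNIV. dx i (\<lambda>z r. u z r $ i) x t)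
      = \<mu> / 2 * (\<Sum>i\<in>UNIV. \<Sum>j\<in>UNIV.
             (dx j (\<lambda>y s. u y s $ i) x t + dx i (\<lambda>y s. u y s $ j) x t)\<^sup>2)
        + lam * (\<Sum>i\<in>UNIV. dx i (\<lambda>z r. u z r $ i) x t)\<^sup>2
        + \<kappa> * (\<gamma> - 1) / R * (\<Sum>i\<in>UNIV. dx i (dx i e) x t)"
  obtain y0 where y0: "y0 \<in> \<Omega>" "e0 y0 \<noteq> 0" using assms(15) by blast
  show False
  proof (rule no_smooth_solution[OF assms(1-3,16,4-8) C21 _ _ _ _ y0(1)])
    show "e y0 0 \<noteq> 0" using init y0 by simp
  qed (use eqs init bdry assms(10,14) in auto)
qed

end
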